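(* Let $b_1,\dots,b_s\in\mathcal{H}$ and let $\mathcal{L}_j=\mathcal{L}_{b_j}$ be the associated $U$-systems, $j=1,\dots,s$. Let $G_j=\sum_{h\in H}\mathcal{L}_ja(h)\,\chi_h\in L^2(\widehat H)$, $j=1,\dots,s$, and assume that all $G_j$ belong to $L^\infty(\widehat H)$; or equivalently, that $\beta_{\mathbb{G}}<\infty$ for the associated $s\times r$ matrix $\mathbb{G}(\xi)$. The following statements are equivalent: (a) $\operatorname{ess\,inf}_{\xi\in\Omega}\det[\mathbb{G}^*(\xi)\mathbb{G}(\xi)]>0$. (b) $\alpha_{\mathbb{G}}>0$. (c) There exists a vector $[H_1(\xi),H_2(\xi),\dots,H_s(\xi)]$ with entries in $L^\infty(\widehat H)$ satisfying $[H_1(\xi),H_2(\xi),\dots,H_s(\xi)]\,\mathbb{G}(\xi)=[1,0,\dots,0]$ for a.e. $\xi\in\widehat H$. (d) There exist $c_j\in\mathcal{A}_a$, $j=1,\dots,s$, such that the sequence $\{U(m)c_j\}_{m\in M;\,j=1,\dots,s}$ is a frame for $\mathcal{A}_a$, and for any $x\in\mathcal{A}_a$ the expansion $x=\sum_{j=1}^s\sum_{m\in M}\mathcal{L}_jx(m)\,U(m)c_j$ holds in $\mathcal{H}$. (e) There exists a frame $\{C_{j,m}\}_{m\in M;\,j=1,\dots,s}$ for $\mathcal{A}_a$ such that, for each $x\in\mathcal{A}_a$, the expansion $x=\sum_{j=1}^s\sum_{m\in M}\mathcal{L}_jx(m)\,C_{j,m}$ holds in $\mathcal{H}$. In case the equivalent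 conditions are satisfied, for the elements $c_j$ in (d) we have $c_j=\mathcal{T}_{H,a}(rH_j)$, $j=1,\dots,s$, for some functions $H_1,\dots,H_s\in L^\infty(\widehat H)$ satisfying $[H_1(\xi),\dots,H_s(\xi)]\,\mathbb{G}(\xi)=[1,0,\dots,0]$ for a.e. $\xi\in\widehat H$.
   Context: $G$ is a second countable locally compact abelian Hausdorff group, written additively. $M\subseteq H\subseteq G$ are countable (finite or countably infinite) uniform lattices in $G$, i.e. discrete subgroups with compact quotient in $G$; then $H/M$ is finite. $\widehat H$ is the (compact) dual group of $H$, with Haar measure $m_{\widehat H}$ normalized by $m_{\widehat H}(\widehat H)=1$; $(h,\gamma)\in\mathbb{T}$ denotes the value of $\gamma\in\widehat H$ at $h\in H$, and $\chi_h(\gamma)=(h,\gamma)$, so $\{\chi_h\}_{h\in H}$ is an orthonormal basis of $L^2(\widehat H)$. $g\mapsto U(g)$ is a continuous unitary representation of $G$ in a complex separable Hilbert space $\mathcal{H}$. $a\in\mathcal{H}$ is fixed and $\{U(h)a\}_{h\in H}$ is assumed to be a Riesz sequence in $\mathcal{H}$; $\mathcal{A}_a=\overline{\operatorname{span}}\{U(h)a: h\in H\}=\{\sum_{h\in H}\alpha_hU(h)a:\{\alpha_h\}\in\ell^2(H)\}$. The isomorphism $\mathcal{T}_{H,a}:L^2(\widehat H)\to\mathcal{A}_a$ is $\sum_{h}\alpha_h\chi_h\mapsto\sum_h\alpha_hU(h)a$. For $b\in\mathcal{H}$, the $U$-system $\mathcal{L}_b$ maps $x\in\mathcal{H}$ to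 the continuous function $\mathcal{L}_bx(g)=\langle x,U(g)b\rangle_{\mathcal{H}}$, $g\in G$. $M^\perp=\{\gamma\in\widehat H:(m,\gamma)=1\ \forall m\in M\}=\{\mu_0^\perp=0,\mu_1^\perp,\dots,\mu_{r-1}^\perp\}$ is the (finite) annihilator of $M$ in $\widehat H$, of order $r$. $\Omega\subset\widehat H$ is a Borel section of $\widehat H/M^\perp$, i.e. $\widehat H$ is the disjoint union of $\mu_n^\perp+\Omega$, $n=0,\dots,r-1$. For $G_1,\dots,G_s\in L^2(\widehat H)$, $\mathbb{G}(\xi)=[G_j(\xi+\mu_k^\perp)]_{j=1,\dots,s;\ k=0,\dots,r-1}$ is an $s\times r$ matrix (the formula makes sense for all $\xi\in\widehat H$), $\mathbb{G}^*(\xi)$ is its conjugate transpose, $\alpha_{\mathbb{G}}=\operatorname{ess\,inf}_{\xi\in\Omega}\lambda_{\min}[\mathbb{G}^*(\xi)\mathbb{G}(\xi)]$ and $\beta_{\mathbb{G}}=\operatorname{ess\,sup}_{\xi\in\Omega}\lambda_{\max}[\mathbb{G}^*(\xi)\mathbb{G}(\xi)]$, where $\lambda_{\min},\lambda_{\max}$ denote the smallest and largest eigenvalues. *)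

theory Defs
  imports
    "HOL-Analysis.Analysis"
    "HOL-Probability.Essential_Supremum"
    "Jordan_Normal_Form.Schur_Decomposition"
    "Jordan_Normal_Form.Spectral_Radius"
begin

section \<open>Complex separable Hilbert spaces\<close>

text \<open>The inner product is linear in its first argument. Separability is expressed by second
  countability, which is equivalent to it for metric spaces.\<close>

class complex_hilbert_space = banach + second_countable_topology +
  fixes scaleC :: "complex \<Rightarrow> 'a \<Rightarrow> 'a"
    and cinner :: "'a \<Rightarrow> 'a \<Rightarrow> complex"
  assumes scaleC_add_right: "scaleC c (x + y) = scaleC c x + scaleC c y"
    and scaleC_add_left: "scaleC (c + d) x = scaleC c x + scaleC d x"
    and scaleC_scaleC: "scaleC c (scaleC d x) = scaleC (c * d) x"
    and scaleC_one: "scaleC 1 x = x"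
    and scaleR_scaleC: "scaleR t x = scaleC (of_real t) x"
    and cinner_commute: "cinner x y = cnj (cinner y x)"
    and cinner_add_left: "cinner (x + y) z = cinner x z + cinner y z"
    and cinner_scaleC_left: "cinner (scaleC c x) y = c * cinner x y"
    and cinner_self: "cinner x x = of_real ((norm x)\<^sup>2)"

interpretation complex_vector: vector_space "scaleC :: complex \<Rightarrow> 'a \<Rightarrow> 'a :: complex_hilbert_space"
  by unfold_locales (rule scaleC_add_right scaleC_add_left scaleC_scaleC scaleC_one)+

instantiation complex :: complex_hilbert_space
begin

definition scaleC_complex :: "complex \<Rightarrow> complex \<Rightarrow> complex"
  where "scaleC_complex c x = c * x"

definition cinner_complex :: "complex \<Rightarrow> complex \<Rightarrow> complex"
  where "cinner_complex x y = x * cnj y"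

instance
proof
  fix c d x y z :: complex and t :: real
  show "scaleC c (x + y) = scaleC c x + scaleC c y"
    unfolding scaleC_complex_def by (rule distrib_left)
  show "scaleC (c + d) x = scaleC c x + scaleC d x"
    unfolding scaleC_complex_def by (rule distrib_right)
  show "scaleC c (scaleC d x) = scaleC (c * d) x"
    unfolding scaleC_complex_def by (rule mult.assoc[symmetric])
  show "scaleC 1 x = x"
    unfolding scaleC_complex_def by (rule mult_1_left)
  show "t *\<^sub>R x = scaleC (complex_of_real t) x"
    unfolding scaleC_complex_def by (rule scaleR_conv_of_real)
  show "cinner x y = cnj (cinner y x)"
    unfolding cinner_complex_def by (simp only: complex_cnj_mult complex_cnj_cnj mult.commute)
  show "cinner (x + y) z = cinner x z + cinner y z"
    unfolding cinner_complex_def by (rule distrib_right)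
  show "cinner (scaleC c x) y = c * cinner x y"
    unfolding cinner_complex_def scaleC_complex_def by (rule mult.assoc)
  show "cinner x x = complex_of_real ((norm x)\<^sup>2)"
    unfolding cinner_complex_def by (metis complex_norm_square of_real_power)
qed

end


section \<open>Uniform lattices\<close>

definition add_subgroup :: "'g::ab_group_add set \<Rightarrow> bool" where
  "add_subgroup H \<longleftrightarrow> 0 \<in> H \<and> (\<forall>x\<in>H. \<forall>y\<in>H. x + y \<in> H) \<and> (\<forall>x\<in>H. - x \<in> H)"

definition coset :: "'g::ab_group_add set \<Rightarrow> 'g \<Rightarrow> 'g set" where
  "coset H g = (\<lambda>h. g + h) ` H"

definition quotient_topology :: "'g::topological_ab_group_add set \<Rightarrow> 'g set topology" where
  "quotient_topology H = topology (\<lambda>V. V \<subseteq> range (coset H) \<and> open (coset H -` V))"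

lemma openin_quotient_topology:
  "openin (quotient_topology H) V \<longleftrightarrow> V \<subseteq> range (coset H) \<and> open (coset H -` V)"
proof -
  let ?L = "\<lambda>V. V \<subseteq> range (coset H) \<and> open (coset H -` V)"
  have "?L (S \<inter> T)" if "?L S" and "?L T" for S T
    using that open_Int[of "coset H -` S" "coset H -` T"] unfolding vimage_Int by blast
  moreover have "?L (\<Union>K)" if K: "\<forall>S\<in>K. ?L S" for K
  proof
    show "\<Union>K \<subseteq> range (coset H)"
      using K by (meson Sup_least)
    show "open (coset H -` \<Union>K)"
      unfolding vimage_Union using K by (intro open_UN) meson
  qed
  ultimately have "istopology ?L"
    unfolding istopology_def by meson
  then show ?thesis
    unfolding quotient_topology_def by (simp only: topology_inverse')
qed

lemma topspace_quotient_topology: "topspace (quotient_topology H) = range (coset H)"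
proof -
  have "openin (quotient_topology H) (range (coset H))"
    unfolding openin_quotient_topology by (metis open_UNIV subset_refl rangeI top.extremum_unique vimageI2 subsetI)
  then show ?thesis
    by (metis openin_quotient_topology openin_subset openin_topspace subset_antisym)
qed

lemma quotient_map_coset: "quotient_map euclidean (quotient_topology H) (coset H)"
  unfolding quotient_map_def topspace_quotient_topology openin_quotient_topology
  by (simp add: vimage_def)

definition uniform_lattice :: "'g::topological_ab_group_add set \<Rightarrow> bool" where
  "uniform_lattice H \<longleftrightarrow> add_subgroup H \<and> discrete H \<and> compact_space (quotient_topology H)"


section \<open>The dual group\<close>

text \<open>A character of \<open>H\<close> is represented by a function on the ambient group that is
  undefined outside \<open>H\<close>, so that distinct elements of the carrier are distinct characters.
  The value \<open>(h, \<gamma>)\<close> is \<open>\<gamma> h\<close>, so the function \<open>\<chi>\<^sub>h\<close> on the dual is \<open>\<lambda>\<gamma>. \<gamma> h\<close>.\<close>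

definition dual_group :: "'g::topological_ab_group_add set \<Rightarrow> ('g \<Rightarrow> complex) set" where
  "dual_group H = {\<gamma> \<in> extensional H. continuous_on H \<gamma> \<and> (\<forall>h\<in>H. cmod (\<gamma> h) = 1) \<and>
     (\<forall>h\<in>H. \<forall>k\<in>H. \<gamma> (h + k) = \<gamma> h * \<gamma> k)}"

definition dual_zero :: "'g set \<Rightarrow> 'g \<Rightarrow> complex" where
  "dual_zero H = (\<lambda>h\<in>H. 1)"

definition dual_add :: "'g set \<Rightarrow> ('g \<Rightarrow> complex) \<Rightarrow> ('g \<Rightarrow> complex) \<Rightarrow> 'g \<Rightarrow> complex" where
  "dual_add H \<gamma> \<delta> = (\<lambda>h\<in>H. \<gamma> h * \<delta> h)"

text \<open>The compact-open topology.\<close>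

definition dual_topology :: "'g::topological_ab_group_add set \<Rightarrow> ('g \<Rightarrow> complex) topology" where
  "dual_topology H = topology_generated_by
     {{\<gamma> \<in> dual_group H. \<gamma> ` K \<subseteq> V} |K V. compact K \<and> K \<subseteq> H \<and> open V}"

text \<open>The normalized Haar measure on the Borel sets of the dual group. For countable discrete
  \<open>H\<close> the dual is compact and metrizable, so regularity is automatic, and these
  conditions determine the measure uniquely.\<close>

definition normalized_haar_measure ::
    "'g::topological_ab_group_add set \<Rightarrow> ('g \<Rightarrow> complex) measure \<Rightarrow> bool" where
  "normalized_haar_measure H m \<longleftrightarrow>
     space m = dual_group H \<and>
     sets m = sigma_sets (dual_group H) {V. openin (dual_topology H) V} \<and>
     emeasure m (dual_group H) = 1 \<and>
     (\<forall>\<gamma>\<in>dual_group H. \<forall>A\<in>sets m. emeasure m (dual_add H \<gamma> ` A) = emeasure m A)"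

definition annihilator :: "'g::topological_ab_group_add set \<Rightarrow> 'g set \<Rightarrow> ('g \<Rightarrow> complex) set" where
  "annihilator H M = {\<gamma> \<in> dual_group H. \<forall>x\<in>M. \<gamma> x = 1}"

definition borel_section ::
    "'g::topological_ab_group_add set \<Rightarrow> ('g \<Rightarrow> complex) measure \<Rightarrow> ('g \<Rightarrow> complex) set \<Rightarrow>
      ('g \<Rightarrow> complex) set \<Rightarrow> bool" where
  "borel_section H m N \<Omega> \<longleftrightarrow> \<Omega> \<in> sets m \<and>
     (\<Union>\<nu>\<in>N. dual_add H \<nu> ` \<Omega>) = dual_group H \<and>
     disjoint_family_on (\<lambda>\<nu>. dual_add H \<nu> ` \<Omega>) N"


section \<open>Function spaces and essential bounds\<close>

definition L2 :: "'x measure \<Rightarrow> ('x \<Rightarrow> complex) set" where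
  "L2 m = {f. f \<in> borel_measurable m \<and> integrable m (\<lambda>x. (cmod (f x))\<^sup>2)}"

definition Linf :: "'x measure \<Rightarrow> ('x \<Rightarrow> complex) set" where
  "Linf m = {f. f \<in> borel_measurable m \<and> (\<exists>C. AE x in m. cmod (f x) \<le> C)}"

definition L2_has_sum ::
    "'x measure \<Rightarrow> ('i \<Rightarrow> 'x \<Rightarrow> complex) \<Rightarrow> ('x \<Rightarrow> complex) \<Rightarrow> 'i set \<Rightarrow> bool" where
  "L2_has_sum m f F I \<longleftrightarrow> F \<in> L2 m \<and> (\<forall>i\<in>I. f i \<in> L2 m) \<and>
     ((\<lambda>J. \<integral>x. (cmod (F x - (\<Sum>i\<in>J. f i x)))\<^sup>2 \<partial>m) \<longlongrightarrow> 0) (finite_subsets_at_top I)"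

definition essinf :: "'x measure \<Rightarrow> ('x \<Rightarrow> ereal) \<Rightarrow> ereal" where
  "essinf m f = Sup {c. AE x in m. c \<le> f x}"


section \<open>Riesz sequences, frames and U-systems\<close>

definition unitary_representation ::
    "('g::topological_ab_group_add \<Rightarrow> 'h::complex_hilbert_space \<Rightarrow> 'h) \<Rightarrow> bool" where
  "unitary_representation U \<longleftrightarrow>
     (\<forall>g. Vector_Spaces.linear scaleC scaleC (U g) \<and> surj (U g) \<and>
       (\<forall>x y. cinner (U g x) (U g y) = cinner x y)) \<and>
     (\<forall>g k. U (g + k) = U g \<circ> U k) \<and>
     (\<forall>x. continuous_on UNIV (\<lambda>g. U g x))"

definition riesz_sequence :: "'i set \<Rightarrow> ('i \<Rightarrow> 'h::complex_hilbert_space) \<Rightarrow> bool" where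
  "riesz_sequence I f \<longleftrightarrow> (\<exists>A B. 0 < A \<and> (\<forall>J \<alpha>. finite J \<and> J \<subseteq> I \<longrightarrow>
     A * (\<Sum>i\<in>J. (cmod (\<alpha> i))\<^sup>2) \<le> (norm (\<Sum>i\<in>J. scaleC (\<alpha> i) (f i)))\<^sup>2 \<and>
     (norm (\<Sum>i\<in>J. scaleC (\<alpha> i) (f i)))\<^sup>2 \<le> B * (\<Sum>i\<in>J. (cmod (\<alpha> i))\<^sup>2)))"

definition frame_for ::
    "'h::complex_hilbert_space set \<Rightarrow> 'i set \<Rightarrow> ('i \<Rightarrow> 'h) \<Rightarrow> bool" where
  "frame_for V I f \<longleftrightarrow> (\<forall>i\<in>I. f i \<in> V) \<and> (\<exists>A B. 0 < A \<and> (\<forall>x\<in>V.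
     (\<lambda>i. (cmod (cinner x (f i)))\<^sup>2) summable_on I \<and>
     A * (norm x)\<^sup>2 \<le> (\<Sum>\<^sub>\<infinity>i\<in>I. (cmod (cinner x (f i)))\<^sup>2) \<and>
     (\<Sum>\<^sub>\<infinity>i\<in>I. (cmod (cinner x (f i)))\<^sup>2) \<le> B * (norm x)\<^sup>2))"

definition U_system ::
    "('g \<Rightarrow> 'h::complex_hilbert_space \<Rightarrow> 'h) \<Rightarrow> 'h \<Rightarrow> 'h \<Rightarrow> 'g \<Rightarrow> complex" where
  "U_system U b x g = cinner x (U g b)"

definition closed_orbit_span ::
    "('g \<Rightarrow> 'h::complex_hilbert_space \<Rightarrow> 'h) \<Rightarrow> 'g set \<Rightarrow> 'h \<Rightarrow> 'h set" where
  "closed_orbit_span U H a = closure (complex_vector.span ((\<lambda>h. U h a) ` H))"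

text \<open>The isomorphism of \<open>L\<^sup>2\<close> of the dual onto the closed orbit span, which maps
  \<open>\<Sum>\<^sub>h \<alpha>\<^sub>h \<chi>\<^sub>h\<close> to \<open>\<Sum>\<^sub>h \<alpha>\<^sub>h U(h) a\<close>.\<close>

definition T_iso ::
    "('g \<Rightarrow> complex) measure \<Rightarrow> ('g \<Rightarrow> 'h::complex_hilbert_space \<Rightarrow> 'h) \<Rightarrow> 'g set \<Rightarrow> 'h \<Rightarrow>
      (('g \<Rightarrow> complex) \<Rightarrow> complex) \<Rightarrow> 'h" where
  "T_iso m U H a F = (THE x. \<exists>\<alpha>. L2_has_sum m (\<lambda>h \<gamma>. \<alpha> h * \<gamma> h) F H \<and>
     ((\<lambda>h. scaleC (\<alpha> h) (U h a)) has_sum x) H)"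

definition frame_expansion ::
    "('g \<Rightarrow> 'h::complex_hilbert_space \<Rightarrow> 'h) \<Rightarrow> 'g set \<Rightarrow> 'h set \<Rightarrow> nat \<Rightarrow> (nat \<Rightarrow> 'h) \<Rightarrow>
      (nat \<Rightarrow> 'g \<Rightarrow> 'h) \<Rightarrow> bool" where
  "frame_expansion U M V s b C \<longleftrightarrow>
     frame_for V ({..<s} \<times> M) (\<lambda>(j, k). C j k) \<and>
     (\<forall>x\<in>V. ((\<lambda>(j, k). scaleC (U_system U (b j) x k) (C j k)) has_sum x) ({..<s} \<times> M))"


section \<open>The matrix of a family of functions on the dual\<close>

definition G_mat ::
    "'g set \<Rightarrow> nat \<Rightarrow> nat \<Rightarrow> (nat \<Rightarrow> 'g \<Rightarrow> complex) \<Rightarrow>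
      (nat \<Rightarrow> ('g \<Rightarrow> complex) \<Rightarrow> complex) \<Rightarrow> ('g \<Rightarrow> complex) \<Rightarrow> complex mat" where
  "G_mat H s r \<mu> G \<xi> = Matrix.mat s r (\<lambda>(j, k). G j (dual_add H \<xi> (\<mu> k)))"

definition gram_mat :: "complex mat \<Rightarrow> complex mat" where
  "gram_mat A = mat_adjoint A * A"

text \<open>Smallest and largest eigenvalue of a Hermitian matrix; all eigenvalues are real then.\<close>

definition lambda_min :: "complex mat \<Rightarrow> real" where
  "lambda_min A = Min {t. eigenvalue A (complex_of_real t)}"

definition lambda_max :: "complex mat \<Rightarrow> real" where
  "lambda_max A = Max {t. eigenvalue A (complex_of_real t)}"

definition alpha_G ::
    "('g \<Rightarrow> complex) measure \<Rightarrow> ('g \<Rightarrow> complex) set \<Rightarrow>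
      (('g \<Rightarrow> complex) \<Rightarrow> complex mat) \<Rightarrow> ereal" where
  "alpha_G m \<Omega> GG = essinf (restrict_space m \<Omega>) (\<lambda>\<xi>. ereal (lambda_min (gram_mat (GG \<xi>))))"

definition beta_G ::
    "('g \<Rightarrow> complex) measure \<Rightarrow> ('g \<Rightarrow> complex) set \<Rightarrow>
      (('g \<Rightarrow> complex) \<Rightarrow> complex mat) \<Rightarrow> ereal" where
  "beta_G m \<Omega> GG = esssup (restrict_space m \<Omega>) (\<lambda>\<xi>. ereal (lambda_max (gram_mat (GG \<xi>))))"

text \<open>The determinant of a Gram matrix is real, hence equal to its real part.\<close>

definition essinf_det ::
    "('g \<Rightarrow> complex) measure \<Rightarrow> ('g \<Rightarrow> complex) set \<Rightarrow>
      (('g \<Rightarrow> complex) \<Rightarrow> complex mat) \<Rightarrow> ereal" where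
  "essinf_det m \<Omega> GG =
     essinf (restrict_space m \<Omega>) (\<lambda>\<xi>. ereal (Re (Determinant.det (gram_mat (GG \<xi>)))))"

definition left_inverse_row ::
    "('g \<Rightarrow> complex) measure \<Rightarrow> nat \<Rightarrow> nat \<Rightarrow> (('g \<Rightarrow> complex) \<Rightarrow> complex mat) \<Rightarrow>
      (nat \<Rightarrow> ('g \<Rightarrow> complex) \<Rightarrow> complex) \<Rightarrow> bool" where
  "left_inverse_row m s r GG F \<longleftrightarrow> (\<forall>j<s. F j \<in> Linf m) \<and>
     (AE \<xi> in m. mat_of_row (Matrix.vec s (\<lambda>j. F j \<xi>)) * GG \<xi> = mat_of_row (unit_vec r 0))"

end

theory Submission
  imports Defs "HOL-Probability.Probability_Measure"
begin

text \<open>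
The isomorphism \<open>T\<close> carries the problem to \<open>L\<^sup>2\<close> of the dual group. There the sample \<open>\<L>\<^sub>j x(m)\<close> of
\<open>x = T F\<close> is the Fourier coefficient of \<open>F G\<^sub>j\<close> at \<open>m\<close>, so the samples on \<open>M\<close> are the coefficients of the
periodization \<open>P(F G\<^sub>j)\<close> (\<open>periodize\<close> below), the average of \<open>F G\<^sub>j\<close> over the annihilator of \<open>M\<close>. The expansion with generators
\<open>T (r H\<^sub>j)\<close> becomes \<open>F = \<Sum>\<^sub>j r H\<^sub>j P(F G\<^sub>j)\<close>, which is the pointwise identity \<open>[H\<^sub>1, \<dots>, H\<^sub>s] \<G> = [1, 0, \<dots>, 0]\<close>.

The equivalence is a cycle. A determinant bounded below gives bounded \<open>H\<^sub>j\<close> as the first row of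
\<open>(\<G>\<^sup>* \<G>)\<^sup>-\<^sup>1 \<G>\<^sup>*\<close>. An expansion in a frame bounds the energy of the samples from below, and testing this on
functions concentrated on the translates of a subset of \<open>\<Omega>\<close> bounds \<open>\<lambda>\<^sub>m\<^sub>i\<^sub>n\<close> from below, hence also the
determinant, the product of the eigenvalues.
\<close>

section \<open>Complex Hilbert spaces\<close>

text \<open>Expansions and frame bounds are linked by \<open>has_sum_norm_lower\<close>: if x is the
  sum of the vectors e i with coefficients d i, the fourth power of norm x is at most the energy of
  the d i times the energy of the numbers \<open>cinner x (e i)\<close>. An upper bound for one
  energy is thus a lower bound for the other. This gives the lower frame bound of the constructed
  generators and, conversely, the lower bound for the samples.

  Bounded factors make multiplication bounded on L2, hence the sums over M convergent. In the last
  claim the c_j are only known to come from L2; that their preimages are bounded is extracted from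
  the upper frame bound.

  Two facts about the dual carry the transfer to L2: the characters of H span a dense subspace, and
  a point of H outside M is separated from M by a character in the annihilator, found with Zorn's
  lemma. The factor r compensates the 1/r of the average. The null set in the eigenvalue test
  depends on the vector, so a countable dense set of vectors is tested.\<close>

lemma cinner_add_right: "cinner x (y + z) = cinner x y + cinner x z"
  by (metis cinner_commute cinner_add_left complex_cnj_add)

lemma cinner_scaleC_right: "cinner x (scaleC c y) = cnj c * cinner x y"
  by (metis cinner_commute cinner_scaleC_left complex_cnj_mult)

lemma additive_cinner_left: "Modules.additive (\<lambda>x. cinner x y)"
  by (simp add: Modules.additive_def cinner_add_left)

lemma additive_cinner_right: "Modules.additive (cinner x)"
  by (simp add: Modules.additive_def cinner_add_right)

lemmas cinner_diff_left = Modules.additive.diff[OF additive_cinner_left]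
  and cinner_sum_left = Modules.additive.sum[OF additive_cinner_left]
  and cinner_diff_right = Modules.additive.diff[OF additive_cinner_right]
  and cinner_sum_right = Modules.additive.sum[OF additive_cinner_right]

lemma cmod_cinner_commute: "cmod (cinner x y) = cmod (cinner y x)"
  by (metis cinner_commute complex_mod_cnj)

lemma norm_scaleC: "norm (scaleC c x) = cmod c * norm x"
proof -
  have "complex_of_real ((norm (scaleC c x))\<^sup>2) = c * cnj c * of_real ((norm x)\<^sup>2)"
    unfolding cinner_self[symmetric] cinner_scaleC_left cinner_scaleC_right by (simp only: mult_ac)
  also have "\<dots> = of_real ((cmod c * norm x)\<^sup>2)"
    by (simp add: power_mult_distrib flip: complex_norm_square)
  finally have "(norm (scaleC c x))\<^sup>2 = (cmod c * norm x)\<^sup>2"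
    using of_real_eq_iff by blast
  then show ?thesis by (simp add: power2_eq_iff_nonneg)
qed

text \<open>Pythagoras for the part of x orthogonal to the unit vector y. Nonnegativity of the left
  side is the Cauchy-Schwarz inequality for unit vectors.\<close>

lemma norm_sub_projection:
  assumes "norm y = 1"
  shows "(norm (x - scaleC (cinner x y) y))\<^sup>2 = (norm x)\<^sup>2 - (cmod (cinner x y))\<^sup>2"
proof -
  let ?c = "cinner x y"
  have yy: "cinner y y = 1" using assms by (simp add: cinner_self)
  have "complex_of_real ((norm (x - scaleC ?c y))\<^sup>2)
      = cinner x x - cnj ?c * ?c - ?c * cinner y x + ?c * cnj ?c"
    unfolding cinner_self[symmetric] cinner_diff_left cinner_diff_right cinner_scaleC_left
      cinner_scaleC_right yy by (simp add: algebra_simps)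
  also have "cinner y x = cnj ?c" by (rule cinner_commute)
  finally have "complex_of_real ((norm (x - scaleC ?c y))\<^sup>2)
      = of_real ((norm x)\<^sup>2 - (cmod ?c)\<^sup>2)"
    by (simp add: cinner_self mult.commute flip: complex_norm_square)
  then show ?thesis using of_real_eq_iff by blast
qed

lemma cinner_Cauchy_Schwarz: "cmod (cinner x y) \<le> norm x * norm y"
proof (cases "y = 0")
  case True
  then show ?thesis using cinner_self[of y] by (simp add: Modules.additive.zero[OF additive_cinner_right])
next
  case False
  define c where "c = complex_of_real (inverse (norm y))"
  have n1: "norm (scaleC c y) = 1" using False by (simp add: norm_scaleC c_def norm_inverse)
  have "(cmod (cinner x (scaleC c y)))\<^sup>2 \<le> (norm x)\<^sup>2"
    using norm_sub_projection[OF n1, of x] by (metis diff_ge_0_iff_ge zero_le_power2)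
  then have "cmod (cinner x (scaleC c y)) \<le> norm x"
    using power2_le_imp_le norm_ge_zero by blast
  then show ?thesis using False
    by (simp add: cinner_scaleC_right c_def norm_mult norm_divide field_simps)
qed

lemma bounded_linear_cinner_left: "bounded_linear (\<lambda>x. cinner x y)"
proof (rule bounded_linear_intro[where K = "norm y"])
  show "cinner (c *\<^sub>R x) y = c *\<^sub>R cinner x y" for c x
    unfolding scaleR_scaleC[of c x] cinner_scaleC_left scaleR_conv_of_real ..
qed (auto simp: cinner_add_left cinner_Cauchy_Schwarz)

lemma bounded_linear_scaleC: "bounded_linear (scaleC c)"
  by (rule bounded_linear_intro[where K = "cmod c"])
    (auto simp: scaleC_add_right scaleR_scaleC scaleC_scaleC norm_scaleC mult.commute)

section \<open>Synthesis operators\<close>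

text \<open>If x is itself the combination of the \<open>e i\<close> with coefficients
  \<open>d i\<close>, the sum on the left is \<open>cinner x x\<close>, and the inequality bounds
  the fourth power of \<open>norm x\<close>. It is used in this way for finite sums and, in the
  limit, for convergent expansions.\<close>

lemma sum_mult_cinner_le:
  assumes "finite J"
  shows "(cmod (\<Sum>i\<in>J. d i * cinner (e i) x))\<^sup>2
    \<le> (\<Sum>i\<in>J. (cmod (d i))\<^sup>2) * (\<Sum>i\<in>J. (cmod (cinner x (e i)))\<^sup>2)"
proof -
  have "cmod (\<Sum>i\<in>J. d i * cinner (e i) x) \<le> (\<Sum>i\<in>J. cmod (d i) * cmod (cinner x (e i)))"
    by (rule order.trans[OF norm_sum]) (simp add: norm_mult cmod_cinner_commute)
  then have "(cmod (\<Sum>i\<in>J. d i * cinner (e i) x))\<^sup>2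
      \<le> (\<Sum>i\<in>J. cmod (d i) * cmod (cinner x (e i)))\<^sup>2"
    by (simp add: power_mono)
  also have "\<dots> \<le> (\<Sum>i\<in>J. (cmod (d i))\<^sup>2) * (\<Sum>i\<in>J. (cmod (cinner x (e i)))\<^sup>2)"
    by (rule Cauchy_Schwarz_ineq_sum)
  finally show ?thesis .
qed

text \<open>An operator and its adjoint have the same norm: the synthesis bound is applied to the
  coefficients \<open>cinner x (e i)\<close> themselves, which gives S^2 <= (norm x)^2 B S for their
  energy S.\<close>

lemma analysis_bound_of_synthesis_bound:
  assumes "0 \<le> B"
    and B: "\<And>d. (norm (\<Sum>i\<in>J. scaleC (d i) (e i)))\<^sup>2 \<le> B * (\<Sum>i\<in>J. (cmod (d i))\<^sup>2)"
  shows "(\<Sum>i\<in>J. (cmod (cinner x (e i)))\<^sup>2) \<le> B * (norm x)\<^sup>2"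
proof -
  define y where "y = (\<Sum>i\<in>J. scaleC (cinner x (e i)) (e i))"
  define S where "S = (\<Sum>i\<in>J. (cmod (cinner x (e i)))\<^sup>2)"
  have S0: "0 \<le> S" unfolding S_def by (rule sum_nonneg) simp
  have "cinner x y = of_real S"
    unfolding y_def S_def cinner_sum_right cinner_scaleC_right of_real_sum
    by (rule sum.cong[OF refl]) (metis complex_norm_square mult.commute)
  then have "S \<le> norm x * norm y"
    using cinner_Cauchy_Schwarz[of x y] S0 by simp
  then have "S\<^sup>2 \<le> (norm x)\<^sup>2 * (norm y)\<^sup>2"
    using S0 by (metis power_mono power_mult_distrib)
  also have "\<dots> \<le> (norm x)\<^sup>2 * (B * S)"
    using B[of "\<lambda>i. cinner x (e i)"] unfolding y_def S_def by (intro mult_left_mono) auto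
  finally have "S * S \<le> (B * (norm x)\<^sup>2) * S" by (simp add: power2_eq_square mult_ac)
  then show ?thesis unfolding S_def[symmetric] using S0 \<open>0 \<le> B\<close>
    by (cases "S = 0") auto
qed

text \<open>The Cauchy criterion for unconditional sums: small tails make the net of finite partial
  sums Cauchy, and the space is complete.\<close>

lemma cauchy_filter_finite_subsets_sum_summable:
  fixes f :: "'i \<Rightarrow> 'a::banach"
  assumes "\<And>e. e > 0 \<Longrightarrow> \<exists>P. finite P \<and> P \<subseteq> I \<and>
    (\<forall>J. finite J \<and> J \<subseteq> I \<and> J \<inter> P = {} \<longrightarrow> norm (sum f J) < e)"
  shows "f summable_on I"
proof -
  have "cauchy_filter (filtermap (sum f) (finite_subsets_at_top I))"
    unfolding cauchy_filter_metric_filtermap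
  proof (intro allI impI)
    fix e :: real assume "e > 0"
    then obtain P where P: "finite P" "P \<subseteq> I"
      and PJ: "\<And>J. finite J \<Longrightarrow> J \<subseteq> I \<Longrightarrow> J \<inter> P = {} \<Longrightarrow> norm (sum f J) < e / 2"
      using assms[of "e / 2"] by (metis half_gt_zero)
    define Q where "Q J \<longleftrightarrow> finite J \<and> P \<subseteq> J \<and> J \<subseteq> I" for J
    have "dist (sum f J) (sum f K) < e" if "Q J" "Q K" for J K
    proof -
      have *: "sum f L = sum f P + sum f (L - P)" if "Q L" for L
        using that sum.subset_diff[of P L f] by (simp add: Q_def add.commute)
      have **: "norm (sum f (L - P)) < e / 2" if "Q L" for L
        using that by (intro PJ) (auto simp: Q_def)
      have "dist (sum f J) (sum f K) = norm (sum f (J - P) - sum f (K - P))"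
        using *[OF that(1)] *[OF that(2)] by (simp add: dist_norm)
      also have "\<dots> < e"
        using **[OF that(1)] **[OF that(2)] norm_triangle_ineq4[of "sum f (J - P)" "sum f (K - P)"]
        by linarith
      finally show ?thesis .
    qed
    moreover have "eventually Q (finite_subsets_at_top I)"
      unfolding Q_def eventually_finite_subsets_at_top using P by blast
    ultimately show "\<exists>Q. eventually Q (finite_subsets_at_top I) \<and>
        (\<forall>J K. Q J \<and> Q K \<longrightarrow> dist (sum f J) (sum f K) < e)"
      by blast
  qed
  then obtain L where "(sum f \<longlongrightarrow> L) (finite_subsets_at_top I)"
    using cauchy_filter_complete_converges[of "filtermap (sum f) (finite_subsets_at_top I)" UNIV]
    by (auto simp: complete_UNIV filterlim_def filtermap_bot_iff)
  then show ?thesis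
    unfolding summable_on_def has_sum_def by blast
qed

text \<open>The sum over J is the difference of the sums over \<open>J \<union> P\<close> and over
  P, both of which lie within e / 2 of the total.\<close>

lemma summable_on_tail_less:
  fixes f :: "'i \<Rightarrow> real"
  assumes f: "f summable_on I" and "e > 0"
  shows "\<exists>P. finite P \<and> P \<subseteq> I \<and> (\<forall>J. finite J \<and> J \<subseteq> I \<and> J \<inter> P = {} \<longrightarrow> \<bar>sum f J\<bar> < e)"
proof -
  obtain s where "(f has_sum s) I" using f by (auto simp: summable_on_def)
  then have "eventually (\<lambda>J. dist (sum f J) s < e / 2) (finite_subsets_at_top I)"
    using \<open>e > 0\<close> by (intro tendstoD) (auto simp: has_sum_def)
  then obtain P where P: "finite P" "P \<subseteq> I"
    and PJ: "\<And>J. finite J \<Longrightarrow> P \<subseteq> J \<Longrightarrow> J \<subseteq> I \<Longrightarrow> dist (sum f J) s < e / 2"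
    unfolding eventually_finite_subsets_at_top by auto
  have "\<bar>sum f J\<bar> < e" if J: "finite J" "J \<subseteq> I" "J \<inter> P = {}" for J
  proof -
    have "sum f (J \<union> P) = sum f J + sum f P"
      using J P by (simp add: sum.union_disjoint)
    moreover have "dist (sum f (J \<union> P)) s < e / 2" using J P by (intro PJ) auto
    moreover have "dist (sum f P) s < e / 2" using P by (intro PJ) auto
    ultimately show ?thesis unfolding dist_real_def by arith
  qed
  then show ?thesis using P by blast
qed

lemma synthesis_summable:
  assumes B: "\<And>J. finite J \<Longrightarrow> J \<subseteq> I \<Longrightarrow>
      (norm (\<Sum>i\<in>J. scaleC (d i) (e i)))\<^sup>2 \<le> B * (\<Sum>i\<in>J. (cmod (d i))\<^sup>2)"
    and d: "(\<lambda>i. (cmod (d i))\<^sup>2) summable_on I"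
  shows "(\<lambda>i. scaleC (d i) (e i)) summable_on I"
proof (rule cauchy_filter_finite_subsets_sum_summable)
  fix \<epsilon> :: real assume e: "\<epsilon> > 0"
  \<comment> \<open>The constant B carries no sign condition; C dominates it and is positive, so
    that dividing by it gives a legitimate tolerance.\<close>
  define C where "C = \<bar>B\<bar> + 1"
  have C: "C > 0" by (simp add: C_def)
  have "\<epsilon>\<^sup>2 / C > 0" using e C by simp
  from summable_on_tail_less[OF d this] obtain P where P: "finite P" "P \<subseteq> I"
    and PJ: "\<forall>J. finite J \<and> J \<subseteq> I \<and> J \<inter> P = {} \<longrightarrow> \<bar>\<Sum>i\<in>J. (cmod (d i))\<^sup>2\<bar> < \<epsilon>\<^sup>2 / C"
    by blast
  have "norm (\<Sum>i\<in>J. scaleC (d i) (e i)) < \<epsilon>" if J: "finite J" "J \<subseteq> I" "J \<inter> P = {}" for J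
  proof -
    have S: "0 \<le> (\<Sum>i\<in>J. (cmod (d i))\<^sup>2)" by (rule sum_nonneg) simp
    have "(norm (\<Sum>i\<in>J. scaleC (d i) (e i)))\<^sup>2 \<le> B * (\<Sum>i\<in>J. (cmod (d i))\<^sup>2)"
      using J by (intro B)
    also have "\<dots> \<le> C * (\<Sum>i\<in>J. (cmod (d i))\<^sup>2)"
      using S by (intro mult_right_mono) (auto simp: C_def)
    also have "\<dots> < C * (\<epsilon>\<^sup>2 / C)"
      using PJ[rule_format, of J] J C by (intro mult_strict_left_mono) linarith+
    finally show ?thesis using C e by (simp add: power2_less_imp_less)
  qed
  then show "\<exists>P. finite P \<and> P \<subseteq> I \<and> (\<forall>J. finite J \<and> J \<subseteq> I \<and> J \<inter> P = {} \<longrightarrow>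
      norm (\<Sum>i\<in>J. scaleC (d i) (e i)) < \<epsilon>)"
    using P by blast
qed

text \<open>An expansion of x turns an upper bound for one of the energies D and E into a lower
  bound for the other. The expansion is paired with x, and the finite Cauchy-Schwarz inequality
  passes to the limit.\<close>

lemma has_sum_norm_lower:
  assumes x: "((\<lambda>i. scaleC (d i) (e i)) has_sum x) I"
    and D: "((\<lambda>i. (cmod (d i))\<^sup>2) has_sum D) I"
    and E: "((\<lambda>i. (cmod (cinner x (e i)))\<^sup>2) has_sum E) I"
  shows "((norm x)\<^sup>2)\<^sup>2 \<le> D * E"
proof -
  have "((\<lambda>i. d i * cinner (e i) x) has_sum cinner x x) I"
    using has_sum_bounded_linear[OF bounded_linear_cinner_left[of x] x]
    by (simp add: cinner_scaleC_left)
  then have 1: "((\<lambda>J. (cmod (\<Sum>i\<in>J. d i * cinner (e i) x))\<^sup>2) \<longlongrightarrow> (cmod (cinner x x))\<^sup>2)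
      (finite_subsets_at_top I)"
    unfolding has_sum_def by (intro tendsto_intros)
  have 2: "((\<lambda>J. (\<Sum>i\<in>J. (cmod (d i))\<^sup>2) * (\<Sum>i\<in>J. (cmod (cinner x (e i)))\<^sup>2)) \<longlongrightarrow> D * E)
      (finite_subsets_at_top I)"
    using D E unfolding has_sum_def by (intro tendsto_intros)
  have "(cmod (cinner x x))\<^sup>2 \<le> D * E"
    by (rule tendsto_le[OF finite_subsets_at_top_neq_bot 2 1])
      (auto intro: eventually_finite_subsets_at_top_weakI sum_mult_cinner_le)
  then show ?thesis by (simp add: cinner_self norm_power)
qed

lemma riesz_sequence_synthesis:
  assumes A: "\<And>J \<alpha>. finite J \<Longrightarrow> J \<subseteq> I \<Longrightarrow>
      A * (\<Sum>i\<in>J. (cmod (\<alpha> i))\<^sup>2) \<le> (norm (\<Sum>i\<in>J. scaleC (\<alpha> i) (f i)))\<^sup>2"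
    and B: "\<And>J \<alpha>. finite J \<Longrightarrow> J \<subseteq> I \<Longrightarrow>
      (norm (\<Sum>i\<in>J. scaleC (\<alpha> i) (f i)))\<^sup>2 \<le> B * (\<Sum>i\<in>J. (cmod (\<alpha> i))\<^sup>2)"
    and S: "((\<lambda>i. (cmod (\<alpha> i))\<^sup>2) has_sum S) I"
  shows "(\<lambda>i. scaleC (\<alpha> i) (f i)) summable_on I"
    and "A * S \<le> (norm (\<Sum>\<^sub>\<infinity>i\<in>I. scaleC (\<alpha> i) (f i)))\<^sup>2"
    and "(norm (\<Sum>\<^sub>\<infinity>i\<in>I. scaleC (\<alpha> i) (f i)))\<^sup>2 \<le> B * S"
proof -
  show sm: "(\<lambda>i. scaleC (\<alpha> i) (f i)) summable_on I"
    using S by (intro synthesis_summable[where B = B] B) (auto simp: summable_on_def)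
  then have N: "((\<lambda>J. (norm (\<Sum>i\<in>J. scaleC (\<alpha> i) (f i)))\<^sup>2) \<longlongrightarrow>
      (norm (\<Sum>\<^sub>\<infinity>i\<in>I. scaleC (\<alpha> i) (f i)))\<^sup>2) (finite_subsets_at_top I)"
    using has_sum_infsum unfolding has_sum_def by (intro tendsto_intros) auto
  have C: "((\<lambda>J. C * (\<Sum>i\<in>J. (cmod (\<alpha> i))\<^sup>2)) \<longlongrightarrow> C * S) (finite_subsets_at_top I)" for C
    using S unfolding has_sum_def by (intro tendsto_intros)
  show "A * S \<le> (norm (\<Sum>\<^sub>\<infinity>i\<in>I. scaleC (\<alpha> i) (f i)))\<^sup>2"
    by (rule tendsto_le[OF finite_subsets_at_top_neq_bot N C])
      (auto intro: eventually_finite_subsets_at_top_weakI A)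
  show "(norm (\<Sum>\<^sub>\<infinity>i\<in>I. scaleC (\<alpha> i) (f i)))\<^sup>2 \<le> B * S"
    by (rule tendsto_le[OF finite_subsets_at_top_neq_bot C N])
      (auto intro: eventually_finite_subsets_at_top_weakI B)
qed

section \<open>Characters of a countable discrete subgroup\<close>

text \<open>Every point of H is isolated, so the continuity clause of \<open>dual_group\<close>
  holds for any function.\<close>

lemma dual_groupI:
  assumes "add_subgroup H" "discrete H" "\<And>h. h \<in> H \<Longrightarrow> cmod (f h) = 1"
    and "\<And>h k. h \<in> H \<Longrightarrow> k \<in> H \<Longrightarrow> f (h + k) = f h * f k"
  shows "restrict f H \<in> dual_group H"
proof -
  have "continuous_on H (restrict f H)"
    unfolding continuous_on_topological
  proof (intro ballI allI impI)
    fix x B assume x: "x \<in> H" "restrict f H x \<in> B"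
    then obtain T where "open T" "T \<inter> H = {x}"
      using assms(2) by (auto simp: discrete_def isolated_in_def)
    then show "\<exists>A. open A \<and> x \<in> A \<and> (\<forall>y\<in>H. y \<in> A \<longrightarrow> restrict f H y \<in> B)"
      using x by (intro exI[of _ T]) auto
  qed
  then show ?thesis
    using assms by (auto simp: dual_group_def add_subgroup_def)
qed

locale dual_haar =
  fixes H :: "'g::topological_ab_group_add set" and m :: "('g \<Rightarrow> complex) measure"
  assumes sub: "add_subgroup H" and disc: "discrete H" and countable_H: "countable H"
    and haar: "normalized_haar_measure H m"
begin

abbreviation D where "D \<equiv> dual_group H"
abbreviation translate (infixl "\<boxplus>" 65) where "translate \<equiv> dual_add H"

lemma H0 [simp]: "0 \<in> H" and H_add: "x \<in> H \<Longrightarrow> y \<in> H \<Longrightarrow> x + y \<in> H"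
  and H_uminus: "x \<in> H \<Longrightarrow> - x \<in> H"
  using sub by (auto simp: add_subgroup_def)

lemma H_diff: "x \<in> H \<Longrightarrow> y \<in> H \<Longrightarrow> x - y \<in> H"
  by (metis H_add H_uminus uminus_add_conv_diff add.commute)

lemma char_norm: "\<gamma> \<in> D \<Longrightarrow> h \<in> H \<Longrightarrow> cmod (\<gamma> h) = 1"
  and char_add: "\<gamma> \<in> D \<Longrightarrow> h \<in> H \<Longrightarrow> k \<in> H \<Longrightarrow> \<gamma> (h + k) = \<gamma> h * \<gamma> k"
  and char_ext: "\<gamma> \<in> D \<Longrightarrow> \<gamma> \<in> extensional H"
  by (auto simp: dual_group_def)

lemma char_mult_cnj: "\<gamma> \<in> D \<Longrightarrow> h \<in> H \<Longrightarrow> \<gamma> h * cnj (\<gamma> h) = 1"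
  using char_norm[of \<gamma> h] by (metis complex_norm_square of_real_1 power_one)

lemma char_nonzero: "\<gamma> \<in> D \<Longrightarrow> h \<in> H \<Longrightarrow> \<gamma> h \<noteq> 0"
  using char_norm by fastforce

lemma char_0: assumes "\<gamma> \<in> D" shows "\<gamma> 0 = 1"
  using char_add[OF assms H0 H0] char_nonzero[OF assms H0] by simp

lemma char_uminus: assumes "\<gamma> \<in> D" "h \<in> H" shows "\<gamma> (- h) = cnj (\<gamma> h)"
proof -
  have "\<gamma> (- h) * \<gamma> h = cnj (\<gamma> h) * \<gamma> h"
    using char_add[OF assms(1) H_uminus[OF assms(2)] assms(2)] char_0[OF assms(1)]
      char_mult_cnj[OF assms] by (simp add: mult.commute)
  then show ?thesis using char_nonzero[OF assms] by simp
qed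

lemma char_diff: "\<gamma> \<in> D \<Longrightarrow> h \<in> H \<Longrightarrow> k \<in> H \<Longrightarrow> \<gamma> (h - k) = \<gamma> h * cnj (\<gamma> k)"
  using char_add[of \<gamma> h "- k"] char_uminus[of \<gamma> k] H_uminus[of k] by simp

lemma translate_apply: "h \<in> H \<Longrightarrow> (\<gamma> \<boxplus> \<delta>) h = \<gamma> h * \<delta> h"
  by (simp add: dual_add_def)

lemma translate_closed: "\<gamma> \<in> D \<Longrightarrow> \<delta> \<in> D \<Longrightarrow> \<gamma> \<boxplus> \<delta> \<in> D"
  unfolding dual_add_def
  by (rule dual_groupI[OF sub disc]) (auto simp: char_norm norm_mult char_add)

lemma translate_commute: "\<gamma> \<boxplus> \<delta> = \<delta> \<boxplus> \<gamma>"
  unfolding dual_add_def by (auto simp: mult.commute)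

lemma translate_assoc: "\<gamma> \<boxplus> \<delta> \<boxplus> \<epsilon> = \<gamma> \<boxplus> (\<delta> \<boxplus> \<epsilon>)"
  unfolding dual_add_def by (auto simp: mult.assoc)

lemma char_eqI: "\<gamma> \<in> D \<Longrightarrow> \<delta> \<in> D \<Longrightarrow> (\<And>h. h \<in> H \<Longrightarrow> \<gamma> h = \<delta> h) \<Longrightarrow> \<gamma> = \<delta>"
  using char_ext extensionalityI by blast

lemma zero_closed: "dual_zero H \<in> D"
  unfolding dual_zero_def by (rule dual_groupI[OF sub disc]) auto

lemma zero_translate: "\<gamma> \<in> D \<Longrightarrow> dual_zero H \<boxplus> \<gamma> = \<gamma>"
  by (rule char_eqI) (auto simp: translate_closed zero_closed, simp add: translate_apply dual_zero_def)

lemma translate_zero: "\<gamma> \<in> D \<Longrightarrow> \<gamma> \<boxplus> dual_zero H = \<gamma>"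
  using zero_translate translate_commute by metis

text \<open>On unimodular values the conjugate is the inverse, so this is the negative in the dual
  group.\<close>

definition neg where "neg \<gamma> = (\<lambda>h\<in>H. cnj (\<gamma> h))"

lemma neg_closed: "\<gamma> \<in> D \<Longrightarrow> neg \<gamma> \<in> D"
  unfolding neg_def by (rule dual_groupI[OF sub disc]) (auto simp: char_norm char_add)

lemma neg_translate: "\<gamma> \<in> D \<Longrightarrow> \<delta> \<in> D \<Longrightarrow> neg \<gamma> \<boxplus> (\<gamma> \<boxplus> \<delta>) = \<delta>"
  by (rule char_eqI)
    (auto simp: translate_closed neg_closed,
      simp add: translate_apply neg_def char_mult_cnj mult.commute[of "cnj _"] flip: mult.assoc)

lemma translate_neg: "\<gamma> \<in> D \<Longrightarrow> \<delta> \<in> D \<Longrightarrow> \<gamma> \<boxplus> (neg \<gamma> \<boxplus> \<delta>) = \<delta>"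
  using neg_translate[of \<gamma> \<delta>] unfolding translate_assoc[symmetric] translate_commute[of \<gamma> "neg \<gamma>"] by simp

lemma translate_cancel: "\<gamma> \<in> D \<Longrightarrow> \<delta> \<in> D \<Longrightarrow> \<epsilon> \<in> D \<Longrightarrow> \<gamma> \<boxplus> \<delta> = \<gamma> \<boxplus> \<epsilon> \<longleftrightarrow> \<delta> = \<epsilon>"
  by (metis neg_translate)

section \<open>The Haar measure of the dual group\<close>

lemma space_m: "space m = D" and sets_m': "sets m = sigma_sets D {V. openin (dual_topology H) V}"
  and emeasure_D: "emeasure m D = 1"
  and emeasure_translate: "\<gamma> \<in> D \<Longrightarrow> A \<in> sets m \<Longrightarrow> emeasure m ((\<boxplus>) \<gamma> ` A) = emeasure m A"
  using haar by (auto simp: normalized_haar_measure_def)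

sublocale prob_space m
  by standard (simp add: space_m emeasure_D)

lemma sets_m_sub: "A \<in> sets m \<Longrightarrow> A \<subseteq> D"
  using sets.sets_into_space space_m by blast

section \<open>Cylinders and a countable base of the dual topology\<close>

definition cyl where "cyl h V = {\<gamma> \<in> D. \<gamma> h \<in> V}" for h :: 'g and V :: "complex set"

lemma openin_cyl: "h \<in> H \<Longrightarrow> open V \<Longrightarrow> openin (dual_topology H) (cyl h V)"
  unfolding dual_topology_def cyl_def openin_topology_generated_by_iff
  by (rule generate_topology_on.Basis) (auto intro!: exI[of _ "{h}"] exI[of _ V])

lemma cyl_sets: "h \<in> H \<Longrightarrow> open V \<Longrightarrow> cyl h V \<in> sets m"
  using openin_cyl sets_m' by blast

definition cylinders where
  "cylinders = {cyl h V |h V. h \<in> H \<and> V \<in> (SOME B. countable B \<and> topological_basis B)}"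

text \<open>A base of the compact-open topology. It is countable because H is, and because values
  are tested on a countable base of the complex plane; open sets thereby become countable unions of
  boxes.\<close>

definition boxes where "boxes = {D \<inter> \<Inter>\<F> |\<F>. finite \<F> \<and> \<F> \<subseteq> cylinders}"

lemma some_basis: "countable (SOME B :: complex set set. countable B \<and> topological_basis B)"
    "topological_basis (SOME B :: complex set set. countable B \<and> topological_basis B)"
  using someI_ex[of "\<lambda>B :: complex set set. countable B \<and> topological_basis B"]
    ex_countable_basis by auto

lemma countable_boxes: "countable boxes"
proof -
  have "cylinders = (\<lambda>(h, V). cyl h V) ` (H \<times> (SOME B. countable B \<and> topological_basis B))"
    by (auto simp: cylinders_def image_iff)
  then have "countable cylinders"
    using countable_H some_basis by auto
  then have "countable {\<F>. finite \<F> \<and> \<F> \<subseteq> cylinders}"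
    by (rule countable_Collect_finite_subset)
  moreover have "boxes = (\<lambda>\<F>. D \<inter> \<Inter>\<F>) ` {\<F>. finite \<F> \<and> \<F> \<subseteq> cylinders}"
    unfolding boxes_def by blast
  ultimately show ?thesis by simp
qed

lemma boxes_Int: "A \<in> boxes \<Longrightarrow> B \<in> boxes \<Longrightarrow> A \<inter> B \<in> boxes"
proof -
  assume "A \<in> boxes" "B \<in> boxes"
  then obtain F G where "finite F" "F \<subseteq> cylinders" "finite G" "G \<subseteq> cylinders"
    "A = D \<inter> \<Inter>F" "B = D \<inter> \<Inter>G" by (auto simp: boxes_def)
  then show ?thesis unfolding boxes_def by (intro CollectI exI[of _ "F \<union> G"]) auto
qed

lemma open_cyl_boxes: assumes "h \<in> H" "open V" "\<gamma> \<in> cyl h V"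
  shows "\<exists>B\<in>boxes. \<gamma> \<in> B \<and> B \<subseteq> cyl h V"
proof -
  have "\<gamma> h \<in> V" "\<gamma> \<in> D" using assms by (auto simp: cyl_def)
  then obtain W where W: "W \<in> (SOME B :: complex set set. countable B \<and> topological_basis B)"
    "\<gamma> h \<in> W" "W \<subseteq> V"
    using topological_basisE[OF some_basis(2) assms(2)] by metis
  have "cyl h W \<in> cylinders" using W assms by (auto simp: cylinders_def)
  then have "D \<inter> \<Inter>{cyl h W} \<in> boxes" unfolding boxes_def by (intro CollectI exI[of _ "{cyl h W}"]) auto
  moreover have "\<gamma> \<in> D \<inter> \<Inter>{cyl h W}" "D \<inter> \<Inter>{cyl h W} \<subseteq> cyl h V"
    using W \<open>\<gamma> \<in> D\<close> by (auto simp: cyl_def)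
  ultimately show ?thesis by (intro bexI[of _ "D \<inter> \<Inter>{cyl h W}"] conjI)
qed

text \<open>K is covered by open sets that each meet H in a single point, and finitely many of them
  suffice. The compact-open topology is therefore that of pointwise convergence.\<close>

lemma compact_subset_finite: assumes "compact K" "K \<subseteq> H" shows "finite K"
proof -
  have "\<forall>x\<in>K. \<exists>T. open T \<and> T \<inter> H = {x}"
    using disc assms(2) by (auto simp: discrete_def isolated_in_def)
  then obtain T where T: "\<And>x. x \<in> K \<Longrightarrow> open (T x)" "\<And>x. x \<in> K \<Longrightarrow> T x \<inter> H = {x}" by metis
  then have "K \<subseteq> (\<Union>x\<in>K. T x)" by blast
  then obtain F where F: "F \<subseteq> K" "finite F" "K \<subseteq> (\<Union>x\<in>F. T x)"
    using compactE_image[OF assms(1), of K T] T by metis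
  have "K \<subseteq> F"
  proof
    fix y assume "y \<in> K"
    then obtain x where x: "x \<in> F" "y \<in> T x" using F by blast
    then have "y \<in> T x \<inter> H" using \<open>y \<in> K\<close> assms by blast
    moreover have "T x \<inter> H = {x}" using T(2)[of x] x F by blast
    ultimately have "y = x" by blast
    then show "y \<in> F" using x by simp
  qed
  then show ?thesis using F finite_subset by blast
qed

text \<open>Induction over the generation of the topology; a subbasic set given by K is handled by
  intersecting one box for each of the finitely many points of K.\<close>

lemma openin_boxes:
  assumes "openin (dual_topology H) W" "\<gamma> \<in> W"
  shows "\<exists>B\<in>boxes. \<gamma> \<in> B \<and> B \<subseteq> W"
proof -
  have "generate_topology_on
     {{\<gamma> \<in> dual_group H. \<gamma> ` K \<subseteq> V} |K V. compact K \<and> K \<subseteq> H \<and> open V} W"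
    using assms(1) unfolding dual_topology_def openin_topology_generated_by_iff .
  then show ?thesis using assms(2)
  proof (induction arbitrary: \<gamma>)
    case Empty
    then show ?case by simp
  next
    case (Int A B)
    have "\<gamma> \<in> A" "\<gamma> \<in> B" using Int.prems by blast+
    with Int.IH obtain A' B' where *: "A' \<in> boxes" "B' \<in> boxes"
      and "\<gamma> \<in> A'" "A' \<subseteq> A" "\<gamma> \<in> B'" "B' \<subseteq> B" by meson
    then have "\<gamma> \<in> A' \<inter> B'" "A' \<inter> B' \<subseteq> A \<inter> B" by blast+
    then show ?case using boxes_Int[OF *] by (intro bexI[of _ "A' \<inter> B'"] conjI)
  next
    case (UN K)
    then obtain A where "A \<in> K" "\<gamma> \<in> A" by blast
    then obtain B where "B \<in> boxes" "\<gamma> \<in> B" "B \<subseteq> A" using UN.IH[of A \<gamma>] by meson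
    moreover have "A \<subseteq> \<Union>K" using \<open>A \<in> K\<close> by blast
    ultimately show ?case by (intro bexI[of _ B]) auto
  next
    case (Basis W)
    then obtain K V where K: "compact K" "K \<subseteq> H" "open V" and W: "W = {\<gamma> \<in> D. \<gamma> ` K \<subseteq> V}" by blast
    have fin: "finite K" using compact_subset_finite K by blast
    have gD: "\<gamma> \<in> D" using Basis W by blast
    have "\<exists>B\<in>boxes. \<gamma> \<in> B \<and> B \<subseteq> cyl h V" if "h \<in> K" for h
      using open_cyl_boxes[of h V \<gamma>] that K Basis W gD by (auto simp: cyl_def)
    then obtain B where B: "\<And>h. h \<in> K \<Longrightarrow> B h \<in> boxes \<and> \<gamma> \<in> B h \<and> B h \<subseteq> cyl h V" by metis
    have box: "D \<inter> \<Inter>(B ` L) \<in> boxes" if "finite L" "L \<subseteq> K" for L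
      using that
    proof (induction L)
      case empty
      show ?case unfolding boxes_def by (intro CollectI exI[of _ "{}"]) auto
    next
      case (insert x L)
      have "D \<inter> \<Inter>(B ` insert x L) = B x \<inter> (D \<inter> \<Inter>(B ` L))" by auto
      then show ?case using insert B boxes_Int by auto
    qed
    have "D \<inter> \<Inter>(B ` K) \<subseteq> W" using B by (fastforce simp: W cyl_def)
    then show ?case using box[OF fin] gD B by (intro bexI[of _ "D \<inter> \<Inter>(B ` K)"]) auto
  qed
qed

lemma boxes_sigma: "B \<in> boxes \<Longrightarrow> B \<in> sigma_sets D {cyl h V |h V. h \<in> H \<and> open V}"
proof -
  assume "B \<in> boxes"
  then obtain F where F: "finite F" "F \<subseteq> cylinders" "B = D \<inter> \<Inter>F" by (auto simp: boxes_def)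
  interpret S: sigma_algebra D "sigma_sets D {cyl h V |h V. h \<in> H \<and> open V}"
    by (rule sigma_algebra_sigma_sets) (auto simp: cyl_def)
  have cyl: "A \<in> sigma_sets D {cyl h V |h V. h \<in> H \<and> open V}" if A: "A \<in> cylinders" for A
    using A topological_basis_open[OF some_basis(2)] unfolding cylinders_def
    by (intro sigma_sets.Basic) blast
  from F(1,2) have "D \<inter> \<Inter>F \<in> sigma_sets D {cyl h V |h V. h \<in> H \<and> open V}"
  proof (induction F)
    case empty
    then show ?case using S.top by simp
  next
    case (insert x F)
    have "D \<inter> \<Inter>(insert x F) = x \<inter> (D \<inter> \<Inter>F)" by auto
    then show ?case using insert cyl S.Int by auto
  qed
  then show ?thesis using F by simp
qed

text \<open>Each open set is the union of the boxes it contains, a countable union. Measurability of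
  maps into m can thus be checked one coordinate at a time, and claims about measurable sets can be
  proved by induction from cylinders.\<close>

lemma sets_m: "sets m = sigma_sets D {cyl h V |h V. h \<in> H \<and> open V}"
proof
  show "sigma_sets D {cyl h V |h V. h \<in> H \<and> open V} \<subseteq> sets m"
  proof (rule sets.sigma_sets_subset[of _ m, unfolded space_m])
    show "{cyl h V |h V. h \<in> H \<and> open V} \<subseteq> sets m" using cyl_sets by blast
  qed
  interpret S: sigma_algebra D "sigma_sets D {cyl h V |h V. h \<in> H \<and> open V}"
    by (rule sigma_algebra_sigma_sets) (auto simp: cyl_def)
  have "W \<in> sigma_sets D {cyl h V |h V. h \<in> H \<and> open V}" if W: "openin (dual_topology H) W" for W
  proof -
    have "W = \<Union>{B \<in> boxes. B \<subseteq> W}"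
      using openin_boxes[OF W] by (intro equalityI subsetI) (blast, blast)
    moreover have "\<Union>{B \<in> boxes. B \<subseteq> W} \<in> sigma_sets D {cyl h V |h V. h \<in> H \<and> open V}"
      using boxes_sigma countable_subset[OF _ countable_boxes, of "{B \<in> boxes. B \<subseteq> W}"]
      by (intro S.countable_Union) auto
    ultimately show ?thesis by simp
  qed
  then show "sets m \<subseteq> sigma_sets D {cyl h V |h V. h \<in> H \<and> open V}"
    unfolding sets_m' by (intro sigma_sets_mono) auto
qed

lemma char_measurable [measurable]: "h \<in> H \<Longrightarrow> (\<lambda>\<gamma>. \<gamma> h) \<in> borel_measurable m"
proof (rule borel_measurableI)
  fix V :: "complex set" assume "h \<in> H" "open V"
  moreover have "(\<lambda>\<gamma>. \<gamma> h) -` V \<inter> space m = cyl h V" by (auto simp: cyl_def space_m)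
  ultimately show "(\<lambda>\<gamma>. \<gamma> h) -` V \<inter> space m \<in> sets m" using cyl_sets by simp
qed

lemma measurable_into_m:
  assumes "f \<in> space N \<rightarrow> D" "\<And>h. h \<in> H \<Longrightarrow> (\<lambda>x. f x h) \<in> borel_measurable N"
  shows "f \<in> measurable N m"
proof (rule measurable_sigma_sets[OF sets_m])
  fix A assume "A \<in> {cyl h V |h V. h \<in> H \<and> open V}"
  then obtain h V where A: "h \<in> H" "open V" "A = cyl h V" by blast
  have "f -` A \<inter> space N = (\<lambda>x. f x h) -` V \<inter> space N"
    using assms(1) A by (auto simp: cyl_def)
  also have "\<dots> \<in> sets N"
    using assms(2)[OF A(1)] A(2) by (intro measurable_sets[of _ _ borel]) auto
  finally show "f -` A \<inter> space N \<in> sets N" .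
qed (use assms in \<open>auto simp: cyl_def\<close>)

section \<open>Invariance of integrals and null sets under translation\<close>

lemma translate_measurable [measurable]: "\<gamma> \<in> D \<Longrightarrow> (\<boxplus>) \<gamma> \<in> measurable m m"
  by (rule measurable_into_m) (use translate_closed space_m in \<open>auto simp: translate_apply\<close>)

lemma translate_vimage: assumes "\<gamma> \<in> D" "A \<subseteq> D" shows "(\<boxplus>) \<gamma> -` A \<inter> D = (\<boxplus>) (neg \<gamma>) ` A"
proof (intro equalityI subsetI)
  fix x assume "x \<in> (\<boxplus>) \<gamma> -` A \<inter> D"
  then have "x = neg \<gamma> \<boxplus> (\<gamma> \<boxplus> x)" "\<gamma> \<boxplus> x \<in> A" using neg_translate[OF assms(1)] by auto
  then show "x \<in> (\<boxplus>) (neg \<gamma>) ` A" by (rule image_eqI)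
next
  fix x assume "x \<in> (\<boxplus>) (neg \<gamma>) ` A"
  then obtain y where "y \<in> A" "x = neg \<gamma> \<boxplus> y" by blast
  then have "y \<in> D" "\<gamma> \<boxplus> x \<in> A" using assms translate_neg[OF assms(1)] by auto
  moreover have "x \<in> D" unfolding \<open>x = _\<close> by (intro translate_closed neg_closed assms \<open>y \<in> D\<close>)
  ultimately show "x \<in> (\<boxplus>) \<gamma> -` A \<inter> D" by blast
qed

lemma translate_image_sets: assumes "\<gamma> \<in> D" "A \<in> sets m" shows "(\<boxplus>) \<gamma> ` A \<in> sets m"
proof -
  have "(\<boxplus>) (neg \<gamma>) -` A \<inter> D = (\<boxplus>) (neg (neg \<gamma>)) ` A"
    using assms neg_closed sets_m_sub by (intro translate_vimage) auto
  moreover have "neg (neg \<gamma>) = \<gamma>"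
    using assms by (intro char_eqI neg_closed) (auto simp: neg_def)
  ultimately show ?thesis
    using measurable_sets[OF translate_measurable[OF neg_closed[OF assms(1)]] assms(2)] space_m by simp
qed

text \<open>Invariance is given for images of sets, whereas \<open>distr\<close> uses preimages; the
  preimage under translation by \<gamma> is the image under translation by
  \<open>neg \<gamma>\<close>.\<close>

lemma distr_translate: assumes "\<gamma> \<in> D" shows "distr m m ((\<boxplus>) \<gamma>) = m"
proof (rule measure_eqI)
  fix A assume "A \<in> sets (distr m m ((\<boxplus>) \<gamma>))"
  then have A: "A \<in> sets m" by simp
  have "emeasure (distr m m ((\<boxplus>) \<gamma>)) A = emeasure m ((\<boxplus>) \<gamma> -` A \<inter> D)"
    using A translate_measurable[OF assms] by (simp add: emeasure_distr space_m)
  also have "\<dots> = emeasure m A"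
    using translate_vimage[OF assms, of A] emeasure_translate[OF neg_closed[OF assms] A] sets_m_sub[OF A] by simp
  finally show "emeasure (distr m m ((\<boxplus>) \<gamma>)) A = emeasure m A" .
qed simp

lemma translate_integral:
  fixes f :: "_ \<Rightarrow> 'b::{banach, second_countable_topology}"
  assumes "\<gamma> \<in> D" "f \<in> borel_measurable m"
  shows "(\<integral>\<xi>. f (\<gamma> \<boxplus> \<xi>) \<partial>m) = (\<integral>\<xi>. f \<xi> \<partial>m)"
  using integral_distr[OF translate_measurable[OF assms(1)] assms(2)] distr_translate[OF assms(1)] by simp

lemma translate_integrable:
  fixes f :: "_ \<Rightarrow> 'b::{banach, second_countable_topology}"
  assumes "\<gamma> \<in> D" "f \<in> borel_measurable m"
  shows "integrable m (\<lambda>\<xi>. f (\<gamma> \<boxplus> \<xi>)) \<longleftrightarrow> integrable m f"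
  using integrable_distr_eq[OF translate_measurable[OF assms(1)], of f] assms distr_translate[OF assms(1)] by simp

lemma translate_AE:
  assumes "\<gamma> \<in> D" "AE \<xi> in m. P \<xi>"
  shows "AE \<xi> in m. P (\<gamma> \<boxplus> \<xi>)"
proof -
  obtain N where N: "\<And>x. x \<in> space m - N \<Longrightarrow> P x" "N \<in> null_sets m"
    using AE_E3[OF assms(2)] by metis
  have "AE \<xi> in distr m m ((\<boxplus>) \<gamma>). \<xi> \<notin> N"
    unfolding distr_translate[OF assms(1)] using N(2) by (rule AE_not_in)
  then have "AE \<xi> in m. \<gamma> \<boxplus> \<xi> \<notin> N"
    by (rule AE_distrD[OF translate_measurable[OF assms(1)]])
  then show ?thesis
    using AE_space
  proof eventually_elim
    case (elim \<xi>)
    then show ?case using N(1) translate_closed[OF assms(1)] space_m by simp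
  qed
qed

end

section \<open>Characters separating a point from a subgroup\<close>

text \<open>At least one of the two sums is empty, so this is the j-fold multiple for an integer j
  of either sign.\<close>

definition zmult :: "int \<Rightarrow> 'g::ab_group_add \<Rightarrow> 'g" where
  "zmult j x = (\<Sum>i<nat j. x) - (\<Sum>i<nat (- j). x)"

lemma zmult_0 [simp]: "zmult 0 x = 0" and zmult_1 [simp]: "zmult 1 x = x"
  by (auto simp: zmult_def)

lemma zmult_plus_1: "zmult (j + 1) x = zmult j x + x"
proof (cases "0 \<le> j")
  case True
  then have "nat (j + 1) = Suc (nat j)" by simp
  then show ?thesis using True by (simp add: zmult_def)
next
  case False
  then have "nat (- j) = Suc (nat (- (j + 1)))" by simp
  then show ?thesis using False by (simp add: zmult_def)
qed

lemma zmult_add: "zmult (i + j) x = zmult i x + zmult j x"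
proof (induction j rule: int_induct[of _ 0])
  case (step1 j)
  then show ?case using zmult_plus_1[of "i + j" x] zmult_plus_1[of j x] by (simp add: add.assoc)
next
  case (step2 j)
  have "zmult (i + j) x = zmult (i + (j - 1)) x + x" "zmult j x = zmult (j - 1) x + x"
    using zmult_plus_1[of "i + (j - 1)" x] zmult_plus_1[of "j - 1" x] by (simp_all add: algebra_simps)
  then show ?case using step2 by (simp add: algebra_simps)
qed simp

lemma zmult_uminus: "zmult (- j) x = - zmult j x"
  by (simp add: zmult_def)

lemma zmult_mult: "zmult (q * n) x = zmult q (zmult n x)"
proof (induction q rule: int_induct[of _ 0])
  case (step1 q)
  then show ?case by (simp add: distrib_right zmult_add)
next
  case (step2 q)
  then show ?case
    using zmult_add[of "q * n" "- n" x] zmult_add[of q "- 1" "zmult n x"]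
    by (simp add: left_diff_distrib zmult_uminus)
qed simp

text \<open>A root other than 1 is wanted, so that an extended character is nontrivial at the new
  point. For z = 1 the angle 2 pi / n lies in (0, pi] because n is at least 2, and there the cosine
  is less than 1; for any other z no root equals 1.\<close>

lemma unit_root_neq_1:
  assumes "cmod z = 1" "2 \<le> n"
  obtains w where "cmod w = 1" "w ^ n = z" "w \<noteq> 1"
proof (cases "z = 1")
  case True
  define t where "t = 2 * pi / real n"
  have n: "0 < real n" using assms by simp
  have "0 < t" "t \<le> pi" using assms(2) n by (auto simp: t_def field_simps)
  then have "cos t < cos 0" by (intro cos_monotone_0_pi) auto
  then have "cis t \<noteq> 1" by (metis cis.simps(1) cos_zero one_complex.simps(1) less_irrefl)
  moreover have "real n * t = 2 * pi" using n by (simp add: t_def)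
  then have "cis t ^ n = 1" by (simp add: Complex.DeMoivre)
  ultimately show ?thesis using that True by (metis norm_cis)
next
  case False
  have "z \<noteq> 0" using assms by auto
  then have "cis (Arg z / real n) ^ n = z"
    using assms cis_Arg[of z] by (simp add: Complex.DeMoivre sgn_eq)
  then show ?thesis using that False by (metis norm_cis power_one)
qed

text \<open>Partial characters are handled as graphs, so that Zorn's lemma applies to inclusion.\<close>

definition char_graph :: "'g::ab_group_add set \<Rightarrow> ('g \<times> complex) set \<Rightarrow> bool" where
  "char_graph H R \<longleftrightarrow> (0, 1) \<in> R \<and> (\<forall>x z y w. (x, z) \<in> R \<longrightarrow> (y, w) \<in> R \<longrightarrow> (x + y, z * w) \<in> R) \<and>
     (\<forall>x z. (x, z) \<in> R \<longrightarrow> (- x, inverse z) \<in> R \<and> x \<in> H \<and> cmod z = 1) \<and>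
     (\<forall>z. (0, z) \<in> R \<longrightarrow> z = 1)"

lemma char_graphD:
  assumes "char_graph H R"
  shows "(0, 1) \<in> R" "(x, z) \<in> R \<Longrightarrow> (y, w) \<in> R \<Longrightarrow> (x + y, z * w) \<in> R"
    "(x, z) \<in> R \<Longrightarrow> (- x, inverse z) \<in> R" "(x, z) \<in> R \<Longrightarrow> x \<in> H" "(x, z) \<in> R \<Longrightarrow> cmod z = 1"
    "(0, z) \<in> R \<Longrightarrow> z = 1"
  using assms unfolding char_graph_def by blast+

text \<open>Single-valuedness follows from the condition over 0: two values at x differ by a factor
  that is a value at 0.\<close>

lemma char_graph_unique:
  assumes R: "char_graph H R" and "(x, z) \<in> R" "(x, w) \<in> R"
  shows "z = w"
proof -
  have "(x + - x, z * inverse w) \<in> R"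
    using assms by (intro char_graphD(2)[OF R] char_graphD(3)[OF R])
  then have "z * inverse w = 1" using char_graphD(6)[OF R] by simp
  moreover have "w \<noteq> 0" using char_graphD(5)[OF R assms(3)] by auto
  ultimately show ?thesis by (simp add: field_simps)
qed

lemma char_graph_zmult:
  assumes R: "char_graph H R" and x: "(x, z) \<in> R"
  shows "(zmult j x, z powi j) \<in> R"
proof (induction j rule: int_induct[of _ 0])
  case base
  then show ?case using char_graphD(1)[OF R] by simp
next
  case (step1 i)
  have "z \<noteq> 0" using char_graphD(5)[OF R x] by auto
  then show ?case
    using char_graphD(2)[OF R step1(2) x] by (simp add: zmult_plus_1 power_int_add_1)
next
  case (step2 i)
  have "z \<noteq> 0" using char_graphD(5)[OF R x] by auto
  then show ?case
    using char_graphD(2)[OF R step2(2) char_graphD(3)[OF R x]] zmult_plus_1[of "i - 1" x]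
    by (simp add: power_int_diff divide_inverse)
qed

text \<open>The partial character on the subgroup generated by the domain of R and x, with x sent to
  w.\<close>

definition graph_extend :: "('g::ab_group_add \<times> complex) set \<Rightarrow> 'g \<Rightarrow> complex \<Rightarrow> ('g \<times> complex) set" where
  "graph_extend R x w = {(y + zmult j x, z * w powi j) |y z j. (y, z) \<in> R}"

lemma graph_extendI: "(y, z) \<in> R \<Longrightarrow> u = y + zmult j x \<Longrightarrow> v = z * w powi j \<Longrightarrow> (u, v) \<in> graph_extend R x w"
  unfolding graph_extend_def by blast

text \<open>An element may have many representations \<open>y + zmult j x\<close>. Single-valuedness
  reduces to those of 0, where \<open>zmult j x = - y\<close> lies in the domain of R and
  \<open>compat\<close> fixes its value.\<close>

lemma char_graph_extend:
  assumes R: "char_graph H R" and H: "add_subgroup H" and x: "x \<in> H" and w: "cmod w = 1"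
    and compat: "\<And>j z. (zmult j x, z) \<in> R \<Longrightarrow> z = w powi j"
  shows "char_graph H (graph_extend R x w)" "R \<subseteq> graph_extend R x w" "(x, w) \<in> graph_extend R x w"
proof -
  have w0: "w \<noteq> 0" using w by auto
  have zH: "zmult j x \<in> H" for j
  proof (induction j rule: int_induct[of _ 0])
    case (step2 i)
    have "zmult (i - 1) x = zmult i x + - x" using zmult_plus_1[of "i - 1" x] by simp
    then show ?case using step2 x H unfolding add_subgroup_def by metis
  qed (use x H in \<open>auto simp: add_subgroup_def zmult_plus_1\<close>)
  have sub: "(y, z) \<in> graph_extend R x w" if "(y, z) \<in> R" for y z
    using that by (rule graph_extendI[where j = 0]) auto
  then show "R \<subseteq> graph_extend R x w" by auto
  show "(x, w) \<in> graph_extend R x w"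
    using char_graphD(1)[OF R] by (rule graph_extendI[where j = 1]) auto
  show "char_graph H (graph_extend R x w)"
    unfolding char_graph_def
  proof (intro conjI allI impI)
    show "(0, 1) \<in> graph_extend R x w" using sub char_graphD(1)[OF R] .
  next
    fix x1 z1 x2 z2 assume "(x1, z1) \<in> graph_extend R x w" "(x2, z2) \<in> graph_extend R x w"
    then obtain y1 v1 j1 y2 v2 j2 where *: "(y1, v1) \<in> R" "(y2, v2) \<in> R"
      and "x1 = y1 + zmult j1 x" "z1 = v1 * w powi j1" "x2 = y2 + zmult j2 x" "z2 = v2 * w powi j2"
      unfolding graph_extend_def by blast
    then show "(x1 + x2, z1 * z2) \<in> graph_extend R x w"
      using w0 by (intro graph_extendI[OF char_graphD(2)[OF R *], where j = "j1 + j2"])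
        (auto simp: zmult_add power_int_add algebra_simps)
  next
    fix y z assume "(y, z) \<in> graph_extend R x w"
    then obtain y1 v1 j1 where *: "(y1, v1) \<in> R" and yz: "y = y1 + zmult j1 x" "z = v1 * w powi j1"
      unfolding graph_extend_def by blast
    show "(- y, inverse z) \<in> graph_extend R x w"
      using yz by (intro graph_extendI[OF char_graphD(3)[OF R *], where j = "- j1"])
        (auto simp: zmult_uminus power_int_minus)
    show "y \<in> H" using yz char_graphD(4)[OF R *] zH H by (auto simp: add_subgroup_def)
    show "cmod z = 1" using yz char_graphD(5)[OF R *] w by (simp add: norm_mult norm_power_int)
  next
    fix z assume "(0, z) \<in> graph_extend R x w"
    then obtain y1 v1 j1 where *: "(y1, v1) \<in> R" and yz: "0 = y1 + zmult j1 x" "z = v1 * w powi j1"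
      unfolding graph_extend_def by blast
    have "zmult j1 x = - y1" using yz(1) by (metis minus_unique)
    then have "inverse v1 = w powi j1" using compat[of j1] char_graphD(3)[OF R *] by metis
    moreover have "v1 \<noteq> 0" using char_graphD(5)[OF R *] by auto
    ultimately show "z = 1" using yz(2) by (metis right_inverse)
  qed
qed

text \<open>If no positive multiple of x lies in the domain, the value at x is free and -1 serves.
  Otherwise let n be the least positive index of such a multiple; w is an n-th root of the value
  prescribed there, and division with remainder shows that \<open>zmult j x\<close> lies in the
  domain only if n divides j.\<close>

lemma char_graph_extension_value:
  assumes R: "char_graph H R" and x: "\<nexists>z. (x, z) \<in> R"
  obtains w where "cmod w = 1" "w \<noteq> 1" "\<And>j z. (zmult j x, z) \<in> R \<Longrightarrow> z = w powi j"
proof (cases "\<exists>n>0. \<exists>z. (zmult (int n) x, z) \<in> R")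
  case False
  have "j = 0" if "(zmult j x, z) \<in> R" for j z
  proof (rule ccontr)
    assume "j \<noteq> 0"
    have "(zmult (- j) x, inverse z) \<in> R" using char_graphD(3)[OF R that] by (simp add: zmult_uminus)
    then show False
      using that False \<open>j \<noteq> 0\<close> by (cases "0 < j") (metis zero_less_nat_eq int_nat_eq less_le linorder_not_less neg_0_less_iff_less order.order_iff_strict)+
  qed
  then have "z = (- 1) powi j" if "(zmult j x, z) \<in> R" for j z
    using that char_graphD(6)[OF R] by fastforce
  then show ?thesis by (intro that[of "- 1"]) auto
next
  case True
  define P where "P n \<longleftrightarrow> 0 < n \<and> (\<exists>z. (zmult (int n) x, z) \<in> R)" for n
  define n where "n = (LEAST n. P n)"
  have "\<exists>n. P n" using True unfolding P_def by blast
  then have "P n" unfolding n_def by (rule LeastI_ex)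
  then obtain z0 where z0: "(zmult (int n) x, z0) \<in> R" and n0: "0 < n" by (auto simp: P_def)
  \<comment> \<open>x itself is outside the domain, so n is at least 2 and a root different from 1
    exists.\<close>
  have "n \<noteq> 1" using z0 x by auto
  then obtain w where w: "cmod w = 1" "w ^ n = z0" "w \<noteq> 1"
    using unit_root_neq_1[of z0 n] char_graphD(5)[OF R z0] n0 by (metis One_nat_def Suc_1 Suc_leI le_neq_implies_less)
  have "z = w powi j" if j: "(zmult j x, z) \<in> R" for j z
  proof -
    define q t where "q = j div int n" and "t = j mod int n"
    have jq: "j = q * int n + t" by (simp add: q_def t_def)
    have qn: "(zmult (q * int n) x, z0 powi q) \<in> R"
      using char_graph_zmult[OF R z0] by (simp add: zmult_mult)
    have "zmult j x + - zmult (q * int n) x = zmult t x" by (simp add: jq zmult_add)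
    then have t: "(zmult t x, z * inverse (z0 powi q)) \<in> R"
      using char_graphD(2)[OF R j char_graphD(3)[OF R qn]] by simp
    have tn: "0 \<le> t" "t < int n" using n0 by (auto simp: t_def)
    have "t = 0"
    proof (rule ccontr)
      assume "t \<noteq> 0"
      then have "P (nat t)" using t tn by (auto simp: P_def)
      then have "n \<le> nat t" unfolding n_def by (rule Least_le)
      then show False using tn by simp
    qed
    then have "(zmult (q * int n) x, z) \<in> R" using j jq by simp
    then have "z = z0 powi q" using char_graph_unique[OF R _ qn] by blast
    also have "\<dots> = w powi (int n * q)" by (simp add: w(2)[symmetric] power_int_power)
    finally show ?thesis using jq \<open>t = 0\<close> by (simp add: mult.commute)
  qed
  then show ?thesis using that w by blast
qed

text \<open>The circle is divisible, so a partial character extends to any further point; a maximal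
  extension is therefore defined on all of H.\<close>

lemma exists_character_separating:
  assumes H: "add_subgroup H" "discrete H" and M: "add_subgroup M" "M \<subseteq> H" and h: "h \<in> H" "h \<notin> M"
  shows "\<exists>\<gamma>\<in>dual_group H. (\<forall>x\<in>M. \<gamma> x = 1) \<and> \<gamma> h \<noteq> 1"
proof -
  define R0 where "R0 = M \<times> {1::complex}"
  have R0: "char_graph H R0"
    using M by (auto simp: char_graph_def R0_def add_subgroup_def)
  have "\<nexists>z. (h, z) \<in> R0" using h by (auto simp: R0_def)
  then obtain w where w: "cmod w = 1" "w \<noteq> 1" "\<And>j z. (zmult j h, z) \<in> R0 \<Longrightarrow> z = w powi j"
    using char_graph_extension_value[OF R0] by metis
  define R1 where "R1 = graph_extend R0 h w"
  have R1: "char_graph H R1" "R0 \<subseteq> R1" "(h, w) \<in> R1"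
    unfolding R1_def using char_graph_extend[OF R0 H(1) h(1) w(1) w(3)] by auto
  \<comment> \<open>The value w, different from 1, is already fixed at h in \<open>R1\<close>, so
    every member of this family, and with it a maximal one, separates h from M.\<close>
  define \<A> where "\<A> = {R. char_graph H R \<and> R1 \<subseteq> R}"
  have "\<exists>R\<in>\<A>. \<forall>X\<in>\<A>. R \<subseteq> X \<longrightarrow> X = R"
  proof (rule subset_Zorn_nonempty)
    show "\<A> \<noteq> {}" using R1 by (auto simp: \<A>_def)
    fix C assume C: "C \<noteq> {}" "subset.chain \<A> C"
    then have CA: "\<And>R. R \<in> C \<Longrightarrow> char_graph H R \<and> R1 \<subseteq> R" by (auto simp: subset.chain_def \<A>_def)
    have "char_graph H (\<Union>C)"
      unfolding char_graph_def
    proof (intro conjI allI impI)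
      show "(0, 1) \<in> \<Union>C" using C CA char_graphD(1) by blast
    next
      fix x z y v assume "(x, z) \<in> \<Union>C" "(y, v) \<in> \<Union>C"
      then obtain R S where RS: "R \<in> C" "S \<in> C" "(x, z) \<in> R" "(y, v) \<in> S" by blast
      then have "R \<subseteq> S \<or> S \<subseteq> R" using C(2) by (auto simp: subset.chain_def)
      then obtain T where "T \<in> C" "(x, z) \<in> T" "(y, v) \<in> T" using RS by blast
      then show "(x + y, z * v) \<in> \<Union>C" using CA[of T] char_graphD(2)[of H T] by blast
    next
      fix x z assume "(x, z) \<in> \<Union>C"
      then obtain R where R: "R \<in> C" "(x, z) \<in> R" by blast
      then show "(- x, inverse z) \<in> \<Union>C" "x \<in> H" "cmod z = 1"
        using CA[of R] char_graphD(3,4,5)[of H R] by blast+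
    next
      fix z assume "(0, z) \<in> \<Union>C"
      then obtain R where R: "R \<in> C" "(0, z) \<in> R" by blast
      then show "z = 1" using CA[of R] char_graphD(6)[of H R] by blast
    qed
    moreover have "R1 \<subseteq> \<Union>C" using C CA by blast
    ultimately show "\<Union>C \<in> \<A>" by (simp add: \<A>_def)
  qed
  then obtain R where R: "char_graph H R" "R1 \<subseteq> R"
    and mx: "\<And>X. char_graph H X \<Longrightarrow> R1 \<subseteq> X \<Longrightarrow> R \<subseteq> X \<Longrightarrow> X = R"
    by (auto simp: \<A>_def)
  have total: "\<exists>z. (x, z) \<in> R" if x: "x \<in> H" for x
  proof (rule ccontr)
    assume n: "\<nexists>z. (x, z) \<in> R"
    then obtain v where v: "cmod v = 1" "\<And>j z. (zmult j x, z) \<in> R \<Longrightarrow> z = v powi j"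
      using char_graph_extension_value[OF R(1)] by metis
    note E = char_graph_extend[OF R(1) H(1) x v]
    have "graph_extend R x v = R" using E(1,2) R(2) by (intro mx) auto
    then show False using E(3) n by auto
  qed
  define f where "f x = (SOME z. (x, z) \<in> R)" for x
  have f: "(x, f x) \<in> R" if "x \<in> H" for x
    unfolding f_def using total[OF that] by (rule someI_ex)
  have fu: "f x = z" if "(x, z) \<in> R" for x z
    using char_graph_unique[OF R(1) f that] char_graphD(4)[OF R(1) that] by blast
  have "restrict f H \<in> dual_group H"
  proof (rule dual_groupI[OF H])
    show "cmod (f x) = 1" if "x \<in> H" for x using char_graphD(5)[OF R(1) f[OF that]] .
    show "f (x + y) = f x * f y" if "x \<in> H" "y \<in> H" for x y
      using that by (intro fu char_graphD(2)[OF R(1)] f)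
  qed
  moreover have "restrict f H h \<noteq> 1" using fu[of h w] R R1 w h by auto
  moreover have "restrict f H x = 1" if "x \<in> M" for x
    using fu[of x 1] R R1 that M by (auto simp: R0_def)
  ultimately show ?thesis by blast
qed

section \<open>Square integrable functions\<close>

text \<open>The square of the L2 norm is kept throughout. In place of the triangle inequality stands
  \<open>cmod_add_sq_le\<close>, whose factor 2 is absorbed in the choice of tolerances.\<close>

definition sqnorm :: "'x measure \<Rightarrow> ('x \<Rightarrow> complex) \<Rightarrow> real" where
  "sqnorm M f = (\<integral>x. (cmod (f x))\<^sup>2 \<partial>M)"

lemma cmod_add_sq_le: "(cmod (z + w))\<^sup>2 \<le> 2 * (cmod z)\<^sup>2 + 2 * (cmod w)\<^sup>2"
proof -
  have "(cmod (z + w))\<^sup>2 \<le> (cmod z + cmod w)\<^sup>2"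
    by (intro power_mono norm_triangle_ineq) auto
  also have "\<dots> \<le> 2 * (cmod z)\<^sup>2 + 2 * (cmod w)\<^sup>2"
    using zero_le_power2[of "cmod z - cmod w"] by (simp add: power2_eq_square algebra_simps)
  finally show ?thesis .
qed

lemma L2_meas: "f \<in> L2 M \<Longrightarrow> f \<in> borel_measurable M"
  and L2_int: "f \<in> L2 M \<Longrightarrow> integrable M (\<lambda>x. (cmod (f x))\<^sup>2)"
  by (auto simp: L2_def)

lemma cmod_sq_measurable:
  fixes f :: "'x \<Rightarrow> complex"
  shows "f \<in> borel_measurable M \<Longrightarrow> (\<lambda>x. (cmod (f x))\<^sup>2) \<in> borel_measurable M"
  by measurable

lemma L2_bound:
  assumes "f \<in> borel_measurable M" "integrable M w" "AE x in M. (cmod (f x))\<^sup>2 \<le> w x"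
  shows "f \<in> L2 M" "sqnorm M f \<le> (\<integral>x. w x \<partial>M)"
proof -
  have [measurable]: "f \<in> borel_measurable M" by fact
  have "integrable M (\<lambda>x. (cmod (f x))\<^sup>2)"
    by (rule Bochner_Integration.integrable_bound[OF assms(2)])
      (use assms(3) in \<open>auto elim!: eventually_mono\<close>)
  then show "f \<in> L2 M" using assms(1) by (simp add: L2_def)
  show "sqnorm M f \<le> (\<integral>x. w x \<partial>M)"
    unfolding sqnorm_def by (rule integral_mono_AE) fact+
qed

lemma sqnorm_nonneg [simp]: "0 \<le> sqnorm M f"
  by (simp add: sqnorm_def)

lemma L2_add:
  assumes "f \<in> L2 M" "g \<in> L2 M"
  shows "(\<lambda>x. f x + g x) \<in> L2 M" "sqnorm M (\<lambda>x. f x + g x) \<le> 2 * sqnorm M f + 2 * sqnorm M g"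
proof -
  have 1: "integrable M (\<lambda>x. 2 * (cmod (f x))\<^sup>2 + 2 * (cmod (g x))\<^sup>2)"
    by (intro Bochner_Integration.integrable_add integrable_mult_right L2_int assms)
  have 2: "(\<lambda>x. f x + g x) \<in> borel_measurable M"
    using assms by (intro borel_measurable_add L2_meas)
  show "(\<lambda>x. f x + g x) \<in> L2 M"
    by (rule L2_bound(1)[OF 2 1]) (simp add: cmod_add_sq_le)
  have "sqnorm M (\<lambda>x. f x + g x) \<le> (\<integral>x. 2 * (cmod (f x))\<^sup>2 + 2 * (cmod (g x))\<^sup>2 \<partial>M)"
    by (rule L2_bound(2)[OF 2 1]) (simp add: cmod_add_sq_le)
  also have "\<dots> = 2 * sqnorm M f + 2 * sqnorm M g"
    using assms by (simp add: sqnorm_def L2_int)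
  finally show "sqnorm M (\<lambda>x. f x + g x) \<le> 2 * sqnorm M f + 2 * sqnorm M g" .
qed

lemma L2_mult_bounded:
  assumes "f \<in> L2 M" "g \<in> borel_measurable M" "AE x in M. cmod (g x) \<le> C"
  shows "(\<lambda>x. g x * f x) \<in> L2 M" "sqnorm M (\<lambda>x. g x * f x) \<le> C\<^sup>2 * sqnorm M f"
proof -
  have 1: "integrable M (\<lambda>x. C\<^sup>2 * (cmod (f x))\<^sup>2)"
    using assms by (auto intro: L2_int)
  have 2: "(\<lambda>x. g x * f x) \<in> borel_measurable M"
    using assms(2) L2_meas[OF assms(1)] by (intro borel_measurable_times)
  have 3: "AE x in M. (cmod (g x * f x))\<^sup>2 \<le> C\<^sup>2 * (cmod (f x))\<^sup>2"
    using assms(3) by eventually_elim (auto simp: norm_mult power_mult_distrib intro!: mult_right_mono power_mono)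
  show "(\<lambda>x. g x * f x) \<in> L2 M"
    by (rule L2_bound(1)[OF 2 1 3])
  show "sqnorm M (\<lambda>x. g x * f x) \<le> C\<^sup>2 * sqnorm M f"
    using L2_bound(2)[OF 2 1 3] by (simp add: sqnorm_def)
qed

lemma L2_mult_Linf: "f \<in> L2 M \<Longrightarrow> g \<in> Linf M \<Longrightarrow> (\<lambda>x. g x * f x) \<in> L2 M"
  using L2_mult_bounded(1) unfolding Linf_def by blast

lemma L2_scale: "f \<in> L2 M \<Longrightarrow> (\<lambda>x. c * f x) \<in> L2 M"
  by (rule L2_mult_bounded(1)[where C = "cmod c"]) auto

lemma sqnorm_scale: "sqnorm M (\<lambda>x. c * f x) = (cmod c)\<^sup>2 * sqnorm M f"
  by (simp add: sqnorm_def norm_mult power_mult_distrib)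

lemma sqnorm_cmod_cong: "(\<And>x. x \<in> space M \<Longrightarrow> cmod (f x) = cmod (g x)) \<Longrightarrow> sqnorm M f = sqnorm M g"
  unfolding sqnorm_def by (rule Bochner_Integration.integral_cong) auto

lemma L2_cnj: "f \<in> L2 M \<Longrightarrow> (\<lambda>x. cnj (f x)) \<in> L2 M"
  unfolding L2_def
  using borel_measurable_continuous_on[of cnj f M] by (auto simp: continuous_on_cnj continuous_on_id)

lemma L2_diff:
  assumes "f \<in> L2 M" "g \<in> L2 M"
  shows "(\<lambda>x. f x - g x) \<in> L2 M" "sqnorm M (\<lambda>x. f x - g x) \<le> 2 * sqnorm M f + 2 * sqnorm M g"
  using L2_add[OF assms(1) L2_scale[OF assms(2), of "- 1"]] sqnorm_scale[of M "-1" g] by auto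

lemma L2_zero: "(\<lambda>x. 0) \<in> L2 M"
  by (simp add: L2_def)

lemma L2_sum: "(\<And>i. i \<in> I \<Longrightarrow> f i \<in> L2 M) \<Longrightarrow> (\<lambda>x. \<Sum>i\<in>I. f i x) \<in> L2 M"
  by (induction I rule: infinite_finite_induct) (auto simp: L2_zero L2_add)

lemma sqnorm_zero: "sqnorm M (\<lambda>x. 0) = 0"
  by (simp add: sqnorm_def)

lemma sqnorm_diff_triangle:
  assumes "f \<in> L2 M" "g \<in> L2 M" "h \<in> L2 M"
  shows "sqnorm M (\<lambda>x. f x - h x) \<le> 2 * sqnorm M (\<lambda>x. f x - g x) + 2 * sqnorm M (\<lambda>x. g x - h x)"
  using L2_add(2)[OF L2_diff(1)[OF assms(1,2)] L2_diff(1)[OF assms(2,3)]] by simp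

lemma L2_product_integrable:
  assumes "f \<in> L2 M" "g \<in> L2 M"
  shows "integrable M (\<lambda>x. f x * g x)"
proof (rule Bochner_Integration.integrable_bound)
  show "integrable M (\<lambda>x. (cmod (f x))\<^sup>2 + (cmod (g x))\<^sup>2)"
    using assms by (auto intro: L2_int)
  show "(\<lambda>x. f x * g x) \<in> borel_measurable M"
    using assms by (intro borel_measurable_times L2_meas)
  have "cmod z * cmod w \<le> (cmod z)\<^sup>2 + (cmod w)\<^sup>2" for z w
  proof -
    have "cmod z * cmod w \<le> 2 * (cmod z * cmod w)" by simp
    also have "\<dots> \<le> (cmod z)\<^sup>2 + (cmod w)\<^sup>2"
      using zero_le_power2[of "cmod z - cmod w"] by (simp add: power2_eq_square algebra_simps)
    finally show ?thesis .
  qed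
  then show "AE x in M. norm (f x * g x) \<le> norm ((cmod (f x))\<^sup>2 + (cmod (g x))\<^sup>2)"
    by (simp add: norm_mult)
qed

lemma sqnorm_eq_0_iff:
  assumes "f \<in> L2 M"
  shows "sqnorm M f = 0 \<longleftrightarrow> (AE x in M. f x = 0)"
  unfolding sqnorm_def using integral_nonneg_eq_0_iff_AE[OF L2_int[OF assms]] by simp

text \<open>Reduces inner products to norms, so that the polarized Parseval identity follows from
  Parseval's identity.\<close>

lemma polarization_complex:
  "4 * (z * cnj w) = of_real ((cmod (z + w))\<^sup>2) - of_real ((cmod (z - w))\<^sup>2)
     + \<i> * of_real ((cmod (z + \<i> * w))\<^sup>2) - \<i> * of_real ((cmod (z - \<i> * w))\<^sup>2)"
  unfolding complex_norm_square by (simp add: algebra_simps)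

lemma polarization_integral:
  assumes f: "f \<in> L2 M" and g: "g \<in> L2 M"
  shows "4 * (\<integral>x. f x * cnj (g x) \<partial>M) = of_real (sqnorm M (\<lambda>x. f x + g x)) - of_real (sqnorm M (\<lambda>x. f x - g x))
     + \<i> * of_real (sqnorm M (\<lambda>x. f x + \<i> * g x)) - \<i> * of_real (sqnorm M (\<lambda>x. f x - \<i> * g x))"
proof -
  note [simp] = L2_int[OF L2_add(1)[OF f g]] L2_int[OF L2_diff(1)[OF f g]]
    L2_int[OF L2_add(1)[OF f L2_scale[OF g, of \<i>]]] L2_int[OF L2_diff(1)[OF f L2_scale[OF g, of \<i>]]]
  have "4 * (\<integral>x. f x * cnj (g x) \<partial>M) = (\<integral>x. 4 * (f x * cnj (g x)) \<partial>M)"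
    by simp
  also have "\<dots> = of_real (sqnorm M (\<lambda>x. f x + g x)) - of_real (sqnorm M (\<lambda>x. f x - g x))
     + \<i> * of_real (sqnorm M (\<lambda>x. f x + \<i> * g x)) - \<i> * of_real (sqnorm M (\<lambda>x. f x - \<i> * g x))"
    unfolding polarization_complex sqnorm_def by (simp del: of_real_power)
  finally show ?thesis .
qed

text \<open>Fatou's lemma for real integrals. It also yields integrability of the limit, which is
  how limits of L2 functions are seen to lie in L2.\<close>

lemma fatou_bound:
  fixes u :: "nat \<Rightarrow> 'x \<Rightarrow> real"
  assumes u: "\<And>k. integrable M (u k)" "\<And>k x. 0 \<le> u k x" and C: "\<And>k. (\<integral>x. u k x \<partial>M) \<le> C"
    and f: "f \<in> borel_measurable M" and lim: "AE x in M. (\<lambda>k. u k x) \<longlonglongrightarrow> f x"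
  shows "integrable M f" "(\<integral>x. f x \<partial>M) \<le> C"
proof -
  have f0: "AE x in M. 0 \<le> f x"
    using lim by eventually_elim (use u in \<open>auto intro: LIMSEQ_le_const\<close>)
  have "0 \<le> (\<integral>x. u 0 x \<partial>M)" using u(2) by simp
  then have C0: "0 \<le> C" using C[of 0] by linarith
  have "(\<integral>\<^sup>+x. ennreal (f x) \<partial>M) = (\<integral>\<^sup>+x. liminf (\<lambda>k. ennreal (u k x)) \<partial>M)"
    using lim by (intro nn_integral_cong_AE, eventually_elim)
      (metis lim_imp_Liminf tendsto_ennrealI trivial_limit_sequentially)
  also have "\<dots> \<le> liminf (\<lambda>k. \<integral>\<^sup>+x. ennreal (u k x) \<partial>M)"
    using u(1) by (intro nn_integral_liminf) auto
  also have "\<dots> \<le> ennreal C"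
  proof -
    have "(\<integral>\<^sup>+x. ennreal (u k x) \<partial>M) \<le> ennreal C" for k
      using nn_integral_eq_integral[OF u(1), of k] u(2) C[of k] by (simp add: ennreal_leI)
    then show ?thesis
      by (intro Liminf_le) auto
  qed
  finally have le: "(\<integral>\<^sup>+x. ennreal (f x) \<partial>M) \<le> ennreal C" .
  show "integrable M f"
    using f f0 le by (intro integrableI_nonneg) (auto intro: le_less_trans)
  then have "ennreal (\<integral>x. f x \<partial>M) \<le> ennreal C"
    using nn_integral_eq_integral[of M f] f0 le by simp
  then show "(\<integral>x. f x \<partial>M) \<le> C" using C0 by simp
qed

lemma (in prob_space) L2_integrable: "f \<in> L2 M \<Longrightarrow> integrable M f"
  using L2_product_integrable[of f M "\<lambda>x. 1"] by (simp add: L2_def)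

lemma (in prob_space) L2_of_Linf: assumes "f \<in> Linf M" shows "f \<in> L2 M"
proof -
  have "(\<lambda>x. 1) \<in> L2 M" by (simp add: L2_def)
  then show ?thesis using L2_mult_Linf[OF _ assms] by fastforce
qed

text \<open>Expanding (|z| - e)^2 >= 0 gives the bound for the integrand. With
  \<open>sqnorm M f < e\<^sup>2\<close> the right side is below e, so smallness in the squared L2
  norm implies smallness in L1.\<close>

lemma (in prob_space) L1_le_sqnorm:
  assumes f: "f \<in> L2 M" and "e > 0"
  shows "(\<integral>x. cmod (f x) \<partial>M) \<le> e / 2 + sqnorm M f / (2 * e)"
proof -
  have "cmod z \<le> e / 2 + (cmod z)\<^sup>2 / (2 * e)" for z
    using zero_le_power2[of "cmod z - e"] \<open>e > 0\<close> by (simp add: power2_eq_square field_simps)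
  then have "(\<integral>x. cmod (f x) \<partial>M) \<le> (\<integral>x. e / 2 + (cmod (f x))\<^sup>2 / (2 * e) \<partial>M)"
    using L2_integrable[OF f] L2_int[OF f] by (intro integral_mono) auto
  also have "\<dots> = e / 2 + sqnorm M f / (2 * e)"
    using L2_int[OF f] by (simp add: sqnorm_def prob_space)
  finally show ?thesis .
qed

text \<open>On a probability space a sequence that is Cauchy in L2 is Cauchy in L1, where almost
  everywhere Cauchy subsequences are available.\<close>

lemma (in prob_space) L2_Cauchy_AE_subseq:
  fixes f :: "nat \<Rightarrow> 'a \<Rightarrow> complex"
  assumes f: "\<And>n. f n \<in> L2 M"
    and C: "\<And>e. e > 0 \<Longrightarrow> \<exists>N. \<forall>i\<ge>N. \<forall>j\<ge>N. sqnorm M (\<lambda>x. f i x - f j x) < e"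
  obtains r where "strict_mono r" "AE x in M. Cauchy (\<lambda>i. f (r i) x)"
proof (rule cauchy_L1_AE_cauchy_subseq[of M f])
  show "integrable M (f n)" for n using L2_integrable[OF f] .
  fix e :: real assume e: "e > 0"
  then obtain N where N: "\<And>i j. i \<ge> N \<Longrightarrow> j \<ge> N \<Longrightarrow> sqnorm M (\<lambda>x. f i x - f j x) < e\<^sup>2"
    using C[of "e\<^sup>2"] by auto
  have "(\<integral>x. norm (f i x - f j x) \<partial>M) < e" if "i \<ge> N" "j \<ge> N" for i j
  proof -
    have "(\<integral>x. norm (f i x - f j x) \<partial>M) \<le> e / 2 + sqnorm M (\<lambda>x. f i x - f j x) / (2 * e)"
      using L1_le_sqnorm[OF L2_diff(1)[OF f f] e] .
    also have "\<dots> < e / 2 + e\<^sup>2 / (2 * e)"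
      using N[OF that] e by (intro add_strict_left_mono divide_strict_right_mono) auto
    also have "\<dots> = e" using e by (simp add: power2_eq_square)
    finally show ?thesis .
  qed
  then show "\<exists>N. \<forall>i\<ge>N. \<forall>j\<ge>N. (\<integral>x. norm (f i x - f j x) \<partial>M) < e" by blast
qed (use that in blast)

text \<open>The subsequence converging almost everywhere provides the limit F. Fatou's lemma,
  applied along it to the differences with a fixed \<open>f n\<close>, bounds the distance from F to
  every late member of the whole sequence.\<close>

lemma (in prob_space) L2_complete:
  fixes f :: "nat \<Rightarrow> 'a \<Rightarrow> complex"
  assumes f: "\<And>n. f n \<in> L2 M"
    and C: "\<And>e. e > 0 \<Longrightarrow> \<exists>N. \<forall>i\<ge>N. \<forall>j\<ge>N. sqnorm M (\<lambda>x. f i x - f j x) < e"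
  obtains F where "F \<in> L2 M" "(\<lambda>n. sqnorm M (\<lambda>x. F x - f n x)) \<longlonglongrightarrow> 0"
proof -
  obtain r where r: "strict_mono r" "AE x in M. Cauchy (\<lambda>i. f (r i) x)"
    using L2_Cauchy_AE_subseq[OF f C] by blast
  define F where "F x = lim (\<lambda>i. f (r i) x)" for x
  have fm [measurable]: "f n \<in> borel_measurable M" for n using L2_meas[OF f] .
  have F [measurable]: "F \<in> borel_measurable M" unfolding F_def by measurable
  have lim: "AE x in M. (\<lambda>i. f (r i) x) \<longlonglongrightarrow> F x"
    using r(2) by eventually_elim (auto simp: F_def Cauchy_convergent_iff convergent_LIMSEQ_iff)
  have main: "(\<lambda>x. F x - f n x) \<in> L2 M \<and> sqnorm M (\<lambda>x. F x - f n x) \<le> e"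
    if N: "\<And>i j. i \<ge> N \<Longrightarrow> j \<ge> N \<Longrightarrow> sqnorm M (\<lambda>x. f i x - f j x) < e" and n: "n \<ge> N" for N n e
  proof -
    \<comment> \<open>The shift by N keeps all indices \<open>r (k + N)\<close> at or above N, where
      the Cauchy bound holds.\<close>
    let ?u = "\<lambda>k x. (cmod (f (r (k + N)) x - f n x))\<^sup>2"
    have rk: "r (k + N) \<ge> N" for k using seq_suble[OF r(1), of "k + N"] by simp
    have 1: "integrable M (?u k)" for k using L2_int[OF L2_diff(1)[OF f f]] .
    have 2: "(\<integral>x. ?u k x \<partial>M) \<le> e" for k
      using N[OF rk n, of k] by (simp add: sqnorm_def)
    have 3: "AE x in M. (\<lambda>k. ?u k x) \<longlonglongrightarrow> (cmod (F x - f n x))\<^sup>2"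
      using lim
    proof eventually_elim
      case (elim x)
      have "(\<lambda>k. f (r (k + N)) x) \<longlonglongrightarrow> F x" using LIMSEQ_ignore_initial_segment[OF elim] .
      then show ?case by (intro tendsto_intros)
    qed
    have 4: "(\<lambda>x. (cmod (F x - f n x))\<^sup>2) \<in> borel_measurable M" by measurable
    have "integrable M (\<lambda>x. (cmod (F x - f n x))\<^sup>2)" "(\<integral>x. (cmod (F x - f n x))\<^sup>2 \<partial>M) \<le> e"
      by (rule fatou_bound[of M ?u, OF 1 _ 2 4 3], simp)+
    then show ?thesis by (auto simp: L2_def sqnorm_def)
  qed
  obtain N where N: "\<And>i j. i \<ge> N \<Longrightarrow> j \<ge> N \<Longrightarrow> sqnorm M (\<lambda>x. f i x - f j x) < 1"
    using C[of 1] by auto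
  have "(\<lambda>x. (F x - f N x) + f N x) \<in> L2 M"
    using main[OF N, of N] f by (intro L2_add) auto
  then have "F \<in> L2 M" by simp
  moreover have "(\<lambda>n. sqnorm M (\<lambda>x. F x - f n x)) \<longlonglongrightarrow> 0"
  proof (rule LIMSEQ_I)
    fix e :: real assume "e > 0"
    then obtain N where N: "\<And>i j. i \<ge> N \<Longrightarrow> j \<ge> N \<Longrightarrow> sqnorm M (\<lambda>x. f i x - f j x) < e / 2"
      using C[of "e / 2"] by auto
    have "sqnorm M (\<lambda>x. F x - f n x) \<le> e / 2" if "n \<ge> N" for n
      using main[OF N that] by blast
    then show "\<exists>N. \<forall>n\<ge>N. norm (sqnorm M (\<lambda>x. F x - f n x) - 0) < e"
      using \<open>e > 0\<close> by (intro exI[of _ N]) fastforce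
  qed
  ultimately show ?thesis using that by blast
qed

section \<open>Fourier analysis on the dual group\<close>

context dual_haar
begin

definition fourier :: "(('g \<Rightarrow> complex) \<Rightarrow> complex) \<Rightarrow> 'g \<Rightarrow> complex" where
  "fourier F h = (\<integral>\<gamma>. F \<gamma> * cnj (\<gamma> h) \<partial>m)"

definition partial_sum :: "(('g \<Rightarrow> complex) \<Rightarrow> complex) \<Rightarrow> 'g set \<Rightarrow> ('g \<Rightarrow> complex) \<Rightarrow> complex" where
  "partial_sum F J \<gamma> = (\<Sum>h\<in>J. fourier F h * \<gamma> h)"

lemma cnj_measurable [measurable (raw)]: "f \<in> borel_measurable M \<Longrightarrow> (\<lambda>x. cnj (f x)) \<in> borel_measurable M"
  using borel_measurable_continuous_on[of cnj f M] by (simp add: continuous_on_cnj continuous_on_id)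

lemma AE_D: "(\<And>\<gamma>. \<gamma> \<in> D \<Longrightarrow> P \<gamma>) \<Longrightarrow> AE \<gamma> in m. P \<gamma>"
  by (rule AE_I2) (simp add: space_m)

lemma integral_cong_D: "(\<And>\<gamma>. \<gamma> \<in> D \<Longrightarrow> f \<gamma> = g \<gamma>) \<Longrightarrow> integral\<^sup>L m f = integral\<^sup>L m g"
  by (rule Bochner_Integration.integral_cong) (simp_all add: space_m)

lemma char_Linf: "h \<in> H \<Longrightarrow> (\<lambda>\<gamma>. \<gamma> h) \<in> Linf m"
  unfolding Linf_def by (intro CollectI conjI char_measurable exI[of _ 1] AE_D) (simp_all add: char_norm)

lemma char_L2: "h \<in> H \<Longrightarrow> (\<lambda>\<gamma>. \<gamma> h) \<in> L2 m"
  by (rule L2_of_Linf[OF char_Linf])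

lemma cnj_char_L2: "h \<in> H \<Longrightarrow> (\<lambda>\<gamma>. cnj (\<gamma> h)) \<in> L2 m"
  by (rule L2_cnj[OF char_L2])

lemma char_mult_L2: "h \<in> H \<Longrightarrow> F \<in> L2 m \<Longrightarrow> (\<lambda>\<gamma>. \<gamma> h * F \<gamma>) \<in> L2 m"
  by (rule L2_mult_Linf[OF _ char_Linf])

lemma fourier_integrable: "F \<in> L2 m \<Longrightarrow> h \<in> H \<Longrightarrow> integrable m (\<lambda>\<gamma>. F \<gamma> * cnj (\<gamma> h))"
  by (rule L2_product_integrable[OF _ cnj_char_L2])

lemma fourier_cong_AE:
  assumes "F \<in> borel_measurable m" "K \<in> borel_measurable m" "AE \<gamma> in m. F \<gamma> = K \<gamma>" "h \<in> H"
  shows "fourier F h = fourier K h"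
  unfolding fourier_def
proof (rule integral_cong_AE)
  show "AE \<gamma> in m. F \<gamma> * cnj (\<gamma> h) = K \<gamma> * cnj (\<gamma> h)"
    using assms(3) by eventually_elim simp
qed (intro borel_measurable_times cnj_measurable char_measurable assms)+

lemma fourier_add: "F \<in> L2 m \<Longrightarrow> K \<in> L2 m \<Longrightarrow> h \<in> H \<Longrightarrow> fourier (\<lambda>\<gamma>. F \<gamma> + K \<gamma>) h = fourier F h + fourier K h"
  unfolding fourier_def by (simp add: distrib_right fourier_integrable)

lemma fourier_diff: "F \<in> L2 m \<Longrightarrow> K \<in> L2 m \<Longrightarrow> h \<in> H \<Longrightarrow> fourier (\<lambda>\<gamma>. F \<gamma> - K \<gamma>) h = fourier F h - fourier K h"
  unfolding fourier_def by (simp add: left_diff_distrib fourier_integrable)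

lemma fourier_scale: "fourier (\<lambda>\<gamma>. c * F \<gamma>) h = c * fourier F h"
  unfolding fourier_def by (simp add: mult.assoc)

lemma fourier_sum:
  assumes "\<And>i. i \<in> I \<Longrightarrow> F i \<in> L2 m" "h \<in> H"
  shows "fourier (\<lambda>\<gamma>. \<Sum>i\<in>I. F i \<gamma>) h = (\<Sum>i\<in>I. fourier (F i) h)"
  using assms(1)
proof (induction I rule: infinite_finite_induct)
  case (insert i I)
  then show ?case using fourier_add[OF _ L2_sum assms(2), of "F i" I F] by simp
qed (simp_all add: fourier_def)

lemma fourier_translate:
  assumes "\<delta> \<in> D" "F \<in> borel_measurable m" "h \<in> H"
  shows "fourier (\<lambda>\<gamma>. F (\<delta> \<boxplus> \<gamma>)) h = \<delta> h * fourier F h"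
proof -
  have "fourier (\<lambda>\<gamma>. F (\<delta> \<boxplus> \<gamma>)) h = (\<integral>\<gamma>. \<delta> h * (F (\<delta> \<boxplus> \<gamma>) * cnj ((\<delta> \<boxplus> \<gamma>) h)) \<partial>m)"
    unfolding fourier_def
  proof (rule integral_cong_D)
    fix \<gamma> assume "\<gamma> \<in> D"
    have "\<delta> h * (F (\<delta> \<boxplus> \<gamma>) * cnj ((\<delta> \<boxplus> \<gamma>) h)) = (\<delta> h * cnj (\<delta> h)) * (F (\<delta> \<boxplus> \<gamma>) * cnj (\<gamma> h))"
      using assms(3) by (simp add: translate_apply)
    then show "F (\<delta> \<boxplus> \<gamma>) * cnj (\<gamma> h) = \<delta> h * (F (\<delta> \<boxplus> \<gamma>) * cnj ((\<delta> \<boxplus> \<gamma>) h))"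
      unfolding char_mult_cnj[OF assms(1,3)] mult_1_left by (rule sym)
  qed
  also have "\<dots> = \<delta> h * (\<integral>\<gamma>. F (\<delta> \<boxplus> \<gamma>) * cnj ((\<delta> \<boxplus> \<gamma>) h) \<partial>m)" by simp
  also have "(\<integral>\<gamma>. F (\<delta> \<boxplus> \<gamma>) * cnj ((\<delta> \<boxplus> \<gamma>) h) \<partial>m) = fourier F h"
    unfolding fourier_def
    by (rule translate_integral[OF assms(1), of "\<lambda>\<gamma>. F \<gamma> * cnj (\<gamma> h)"])
      (intro borel_measurable_times cnj_measurable char_measurable assms)
  finally show ?thesis .
qed

text \<open>Translation by \<delta> leaves the integral unchanged and also multiplies it by \<delta>
  h; a character with \<delta> h different from 1 forces it to vanish.\<close>

lemma fourier_one: assumes "h \<in> H" shows "fourier (\<lambda>_. 1) h = (if h = 0 then 1 else 0)"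
proof (cases "h = 0")
  case True
  have "fourier (\<lambda>_. 1) h = (\<integral>\<gamma>. 1 \<partial>m)"
    unfolding fourier_def using True by (intro integral_cong_D) (simp add: char_0)
  then show ?thesis using True by (simp add: prob_space)
next
  case False
  have "add_subgroup {0::'g}" by (simp add: add_subgroup_def)
  then obtain \<delta> where d: "\<delta> \<in> D" "\<delta> h \<noteq> 1"
    using exists_character_separating[OF sub disc, of "{0}" h] assms False by auto
  have "fourier (\<lambda>_. 1) h = \<delta> h * fourier (\<lambda>_. 1) h"
    using fourier_translate[OF d(1), of "\<lambda>_. 1" h] assms by simp
  then show ?thesis using d(2) False by simp
qed

lemma fourier_char_mult:
  assumes "k \<in> H" "h \<in> H"
  shows "fourier (\<lambda>\<gamma>. \<gamma> k * F \<gamma>) h = fourier F (h - k)"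
  unfolding fourier_def using assms by (intro integral_cong_D) (simp add: char_diff mult_ac)

lemma fourier_char: "k \<in> H \<Longrightarrow> h \<in> H \<Longrightarrow> fourier (\<lambda>\<gamma>. \<gamma> k) h = (if h = k then 1 else 0)"
  using fourier_char_mult[of k h "\<lambda>_. 1"] fourier_one[OF H_diff, of h k] by simp

lemma trig_L2: "J \<subseteq> H \<Longrightarrow> (\<lambda>\<gamma>. \<Sum>h\<in>J. c h * \<gamma> h) \<in> L2 m"
  by (intro L2_sum L2_scale char_L2) auto

lemma partial_sum_L2: "J \<subseteq> H \<Longrightarrow> partial_sum F J \<in> L2 m"
  unfolding partial_sum_def by (rule trig_L2)

lemma fourier_trig: "finite J \<Longrightarrow> J \<subseteq> H \<Longrightarrow> h \<in> H \<Longrightarrow> fourier (\<lambda>\<gamma>. \<Sum>k\<in>J. c k * \<gamma> k) h = (if h \<in> J then c h else 0)"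
proof -
  assume J: "finite J" "J \<subseteq> H" and h: "h \<in> H"
  have "fourier (\<lambda>\<gamma>. \<Sum>k\<in>J. c k * \<gamma> k) h = (\<Sum>k\<in>J. c k * (if h = k then 1 else 0))"
    using J h by (subst fourier_sum) (auto simp: fourier_scale fourier_char subset_iff intro!: L2_scale char_L2 sum.cong)
  also have "\<dots> = (\<Sum>k\<in>J. if h = k then c k else 0)" by (intro sum.cong) auto
  also have "\<dots> = (if h \<in> J then c h else 0)" using J by (simp add: sum.delta)
  finally show ?thesis .
qed

lemma integral_mult_cnj_trig:
  assumes F: "F \<in> L2 m" and J: "J \<subseteq> H"
  shows "(\<integral>\<gamma>. F \<gamma> * cnj (\<Sum>h\<in>J. c h * \<gamma> h) \<partial>m) = (\<Sum>h\<in>J. cnj (c h) * fourier F h)"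
proof -
  have "(\<integral>\<gamma>. F \<gamma> * cnj (\<Sum>h\<in>J. c h * \<gamma> h) \<partial>m) = (\<integral>\<gamma>. (\<Sum>h\<in>J. cnj (c h) * (F \<gamma> * cnj (\<gamma> h))) \<partial>m)"
    by (simp add: sum_distrib_left mult_ac)
  also have "\<dots> = (\<Sum>h\<in>J. (\<integral>\<gamma>. cnj (c h) * (F \<gamma> * cnj (\<gamma> h)) \<partial>m))"
    using J by (intro Bochner_Integration.integral_sum integrable_mult_right fourier_integrable[OF F]) auto
  finally show ?thesis by (simp add: fourier_def)
qed

lemma sqnorm_complex: "F \<in> L2 m \<Longrightarrow> complex_of_real (sqnorm m F) = (\<integral>\<gamma>. F \<gamma> * cnj (F \<gamma>) \<partial>m)"
  unfolding sqnorm_def complex_norm_square[symmetric] by (rule integral_of_real[symmetric], rule L2_int)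

text \<open>Pythagoras for the orthonormal characters. The last sum vanishes when c consists of the
  Fourier coefficients; Bessel's inequality and the optimality of \<open>partial_sum\<close> are
  both read off from it.\<close>

lemma sqnorm_approx:
  assumes F: "F \<in> L2 m" and J: "finite J" "J \<subseteq> H"
  shows "sqnorm m (\<lambda>\<gamma>. F \<gamma> - (\<Sum>h\<in>J. c h * \<gamma> h))
    = sqnorm m F - (\<Sum>h\<in>J. (cmod (fourier F h))\<^sup>2) + (\<Sum>h\<in>J. (cmod (fourier F h - c h))\<^sup>2)"
proof -
  define p where "p \<gamma> = (\<Sum>h\<in>J. c h * \<gamma> h)" for \<gamma>
  have p: "p \<in> L2 m" unfolding p_def using J by (intro trig_L2)
  note int = L2_product_integrable[OF F L2_cnj[OF p]] L2_product_integrable[OF p L2_cnj[OF F]]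
    L2_product_integrable[OF F L2_cnj[OF F]] L2_product_integrable[OF p L2_cnj[OF p]]
  have Fp: "(\<integral>\<gamma>. F \<gamma> * cnj (p \<gamma>) \<partial>m) = (\<Sum>h\<in>J. cnj (c h) * fourier F h)"
    unfolding p_def by (rule integral_mult_cnj_trig[OF F J(2)])
  have "(\<integral>\<gamma>. p \<gamma> * cnj (F \<gamma>) \<partial>m) = cnj (\<integral>\<gamma>. F \<gamma> * cnj (p \<gamma>) \<partial>m)"
    by (simp add: Bochner_Integration.integral_cnj[symmetric] mult.commute)
  then have pF: "(\<integral>\<gamma>. p \<gamma> * cnj (F \<gamma>) \<partial>m) = (\<Sum>h\<in>J. c h * cnj (fourier F h))"
    unfolding Fp by simp
  have "(\<integral>\<gamma>. p \<gamma> * cnj (p \<gamma>) \<partial>m) = (\<Sum>h\<in>J. cnj (c h) * fourier p h)"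
    using integral_mult_cnj_trig[OF p J(2), of c] unfolding p_def .
  also have "\<dots> = (\<Sum>h\<in>J. cnj (c h) * c h)"
    unfolding p_def using J by (intro sum.cong refl) (auto simp: fourier_trig subset_iff)
  finally have pp: "(\<integral>\<gamma>. p \<gamma> * cnj (p \<gamma>) \<partial>m) = (\<Sum>h\<in>J. cnj (c h) * c h)" .
  have "complex_of_real (sqnorm m (\<lambda>\<gamma>. F \<gamma> - p \<gamma>)) = (\<integral>\<gamma>. (F \<gamma> - p \<gamma>) * cnj (F \<gamma> - p \<gamma>) \<partial>m)"
    by (rule sqnorm_complex[OF L2_diff(1)[OF F p]])
  also have "\<dots> = (\<integral>\<gamma>. F \<gamma> * cnj (F \<gamma>) - F \<gamma> * cnj (p \<gamma>) - p \<gamma> * cnj (F \<gamma>) + p \<gamma> * cnj (p \<gamma>) \<partial>m)"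
    by (simp add: algebra_simps)
  also have "\<dots> = complex_of_real (sqnorm m F) - (\<Sum>h\<in>J. cnj (c h) * fourier F h) - (\<Sum>h\<in>J. c h * cnj (fourier F h))
      + (\<Sum>h\<in>J. cnj (c h) * c h)"
    using int by (simp add: Fp pF pp sqnorm_complex[OF F])
  also have "\<dots> = complex_of_real (sqnorm m F) - (\<Sum>h\<in>J. fourier F h * cnj (fourier F h))
      + (\<Sum>h\<in>J. (fourier F h - c h) * cnj (fourier F h - c h))"
    by (simp add: algebra_simps sum.distrib sum_subtractf)
  also have "\<dots> = complex_of_real (sqnorm m F - (\<Sum>h\<in>J. (cmod (fourier F h))\<^sup>2) + (\<Sum>h\<in>J. (cmod (fourier F h - c h))\<^sup>2))"
    unfolding complex_norm_square[symmetric] by simp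
  finally show ?thesis unfolding p_def using of_real_eq_iff by blast
qed

lemma sqnorm_partial_sum: "F \<in> L2 m \<Longrightarrow> finite J \<Longrightarrow> J \<subseteq> H \<Longrightarrow>
    sqnorm m (\<lambda>\<gamma>. F \<gamma> - partial_sum F J \<gamma>) = sqnorm m F - (\<Sum>h\<in>J. (cmod (fourier F h))\<^sup>2)"
  unfolding partial_sum_def by (simp add: sqnorm_approx)

lemma bessel: "F \<in> L2 m \<Longrightarrow> finite J \<Longrightarrow> J \<subseteq> H \<Longrightarrow> (\<Sum>h\<in>J. (cmod (fourier F h))\<^sup>2) \<le> sqnorm m F"
  using sqnorm_partial_sum[of F J] sqnorm_nonneg[of m "\<lambda>\<gamma>. F \<gamma> - partial_sum F J \<gamma>"] by linarith

lemma partial_sum_best: "F \<in> L2 m \<Longrightarrow> finite J \<Longrightarrow> J \<subseteq> H \<Longrightarrow>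
    sqnorm m (\<lambda>\<gamma>. F \<gamma> - partial_sum F J \<gamma>) \<le> sqnorm m (\<lambda>\<gamma>. F \<gamma> - (\<Sum>h\<in>J. c h * \<gamma> h))"
  by (simp add: sqnorm_approx sqnorm_partial_sum sum_nonneg)

lemma partial_sum_antimono:
  assumes "F \<in> L2 m" "finite K" "K \<subseteq> H" "J \<subseteq> K"
  shows "sqnorm m (\<lambda>\<gamma>. F \<gamma> - partial_sum F K \<gamma>) \<le> sqnorm m (\<lambda>\<gamma>. F \<gamma> - partial_sum F J \<gamma>)"
proof -
  have "finite J" "J \<subseteq> H" using assms finite_subset by auto
  moreover have "(\<Sum>h\<in>J. (cmod (fourier F h))\<^sup>2) \<le> (\<Sum>h\<in>K. (cmod (fourier F h))\<^sup>2)"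
    by (rule sum_mono2) (use assms in auto)
  ultimately show ?thesis using assms by (simp add: sqnorm_partial_sum)
qed

text \<open>The closed span \<open>trig_closure\<close> of the characters is all of \<open>L\<^sup>2\<close>: the bounded functions that multiply
  \<open>trig_closure\<close> into itself form an algebra closed under bounded pointwise limits, it contains
  \<open>\<gamma> \<mapsto> g (\<gamma> h)\<close> for continuous \<open>g\<close> by the Weierstrass theorem, and so all indicator functions.\<close>

definition trig_closure where
  "trig_closure = {F \<in> L2 m. \<forall>e>0. \<exists>J. finite J \<and> J \<subseteq> H \<and> sqnorm m (\<lambda>\<gamma>. F \<gamma> - partial_sum F J \<gamma>) < e}"

lemma trig_closure_L2: "F \<in> trig_closure \<Longrightarrow> F \<in> L2 m" by (simp add: trig_closure_def)

text \<open>The Fourier partial sum of F over J is at least as close to F as that of K, and the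
  latter is close to F because it is close to K.\<close>

lemma trig_closure_closed:
  assumes F: "F \<in> L2 m" and K: "\<And>e. e > 0 \<Longrightarrow> \<exists>K\<in>trig_closure. sqnorm m (\<lambda>\<gamma>. F \<gamma> - K \<gamma>) < e"
  shows "F \<in> trig_closure"
  unfolding trig_closure_def
proof (intro CollectI conjI F allI impI)
  fix e :: real assume "e > 0"
  then obtain K where K: "K \<in> trig_closure" "sqnorm m (\<lambda>\<gamma>. F \<gamma> - K \<gamma>) < e / 4" using K[of "e / 4"] by auto
  then obtain J where J: "finite J" "J \<subseteq> H" "sqnorm m (\<lambda>\<gamma>. K \<gamma> - partial_sum K J \<gamma>) < e / 4"
    unfolding trig_closure_def using \<open>e > 0\<close> by (auto dest: spec[of _ "e / 4"])
  have "sqnorm m (\<lambda>\<gamma>. F \<gamma> - partial_sum F J \<gamma>) \<le> sqnorm m (\<lambda>\<gamma>. F \<gamma> - partial_sum K J \<gamma>)"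
    using partial_sum_best[OF F J(1,2), of "fourier K"] by (simp add: partial_sum_def)
  also have "\<dots> \<le> 2 * sqnorm m (\<lambda>\<gamma>. F \<gamma> - K \<gamma>) + 2 * sqnorm m (\<lambda>\<gamma>. K \<gamma> - partial_sum K J \<gamma>)"
    by (rule sqnorm_diff_triangle[OF F trig_closure_L2[OF K(1)] partial_sum_L2[OF J(2)]])
  also have "\<dots> < e" using K J by linarith
  finally show "\<exists>J. finite J \<and> J \<subseteq> H \<and> sqnorm m (\<lambda>\<gamma>. F \<gamma> - partial_sum F J \<gamma>) < e" using J by blast
qed

lemma trig_closure_trig: assumes "finite J" "J \<subseteq> H" shows "(\<lambda>\<gamma>. \<Sum>h\<in>J. c h * \<gamma> h) \<in> trig_closure"
proof -
  have "partial_sum (\<lambda>\<gamma>. \<Sum>h\<in>J. c h * \<gamma> h) J = (\<lambda>\<gamma>. \<Sum>h\<in>J. c h * \<gamma> h)"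
    unfolding partial_sum_def using assms by (intro ext sum.cong refl) (auto simp: fourier_trig subset_iff)
  then show ?thesis
    unfolding trig_closure_def using assms trig_L2[OF assms(2)] sqnorm_zero[of m] by (auto intro!: exI[of _ J])
qed

lemma trig_closure_add: assumes F: "F \<in> trig_closure" and K: "K \<in> trig_closure" shows "(\<lambda>\<gamma>. F \<gamma> + K \<gamma>) \<in> trig_closure"
proof (rule trig_closure_closed)
  show FK: "(\<lambda>\<gamma>. F \<gamma> + K \<gamma>) \<in> L2 m" using L2_add(1) trig_closure_L2 F K by blast
  fix e :: real assume "e > 0"
  then obtain J1 J2 where J1: "finite J1" "J1 \<subseteq> H" "sqnorm m (\<lambda>\<gamma>. F \<gamma> - partial_sum F J1 \<gamma>) < e / 4"
    and J2: "finite J2" "J2 \<subseteq> H" "sqnorm m (\<lambda>\<gamma>. K \<gamma> - partial_sum K J2 \<gamma>) < e / 4"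
    using F K unfolding trig_closure_def by (auto dest!: spec[of _ "e / 4"])
  let ?J = "J1 \<union> J2"
  have J: "finite ?J" "?J \<subseteq> H" using J1 J2 by auto
  let ?p = "\<lambda>\<gamma>. \<Sum>h\<in>?J. (fourier F h + fourier K h) * \<gamma> h"
  have "sqnorm m (\<lambda>\<gamma>. F \<gamma> + K \<gamma> - ?p \<gamma>) = sqnorm m (\<lambda>\<gamma>. (F \<gamma> - partial_sum F ?J \<gamma>) + (K \<gamma> - partial_sum K ?J \<gamma>))"
    by (simp add: partial_sum_def algebra_simps sum.distrib)
  also have "\<dots> \<le> 2 * sqnorm m (\<lambda>\<gamma>. F \<gamma> - partial_sum F ?J \<gamma>) + 2 * sqnorm m (\<lambda>\<gamma>. K \<gamma> - partial_sum K ?J \<gamma>)"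
    using trig_closure_L2[OF F] trig_closure_L2[OF K] partial_sum_L2[OF J(2)] by (intro L2_add(2) L2_diff(1))
  also have "\<dots> < e"
    using partial_sum_antimono[OF trig_closure_L2[OF F] J Un_upper1] partial_sum_antimono[OF trig_closure_L2[OF K] J Un_upper2] J1(3) J2(3)
    by linarith
  finally show "\<exists>L\<in>trig_closure. sqnorm m (\<lambda>\<gamma>. F \<gamma> + K \<gamma> - L \<gamma>) < e" using trig_closure_trig[OF J] by (intro bexI)
qed

lemma trig_closure_scale: assumes F: "F \<in> trig_closure" shows "(\<lambda>\<gamma>. c * F \<gamma>) \<in> trig_closure"
  unfolding trig_closure_def
proof (intro CollectI conjI L2_scale[OF trig_closure_L2[OF F]] allI impI)
  fix e :: real assume e: "e > 0"
  \<comment> \<open>Adding 1 keeps the divisor positive when c = 0.\<close>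
  define C where "C = (cmod c)\<^sup>2 + 1"
  have C: "C > 0" unfolding C_def by (simp add: add_nonneg_pos)
  then have "e / C > 0" using e by simp
  then obtain J where J: "finite J" "J \<subseteq> H" "sqnorm m (\<lambda>\<gamma>. F \<gamma> - partial_sum F J \<gamma>) < e / C"
    using F unfolding trig_closure_def by blast
  have "sqnorm m (\<lambda>\<gamma>. c * F \<gamma> - partial_sum (\<lambda>\<gamma>. c * F \<gamma>) J \<gamma>) = sqnorm m (\<lambda>\<gamma>. c * (F \<gamma> - partial_sum F J \<gamma>))"
    by (simp add: partial_sum_def fourier_scale sum_distrib_left algebra_simps)
  also have "\<dots> = (cmod c)\<^sup>2 * sqnorm m (\<lambda>\<gamma>. F \<gamma> - partial_sum F J \<gamma>)" by (rule sqnorm_scale)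
  also have "\<dots> \<le> C * sqnorm m (\<lambda>\<gamma>. F \<gamma> - partial_sum F J \<gamma>)"
    by (rule mult_right_mono) (simp_all add: C_def)
  also have "\<dots> < e" using J(3) C by (simp add: field_simps)
  finally show "\<exists>J. finite J \<and> J \<subseteq> H \<and> sqnorm m (\<lambda>\<gamma>. c * F \<gamma> - partial_sum (\<lambda>\<gamma>. c * F \<gamma>) J \<gamma>) < e"
    using J by blast
qed

text \<open>Multiplication by a character shifts the frequencies by k and preserves absolute values,
  so approximations go over to approximations of equal quality.\<close>

lemma trig_closure_char_mult: assumes F: "F \<in> trig_closure" and k: "k \<in> H" shows "(\<lambda>\<gamma>. \<gamma> k * F \<gamma>) \<in> trig_closure"
proof (rule trig_closure_closed)
  show "(\<lambda>\<gamma>. \<gamma> k * F \<gamma>) \<in> L2 m" by (rule char_mult_L2[OF k trig_closure_L2[OF F]])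
  fix e :: real assume "e > 0"
  then obtain J where J: "finite J" "J \<subseteq> H" "sqnorm m (\<lambda>\<gamma>. F \<gamma> - partial_sum F J \<gamma>) < e"
    using F unfolding trig_closure_def by blast
  let ?p = "\<lambda>\<gamma>. \<Sum>h\<in>(\<lambda>h. k + h) ` J. fourier F (h - k) * \<gamma> h"
  have p: "?p \<gamma> = \<gamma> k * partial_sum F J \<gamma>" if "\<gamma> \<in> D" for \<gamma>
  proof -
    have "?p \<gamma> = (\<Sum>h\<in>J. fourier F h * \<gamma> (k + h))"
      by (subst sum.reindex) (auto simp: inj_on_def)
    also have "\<dots> = \<gamma> k * partial_sum F J \<gamma>"
      unfolding partial_sum_def sum_distrib_left using that J(2) k
      by (intro sum.cong refl) (auto simp: char_add subset_iff)
    finally show ?thesis .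
  qed
  have "sqnorm m (\<lambda>\<gamma>. \<gamma> k * F \<gamma> - ?p \<gamma>) = sqnorm m (\<lambda>\<gamma>. F \<gamma> - partial_sum F J \<gamma>)"
  proof (rule sqnorm_cmod_cong)
    fix \<gamma> assume "\<gamma> \<in> space m"
    then have g: "\<gamma> \<in> D" by (simp add: space_m)
    have "\<gamma> k * F \<gamma> - ?p \<gamma> = \<gamma> k * (F \<gamma> - partial_sum F J \<gamma>)" unfolding p[OF g] by (simp add: right_diff_distrib)
    then show "cmod (\<gamma> k * F \<gamma> - ?p \<gamma>) = cmod (F \<gamma> - partial_sum F J \<gamma>)"
      by (simp add: norm_mult char_norm[OF g k])
  qed
  moreover have "?p \<in> trig_closure" using J k by (intro trig_closure_trig) (auto simp: H_add)
  ultimately show "\<exists>K\<in>trig_closure. sqnorm m (\<lambda>\<gamma>. \<gamma> k * F \<gamma> - K \<gamma>) < e" using J by (intro bexI[of _ ?p]) simp_all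
qed

lemma trig_closure_cong:
  assumes F: "F \<in> trig_closure" and eq: "\<And>\<gamma>. \<gamma> \<in> D \<Longrightarrow> F \<gamma> = K \<gamma>"
  shows "K \<in> trig_closure"
proof (rule trig_closure_closed)
  have "K \<in> borel_measurable m"
    using L2_meas[OF trig_closure_L2[OF F]] eq measurable_cong[of m F K borel] by (simp add: space_m)
  moreover have "integrable m (\<lambda>x. (cmod (K x))\<^sup>2) \<longleftrightarrow> integrable m (\<lambda>x. (cmod (F x))\<^sup>2)"
    by (rule Bochner_Integration.integrable_cong) (simp_all add: space_m eq)
  ultimately show "K \<in> L2 m" using L2_int[OF trig_closure_L2[OF F]] by (simp add: L2_def)
  fix e :: real assume "e > 0"
  have "sqnorm m (\<lambda>\<gamma>. K \<gamma> - F \<gamma>) = sqnorm m (\<lambda>\<gamma>. 0)"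
    by (rule sqnorm_cmod_cong) (simp add: space_m eq)
  then show "\<exists>L\<in>trig_closure. sqnorm m (\<lambda>\<gamma>. K \<gamma> - L \<gamma>) < e" using F \<open>e > 0\<close> sqnorm_zero[of m] by (intro bexI[of _ F]) simp_all
qed

section \<open>Multipliers of the closed span of the characters\<close>

definition multipliers where
  "multipliers = {f \<in> borel_measurable m. (\<exists>C. \<forall>\<gamma>\<in>D. cmod (f \<gamma>) \<le> C) \<and> (\<forall>F\<in>trig_closure. (\<lambda>\<gamma>. f \<gamma> * F \<gamma>) \<in> trig_closure)}"

lemma multipliersI: "f \<in> borel_measurable m \<Longrightarrow> (\<And>\<gamma>. \<gamma> \<in> D \<Longrightarrow> cmod (f \<gamma>) \<le> C) \<Longrightarrow>
    (\<And>F. F \<in> trig_closure \<Longrightarrow> (\<lambda>\<gamma>. f \<gamma> * F \<gamma>) \<in> trig_closure) \<Longrightarrow> f \<in> multipliers"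
  unfolding multipliers_def by blast

lemma multipliersE: assumes "f \<in> multipliers"
  obtains C where "f \<in> borel_measurable m" "\<And>\<gamma>. \<gamma> \<in> D \<Longrightarrow> cmod (f \<gamma>) \<le> C"
    "\<And>F. F \<in> trig_closure \<Longrightarrow> (\<lambda>\<gamma>. f \<gamma> * F \<gamma>) \<in> trig_closure"
  using assms unfolding multipliers_def by blast

lemma multipliers_add: assumes "f \<in> multipliers" "g \<in> multipliers" shows "(\<lambda>\<gamma>. f \<gamma> + g \<gamma>) \<in> multipliers"
proof -
  obtain C where C: "f \<in> borel_measurable m" "\<And>\<gamma>. \<gamma> \<in> D \<Longrightarrow> cmod (f \<gamma>) \<le> C"
    "\<And>F. F \<in> trig_closure \<Longrightarrow> (\<lambda>\<gamma>. f \<gamma> * F \<gamma>) \<in> trig_closure" using assms(1) by (rule multipliersE) blast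
  obtain C' where C': "g \<in> borel_measurable m" "\<And>\<gamma>. \<gamma> \<in> D \<Longrightarrow> cmod (g \<gamma>) \<le> C'"
    "\<And>F. F \<in> trig_closure \<Longrightarrow> (\<lambda>\<gamma>. g \<gamma> * F \<gamma>) \<in> trig_closure" using assms(2) by (rule multipliersE) blast
  show ?thesis
  proof (rule multipliersI)
    show "(\<lambda>\<gamma>. f \<gamma> + g \<gamma>) \<in> borel_measurable m" using C(1) C'(1) by (rule borel_measurable_add)
    show "cmod (f \<gamma> + g \<gamma>) \<le> C + C'" if "\<gamma> \<in> D" for \<gamma>
      using C(2)[OF that] C'(2)[OF that] norm_triangle_ineq[of "f \<gamma>" "g \<gamma>"] by linarith
    show "(\<lambda>\<gamma>. (f \<gamma> + g \<gamma>) * F \<gamma>) \<in> trig_closure" if "F \<in> trig_closure" for F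
      using trig_closure_add[OF C(3)[OF that] C'(3)[OF that]] by (simp add: distrib_right)
  qed
qed

lemma multipliers_mult: assumes "f \<in> multipliers" "g \<in> multipliers" shows "(\<lambda>\<gamma>. f \<gamma> * g \<gamma>) \<in> multipliers"
proof -
  obtain C where C: "f \<in> borel_measurable m" "\<And>\<gamma>. \<gamma> \<in> D \<Longrightarrow> cmod (f \<gamma>) \<le> C"
    "\<And>F. F \<in> trig_closure \<Longrightarrow> (\<lambda>\<gamma>. f \<gamma> * F \<gamma>) \<in> trig_closure" using assms(1) by (rule multipliersE) blast
  obtain C' where C': "g \<in> borel_measurable m" "\<And>\<gamma>. \<gamma> \<in> D \<Longrightarrow> cmod (g \<gamma>) \<le> C'"
    "\<And>F. F \<in> trig_closure \<Longrightarrow> (\<lambda>\<gamma>. g \<gamma> * F \<gamma>) \<in> trig_closure" using assms(2) by (rule multipliersE) blast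
  show ?thesis
  proof (rule multipliersI)
    show "(\<lambda>\<gamma>. f \<gamma> * g \<gamma>) \<in> borel_measurable m" using C(1) C'(1) by (rule borel_measurable_times)
    show "cmod (f \<gamma> * g \<gamma>) \<le> C * C'" if "\<gamma> \<in> D" for \<gamma>
      unfolding norm_mult using C(2)[OF that] C'(2)[OF that]
      by (intro mult_mono) (auto intro: order.trans[OF norm_ge_zero])
    show "(\<lambda>\<gamma>. (f \<gamma> * g \<gamma>) * F \<gamma>) \<in> trig_closure" if "F \<in> trig_closure" for F
      using C(3)[OF C'(3)[OF that]] by (simp add: mult.assoc)
  qed
qed

lemma multipliers_const: "(\<lambda>_. c) \<in> multipliers"
  by (rule multipliersI[where C = "cmod c"]) (simp_all add: trig_closure_scale)

lemma multipliers_char: "h \<in> H \<Longrightarrow> (\<lambda>\<gamma>. \<gamma> h) \<in> multipliers"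
  by (rule multipliersI[where C = 1]) (simp_all add: trig_closure_char_mult char_norm)

lemma multipliers_cong:
  assumes f: "f \<in> multipliers" and eq: "\<And>\<gamma>. \<gamma> \<in> D \<Longrightarrow> f \<gamma> = g \<gamma>" shows "g \<in> multipliers"
proof -
  obtain C where C: "f \<in> borel_measurable m" "\<And>\<gamma>. \<gamma> \<in> D \<Longrightarrow> cmod (f \<gamma>) \<le> C"
    "\<And>F. F \<in> trig_closure \<Longrightarrow> (\<lambda>\<gamma>. f \<gamma> * F \<gamma>) \<in> trig_closure" using f by (rule multipliersE) blast
  show ?thesis
  proof (rule multipliersI)
    show "g \<in> borel_measurable m" using C(1) eq measurable_cong[of m f g borel] by (simp add: space_m)
    show "cmod (g \<gamma>) \<le> C" if "\<gamma> \<in> D" for \<gamma> using C(2)[OF that] eq[OF that] by simp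
    show "(\<lambda>\<gamma>. g \<gamma> * F \<gamma>) \<in> trig_closure" if "F \<in> trig_closure" for F
      using C(3)[OF that] by (rule trig_closure_cong) (simp add: eq)
  qed
qed

lemma sqnorm_dominated:
  assumes meas: "\<And>n. K n \<in> borel_measurable m" "F \<in> borel_measurable m"
    and w: "integrable m w" and bound: "\<And>n \<gamma>. \<gamma> \<in> D \<Longrightarrow> (cmod (F \<gamma> - K n \<gamma>))\<^sup>2 \<le> w \<gamma>"
    and lim: "\<And>\<gamma>. \<gamma> \<in> D \<Longrightarrow> (\<lambda>n. K n \<gamma>) \<longlonglongrightarrow> F \<gamma>"
  shows "(\<lambda>n. sqnorm m (\<lambda>\<gamma>. F \<gamma> - K n \<gamma>)) \<longlonglongrightarrow> 0"
proof -
  note [measurable] = meas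
  have "(\<lambda>n. \<integral>\<gamma>. (cmod (F \<gamma> - K n \<gamma>))\<^sup>2 \<partial>m) \<longlonglongrightarrow> (\<integral>\<gamma>. 0 \<partial>m)"
  proof (rule integral_dominated_convergence[OF _ _ w])
    show "AE \<gamma> in m. (\<lambda>n. (cmod (F \<gamma> - K n \<gamma>))\<^sup>2) \<longlonglongrightarrow> 0"
    proof (rule AE_D)
      fix \<gamma> assume "\<gamma> \<in> D"
      then have "(\<lambda>n. (cmod (F \<gamma> - K n \<gamma>))\<^sup>2) \<longlonglongrightarrow> (cmod (F \<gamma> - F \<gamma>))\<^sup>2"
        by (intro tendsto_intros lim)
      then show "(\<lambda>n. (cmod (F \<gamma> - K n \<gamma>))\<^sup>2) \<longlonglongrightarrow> 0" by simp
    qed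
    show "AE \<gamma> in m. norm ((cmod (F \<gamma> - K n \<gamma>))\<^sup>2) \<le> w \<gamma>" for n
      by (rule AE_D) (simp add: bound)
  qed measurable
  then show ?thesis by (simp add: sqnorm_def)
qed

lemma trig_closure_limit:
  assumes F: "F \<in> L2 m" and K: "\<And>n. K n \<in> trig_closure" and lim: "(\<lambda>n. sqnorm m (\<lambda>\<gamma>. F \<gamma> - K n \<gamma>)) \<longlonglongrightarrow> 0"
  shows "F \<in> trig_closure"
proof (rule trig_closure_closed[OF F])
  fix e :: real assume "e > 0"
  from eventually_happens'[OF sequentially_bot order_tendstoD(2)[OF lim this]]
  obtain n where "sqnorm m (\<lambda>\<gamma>. F \<gamma> - K n \<gamma>) < e" by blast
  then show "\<exists>K\<in>trig_closure. sqnorm m (\<lambda>\<gamma>. F \<gamma> - K \<gamma>) < e" using K by blast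
qed

text \<open>Dominated convergence, with the square of F times \<open>(2 * C)\<^sup>2\<close> as
  majorant.\<close>

lemma multipliers_limit:
  assumes f: "\<And>n. f n \<in> multipliers" and bound: "\<And>n \<gamma>. \<gamma> \<in> D \<Longrightarrow> cmod (f n \<gamma>) \<le> C"
    and lim: "\<And>\<gamma>. \<gamma> \<in> D \<Longrightarrow> (\<lambda>n. f n \<gamma>) \<longlonglongrightarrow> g \<gamma>"
  shows "g \<in> multipliers"
proof -
  have fm: "f n \<in> borel_measurable m" for n using f[of n] by (simp add: multipliers_def)
  have gm: "g \<in> borel_measurable m"
    by (rule borel_measurable_LIMSEQ_metric[where f = f, OF fm]) (simp add: space_m lim)
  have gC: "cmod (g \<gamma>) \<le> C" if "\<gamma> \<in> D" for \<gamma>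
    using LIMSEQ_le_const2[OF tendsto_norm[OF lim[OF that]]] bound[OF that] by blast
  show ?thesis
  proof (rule multipliersI[OF gm gC])
    fix F assume F: "F \<in> trig_closure"
    have Fm: "F \<in> borel_measurable m" using L2_meas[OF trig_closure_L2[OF F]] .
    show "(\<lambda>\<gamma>. g \<gamma> * F \<gamma>) \<in> trig_closure"
    proof (rule trig_closure_limit)
      show "(\<lambda>\<gamma>. g \<gamma> * F \<gamma>) \<in> L2 m"
        by (rule L2_mult_bounded(1)[OF trig_closure_L2[OF F] gm, of C]) (intro AE_D gC)
      show "(\<lambda>\<gamma>. f n \<gamma> * F \<gamma>) \<in> trig_closure" for n using f[of n] F by (simp add: multipliers_def)
      show "(\<lambda>n. sqnorm m (\<lambda>\<gamma>. g \<gamma> * F \<gamma> - f n \<gamma> * F \<gamma>)) \<longlonglongrightarrow> 0"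
      proof (rule sqnorm_dominated)
        show "integrable m (\<lambda>\<gamma>. (2 * C)\<^sup>2 * (cmod (F \<gamma>))\<^sup>2)"
          by (intro integrable_mult_right L2_int[OF trig_closure_L2[OF F]])
        fix n \<gamma> assume g: "\<gamma> \<in> D"
        have "cmod (g \<gamma> - f n \<gamma>) \<le> 2 * C"
          using gC[OF g] bound[OF g, of n] norm_triangle_ineq4[of "g \<gamma>" "f n \<gamma>"] by linarith
        then show "(cmod (g \<gamma> * F \<gamma> - f n \<gamma> * F \<gamma>))\<^sup>2 \<le> (2 * C)\<^sup>2 * (cmod (F \<gamma>))\<^sup>2"
          unfolding left_diff_distrib[symmetric] norm_mult power_mult_distrib[of "cmod (g \<gamma> - f n \<gamma>)"]
          by (intro mult_right_mono power_mono) auto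
      qed (intro borel_measurable_times fm gm Fm tendsto_mult_right lim | assumption)+
    qed
  qed
qed

text \<open>A real linear functional of a complex number z is a combination of z and
  \<open>cnj z\<close>, and the conjugate of \<gamma> h is \<gamma> (- h). Sums and products are
  covered because the multipliers form an algebra.\<close>

lemma multipliers_real_polynomial:
  assumes h: "h \<in> H" and p: "real_polynomial_function p"
  shows "(\<lambda>\<gamma>. of_real (p (\<gamma> h))) \<in> multipliers"
  using p
proof induction
  case (linear f)
  interpret f: bounded_linear f by fact
  let ?a = "(of_real (f 1) - \<i> * of_real (f \<i>)) / 2" and ?b = "(of_real (f 1) + \<i> * of_real (f \<i>)) / 2"
  have "(\<lambda>\<gamma>. ?a * \<gamma> h + ?b * \<gamma> (- h)) \<in> multipliers"
    by (intro multipliers_add multipliers_mult multipliers_const multipliers_char h H_uminus)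
  then show ?case
  proof (rule multipliers_cong)
    fix \<gamma> assume g: "\<gamma> \<in> D"
    have "\<gamma> h = Re (\<gamma> h) *\<^sub>R 1 + Im (\<gamma> h) *\<^sub>R \<i>" by (simp add: complex_eq_iff)
    then have "f (\<gamma> h) = Re (\<gamma> h) * f 1 + Im (\<gamma> h) * f \<i>" by (metis f.add f.scaleR real_scaleR_def)
    then show "?a * \<gamma> h + ?b * \<gamma> (- h) = of_real (f (\<gamma> h))"
      using char_uminus[OF g h] by (simp add: complex_eq_iff field_simps)
  qed
next
  case (add f g)
  then show ?case using multipliers_add by fastforce
next
  case (mult f g)
  then show ?case using multipliers_mult by fastforce
qed (rule multipliers_const)

text \<open>Characters take their values on the unit circle, a compact set, where g is a uniform
  limit of polynomials.\<close>

lemma multipliers_continuous: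
  fixes g :: "complex \<Rightarrow> real"
  assumes h: "h \<in> H" and g: "continuous_on UNIV g"
  shows "(\<lambda>\<gamma>. of_real (g (\<gamma> h))) \<in> multipliers"
proof -
  have gs: "continuous_on (sphere 0 1) g" using g continuous_on_subset by blast
  have "\<exists>p. real_polynomial_function p \<and> (\<forall>x\<in>sphere 0 1. \<bar>g x - p x\<bar> < 1 / real (Suc n))" for n
    using Stone_Weierstrass_real_polynomial_function[OF compact_sphere gs, of "1 / real (Suc n)"]
    by (metis zero_less_divide_1_iff of_nat_0_less_iff zero_less_Suc)
  then obtain p where p: "\<And>n. real_polynomial_function (p n)"
    "\<And>n x. x \<in> sphere 0 1 \<Longrightarrow> \<bar>g x - p n x\<bar> < 1 / real (Suc n)" by metis
  have "bounded (g ` sphere 0 1)"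
    by (intro compact_imp_bounded compact_continuous_image gs compact_sphere)
  then obtain C where "\<forall>y\<in>g ` sphere 0 1. norm y \<le> C"
    unfolding bounded_iff by blast
  then have C: "\<bar>g x\<bar> \<le> C" if "x \<in> sphere 0 1" for x using that by fastforce
  have gh: "\<gamma> h \<in> sphere 0 1" if "\<gamma> \<in> D" for \<gamma> using char_norm[OF that h] by simp
  show ?thesis
  proof (rule multipliers_limit[where f = "\<lambda>n \<gamma>. of_real (p n (\<gamma> h))" and C = "C + 1"])
    show "(\<lambda>\<gamma>. complex_of_real (p n (\<gamma> h))) \<in> multipliers" for n by (rule multipliers_real_polynomial[OF h p(1)])
    fix \<gamma> assume g: "\<gamma> \<in> D"
    have "1 / real (Suc n) \<le> 1" for n by simp
    then show "cmod (complex_of_real (p n (\<gamma> h))) \<le> C + 1" for n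
      using p(2)[OF gh[OF g], of n] C[OF gh[OF g]] unfolding norm_of_real by (smt (verit))
    have "(\<lambda>n. p n (\<gamma> h)) \<longlonglongrightarrow> g (\<gamma> h)"
    proof (rule Lim_transform_bound[of "\<lambda>n. p n (\<gamma> h) - g (\<gamma> h)" "\<lambda>n. 1 / real (Suc n)", THEN LIM_zero_cancel])
      show "eventually (\<lambda>n. norm (p n (\<gamma> h) - g (\<gamma> h)) \<le> norm (1 / real (Suc n))) sequentially"
        using p(2)[OF gh[OF g]] by (intro always_eventually allI) (simp add: abs_minus_commute less_imp_le)
      show "(\<lambda>n. 1 / real (Suc n)) \<longlonglongrightarrow> 0" using LIMSEQ_inverse_real_of_nat by (simp add: inverse_eq_divide)
    qed
    then show "(\<lambda>n. complex_of_real (p n (\<gamma> h))) \<longlonglongrightarrow> complex_of_real (g (\<gamma> h))"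
      by (rule tendsto_of_real)
  qed
qed

text \<open>The functions min 1 (n d), with d the distance to the complement of V, are continuous
  and increase to the indicator of V. The case V = UNIV is treated apart, since
  \<open>infdist\<close> to the empty set is 0.\<close>

lemma multipliers_cyl: assumes h: "h \<in> H" and V: "open V" shows "indicator (cyl h V) \<in> multipliers"
proof (cases "V = UNIV")
  case True
  show ?thesis by (rule multipliers_cong[OF multipliers_const[of 1]]) (simp add: True cyl_def)
next
  case False
  define g where "g n z = min 1 (real n * infdist z (- V))" for n z
  show ?thesis
  proof (rule multipliers_limit[where f = "\<lambda>n \<gamma>. of_real (g n (\<gamma> h))" and C = 1])
    show "(\<lambda>\<gamma>. complex_of_real (g n (\<gamma> h))) \<in> multipliers" for n
      unfolding g_def by (rule multipliers_continuous[OF h]) (intro continuous_intros)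
    show "cmod (complex_of_real (g n (\<gamma> h))) \<le> 1" for n \<gamma>
    proof -
      have "0 \<le> real n * infdist (\<gamma> h) (- V)" by (intro mult_nonneg_nonneg infdist_nonneg) simp
      then have "0 \<le> g n (\<gamma> h)" "g n (\<gamma> h) \<le> 1" by (simp_all add: g_def)
      then show ?thesis by (simp add: norm_of_real)
    qed
    fix \<gamma> assume gD: "\<gamma> \<in> D"
    show "(\<lambda>n. complex_of_real (g n (\<gamma> h))) \<longlonglongrightarrow> indicator (cyl h V) \<gamma>"
    proof (cases "\<gamma> h \<in> V")
      case True
      have "infdist (\<gamma> h) (- V) > 0"
        using True V False by (intro infdist_pos_not_in_closed) auto
      then obtain N where N: "1 < real N * infdist (\<gamma> h) (- V)" using reals_Archimedean3 by blast
      have "g n (\<gamma> h) = 1" if "n \<ge> N" for n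
      proof -
        have "real N * infdist (\<gamma> h) (- V) \<le> real n * infdist (\<gamma> h) (- V)"
          using that infdist_nonneg by (intro mult_right_mono) auto
        then show ?thesis using N by (simp add: g_def)
      qed
      then have "eventually (\<lambda>n. complex_of_real (g n (\<gamma> h)) = 1) sequentially"
        unfolding eventually_sequentially by auto
      then have "(\<lambda>n. complex_of_real (g n (\<gamma> h))) \<longlonglongrightarrow> 1" by (rule tendsto_eventually)
      then show ?thesis using True gD by (simp add: cyl_def)
    next
      case False
      then have "g n (\<gamma> h) = 0" for n by (simp add: g_def)
      then show ?thesis using False by (simp add: cyl_def)
    qed
  qed
qed

text \<open>Induction over the generated sigma-algebra: complements use 1 - f, and the indicator of
  a countable union is the bounded limit of 1 minus the finite products of the complementary
  indicators.\<close>

lemma multipliers_indicator: assumes "A \<in> sets m" shows "indicator A \<in> multipliers"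
proof -
  have "A \<in> sigma_sets D {cyl h V |h V. h \<in> H \<and> open V}" using assms sets_m by simp
  then show ?thesis
  proof induction
    case (Basic A)
    then show ?case using multipliers_cyl by auto
  next
    case Empty
    show ?case by (rule multipliers_cong[OF multipliers_const[of 0]]) simp
  next
    case (Compl A)
    have "(\<lambda>\<gamma>. 1 + - 1 * indicator A \<gamma>) \<in> multipliers" by (intro multipliers_add multipliers_const multipliers_mult Compl)
    then show ?case by (rule multipliers_cong) (simp add: indicator_def)
  next
    case (Union A)
    have P: "(\<lambda>\<gamma>. \<Prod>i<n. 1 + - 1 * indicator (A i) \<gamma>) \<in> multipliers" for n
    proof (induction n)
      case (Suc n)
      have "(\<lambda>\<gamma>. 1 + - 1 * indicator (A n) \<gamma>) \<in> multipliers" by (intro multipliers_add multipliers_const multipliers_mult Union)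
      from multipliers_mult[OF Suc this] show ?case by simp
    qed (simp add: multipliers_const)
    show ?case
    proof (rule multipliers_limit[where f = "\<lambda>n \<gamma>. 1 + - 1 * (\<Prod>i<n. 1 + - 1 * indicator (A i) \<gamma>)" and C = 2])
      show "(\<lambda>\<gamma>. 1 + - 1 * (\<Prod>i<n. 1 + - 1 * indicator (A i) \<gamma>)) \<in> multipliers" for n
        by (intro multipliers_add multipliers_const multipliers_mult P)
      fix \<gamma>
      have "(\<Prod>i<n. 1 + - 1 * indicator (A i) \<gamma>) \<in> {0, 1 :: complex}" for n
        by (induction n) (auto simp: indicator_def)
      then show "cmod (1 + - 1 * (\<Prod>i<n. 1 + - 1 * indicator (A i) \<gamma>)) \<le> 2" for n
        by (metis (no_types, lifting) add.right_neutral add_uminus_conv_diff insertE mult_minus_left mult_1 diff_self norm_one norm_zero one_le_numeral singletonD minus_zero zero_le_numeral)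
      show "(\<lambda>n. 1 + - 1 * (\<Prod>i<n. 1 + - 1 * indicator (A i) \<gamma>)) \<longlonglongrightarrow> (indicator (\<Union>(range A)) \<gamma> :: complex)"
      proof (cases "\<exists>i. \<gamma> \<in> A i")
        case True
        then obtain i where i: "\<gamma> \<in> A i" by blast
        have "(\<Prod>i<n. 1 + - 1 * indicator (A i) \<gamma>) = (0::complex)" if "n \<ge> Suc i" for n
          using that i by (intro prod_zero bexI[of _ i]) auto
        then have "eventually (\<lambda>n. 1 + - 1 * (\<Prod>i<n. 1 + - 1 * indicator (A i) \<gamma>) = (1::complex)) sequentially"
          unfolding eventually_sequentially by (intro exI[of _ "Suc i"]) simp
        then have "(\<lambda>n. 1 + - 1 * (\<Prod>i<n. 1 + - 1 * indicator (A i) \<gamma>)) \<longlonglongrightarrow> (1::complex)"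
          by (rule tendsto_eventually)
        moreover have "\<gamma> \<in> \<Union>(range A)" using i by blast
        ultimately show ?thesis by simp
      next
        case False
        then show ?thesis by simp
      qed
    qed
  qed
qed

lemma one_trig_closure: "(\<lambda>_. 1) \<in> trig_closure"
proof -
  have "(\<lambda>\<gamma>. \<Sum>h\<in>{0}. 1 * \<gamma> h) \<in> trig_closure" by (rule trig_closure_trig) auto
  then show ?thesis by (rule trig_closure_cong) (simp add: char_0)
qed

lemma trig_closure_indicator: "A \<in> sets m \<Longrightarrow> indicator A \<in> trig_closure"
  using multipliers_indicator[of A] one_trig_closure unfolding multipliers_def by force

lemma trig_closure_sum: "finite I \<Longrightarrow> (\<And>i. i \<in> I \<Longrightarrow> F i \<in> trig_closure) \<Longrightarrow> (\<lambda>\<gamma>. \<Sum>i\<in>I. F i \<gamma>) \<in> trig_closure"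
proof (induction I rule: finite_induct)
  case empty
  then show ?case using trig_closure_scale[OF one_trig_closure, of 0] by simp
qed (simp add: trig_closure_add)

text \<open>F is a dominated limit of simple functions, which are combinations of
  indicators.\<close>

lemma trig_closure_eq_L2: assumes F: "F \<in> L2 m" shows "F \<in> trig_closure"
proof -
  obtain S where S: "\<And>i. simple_function m (S i)" "\<And>x. x \<in> space m \<Longrightarrow> (\<lambda>i. S i x) \<longlonglongrightarrow> F x"
    "\<And>i x. x \<in> space m \<Longrightarrow> dist (S i x) 0 \<le> 2 * dist (F x) 0"
    using borel_measurable_implies_sequence_metric[OF L2_meas[OF F], of 0] by metis
  have SW: "S i \<in> trig_closure" for i
  proof -
    have fin: "finite (S i ` space m)" using S(1) by (simp add: simple_function_def)
    have "(\<lambda>\<gamma>. \<Sum>y\<in>S i ` space m. y * indicator (S i -` {y} \<inter> space m) \<gamma>) \<in> trig_closure"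
      using S(1)[of i] by (intro trig_closure_sum[OF fin] trig_closure_scale trig_closure_indicator) (auto simp: simple_function_def)
    then show ?thesis
    proof (rule trig_closure_cong)
      fix \<gamma> assume g: "\<gamma> \<in> D"
      have "S i \<gamma> = (\<Sum>y\<in>S i ` space m. indicator (S i -` {y} \<inter> space m) \<gamma> *\<^sub>R y)"
        by (rule simple_function_indicator_representation_banach[OF S(1)]) (simp add: space_m g)
      also have "\<dots> = (\<Sum>y\<in>S i ` space m. y * indicator (S i -` {y} \<inter> space m) \<gamma>)"
        by (intro sum.cong) (auto simp: indicator_def)
      finally show "(\<Sum>y\<in>S i ` space m. y * indicator (S i -` {y} \<inter> space m) \<gamma>) = S i \<gamma>" by (rule sym)
    qed
  qed
  show ?thesis
  proof (rule trig_closure_limit[OF F SW])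
    show "(\<lambda>n. sqnorm m (\<lambda>\<gamma>. F \<gamma> - S n \<gamma>)) \<longlonglongrightarrow> 0"
    proof (rule sqnorm_dominated)
      \<comment> \<open>The approximants are at most twice F in absolute value, so the difference is
        at most three times.\<close>
      show "integrable m (\<lambda>\<gamma>. 3\<^sup>2 * (cmod (F \<gamma>))\<^sup>2)" by (intro integrable_mult_right L2_int[OF F])
      fix n \<gamma> assume "\<gamma> \<in> D"
      then have "cmod (F \<gamma> - S n \<gamma>) \<le> 3 * cmod (F \<gamma>)"
        using S(3)[of \<gamma> n] norm_triangle_ineq4[of "F \<gamma>" "S n \<gamma>"] by (simp add: space_m)
      then show "(cmod (F \<gamma> - S n \<gamma>))\<^sup>2 \<le> 3\<^sup>2 * (cmod (F \<gamma>))\<^sup>2"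
        unfolding power_mult_distrib[symmetric] by (intro power_mono) auto
    qed (use S(2) L2_meas[OF F] L2_meas[OF trig_closure_L2[OF SW]] in \<open>simp_all add: space_m\<close>)
  qed
qed

text \<open>Errors do not grow when the frequency set is enlarged, so one good set J makes the whole
  net beyond it good.\<close>

lemma partial_sum_tendsto:
  assumes F: "F \<in> L2 m"
  shows "((\<lambda>J. sqnorm m (\<lambda>\<gamma>. F \<gamma> - partial_sum F J \<gamma>)) \<longlongrightarrow> 0) (finite_subsets_at_top H)"
proof (rule order_tendstoI)
  fix e :: real assume "e < 0"
  then show "eventually (\<lambda>J. e < sqnorm m (\<lambda>\<gamma>. F \<gamma> - partial_sum F J \<gamma>)) (finite_subsets_at_top H)"
    by (intro always_eventually allI) (rule less_le_trans[OF _ sqnorm_nonneg])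
next
  fix e :: real assume "0 < e"
  then obtain J where J: "finite J" "J \<subseteq> H" "sqnorm m (\<lambda>\<gamma>. F \<gamma> - partial_sum F J \<gamma>) < e"
    using trig_closure_eq_L2[OF F] unfolding trig_closure_def by blast
  then show "eventually (\<lambda>J. sqnorm m (\<lambda>\<gamma>. F \<gamma> - partial_sum F J \<gamma>) < e) (finite_subsets_at_top H)"
    unfolding eventually_finite_subsets_at_top
    by (intro exI[of _ J]) (use partial_sum_antimono[OF F] in \<open>blast intro: le_less_trans\<close>)
qed

theorem parseval:
  assumes F: "F \<in> L2 m"
  shows "((\<lambda>h. (cmod (fourier F h))\<^sup>2) has_sum sqnorm m F) H"
proof -
  have "((\<lambda>J. sqnorm m F - sqnorm m (\<lambda>\<gamma>. F \<gamma> - partial_sum F J \<gamma>)) \<longlongrightarrow> sqnorm m F - 0) (finite_subsets_at_top H)"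
    by (intro tendsto_intros partial_sum_tendsto[OF F])
  moreover have "eventually (\<lambda>J. sqnorm m F - sqnorm m (\<lambda>\<gamma>. F \<gamma> - partial_sum F J \<gamma>) = (\<Sum>h\<in>J. (cmod (fourier F h))\<^sup>2))
      (finite_subsets_at_top H)"
    by (rule eventually_finite_subsets_at_top_weakI) (simp add: sqnorm_partial_sum[OF F])
  ultimately show ?thesis unfolding has_sum_def by (simp add: tendsto_cong)
qed

lemma L2_has_sum_fourier: "F \<in> L2 m \<Longrightarrow> L2_has_sum m (\<lambda>h \<gamma>. fourier F h * \<gamma> h) F H"
  unfolding L2_has_sum_def using partial_sum_tendsto[of F]
  by (auto intro!: L2_scale char_L2 simp: sqnorm_def partial_sum_def)

text \<open>Once h belongs to J, the approximation error is at least the squared difference of the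
  two coefficients at h. This makes \<open>T_iso\<close> well defined and identifies the samples of
  a as Fourier coefficients of \<open>G j\<close>.\<close>

lemma L2_has_sum_unique:
  assumes S: "L2_has_sum m (\<lambda>h \<gamma>. \<alpha> h * \<gamma> h) F H" and h: "h \<in> H"
  shows "\<alpha> h = fourier F h"
proof -
  have F: "F \<in> L2 m" and lim: "((\<lambda>J. sqnorm m (\<lambda>\<gamma>. F \<gamma> - (\<Sum>h\<in>J. \<alpha> h * \<gamma> h))) \<longlongrightarrow> 0) (finite_subsets_at_top H)"
    using S by (auto simp: L2_has_sum_def sqnorm_def)
  have "eventually (\<lambda>J. (cmod (fourier F h - \<alpha> h))\<^sup>2 \<le> sqnorm m (\<lambda>\<gamma>. F \<gamma> - (\<Sum>h\<in>J. \<alpha> h * \<gamma> h))) (finite_subsets_at_top H)"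
    unfolding eventually_finite_subsets_at_top
  proof (intro exI[of _ "{h}"] conjI allI impI)
    fix J assume J: "finite J \<and> {h} \<subseteq> J \<and> J \<subseteq> H"
    have "(cmod (fourier F h - \<alpha> h))\<^sup>2 \<le> (\<Sum>h\<in>J. (cmod (fourier F h - \<alpha> h))\<^sup>2)"
      using J by (intro member_le_sum) auto
    then show "(cmod (fourier F h - \<alpha> h))\<^sup>2 \<le> sqnorm m (\<lambda>\<gamma>. F \<gamma> - (\<Sum>h\<in>J. \<alpha> h * \<gamma> h))"
      using J sqnorm_approx[OF F, of J \<alpha>] bessel[OF F, of J] by linarith
  qed (use h in auto)
  then have "(cmod (fourier F h - \<alpha> h))\<^sup>2 \<le> 0"
    by (rule tendsto_lowerbound[OF lim _ finite_subsets_at_top_neq_bot])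
  then show ?thesis by simp
qed

lemma has_sum_diff_complex:
  fixes x y :: complex
  assumes "(f has_sum x) A" "(g has_sum y) A"
  shows "((\<lambda>i. f i - g i) has_sum (x - y)) A"
  using has_sum_add[OF assms(1) has_sum_cmult_right[OF assms(2), of "- 1"]] by simp

theorem parseval_polarized:
  assumes F: "F \<in> L2 m" and K: "K \<in> L2 m"
  shows "((\<lambda>h. fourier F h * cnj (fourier K h)) has_sum (\<integral>\<gamma>. F \<gamma> * cnj (K \<gamma>) \<partial>m)) H"
proof -
  have iK: "(\<lambda>\<gamma>. \<i> * K \<gamma>) \<in> L2 m" by (rule L2_scale[OF K])
  let ?R = "\<lambda>h. complex_of_real ((cmod (fourier F h + fourier K h))\<^sup>2) - of_real ((cmod (fourier F h - fourier K h))\<^sup>2)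
     + \<i> * of_real ((cmod (fourier F h + \<i> * fourier K h))\<^sup>2) - \<i> * of_real ((cmod (fourier F h - \<i> * fourier K h))\<^sup>2)"
  let ?S = "of_real (sqnorm m (\<lambda>x. F x + K x)) - of_real (sqnorm m (\<lambda>x. F x - K x))
     + \<i> * of_real (sqnorm m (\<lambda>x. F x + \<i> * K x)) - \<i> * of_real (sqnorm m (\<lambda>x. F x - \<i> * K x))"
  have p: "((\<lambda>h. complex_of_real ((cmod (fourier L h))\<^sup>2)) has_sum complex_of_real (sqnorm m L)) H" if "L \<in> L2 m" for L
    using parseval[OF that] by (rule has_sum_of_real)
  have R: "?R h = of_real ((cmod (fourier (\<lambda>x. F x + K x) h))\<^sup>2) - of_real ((cmod (fourier (\<lambda>x. F x - K x) h))\<^sup>2)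
     + \<i> * of_real ((cmod (fourier (\<lambda>x. F x + \<i> * K x) h))\<^sup>2) - \<i> * of_real ((cmod (fourier (\<lambda>x. F x - \<i> * K x) h))\<^sup>2)"
    if "h \<in> H" for h
    using that by (simp only: fourier_add[OF F K] fourier_diff[OF F K] fourier_add[OF F iK] fourier_diff[OF F iK] fourier_scale)
  have "(?R has_sum ?S) H"
    by (subst has_sum_cong[OF R], assumption)
      (intro has_sum_add has_sum_diff_complex has_sum_cmult_right p L2_add(1) L2_diff(1) F K iK)
  then have "((\<lambda>h. (1 / 4) * (4 * (fourier F h * cnj (fourier K h)))) has_sum (1 / 4) * (4 * (\<integral>\<gamma>. F \<gamma> * cnj (K \<gamma>) \<partial>m))) H"
    unfolding polarization_complex polarization_integral[OF F K] by (rule has_sum_cmult_right)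
  then show ?thesis by simp
qed

end

section \<open>The annihilator of a sublattice and periodization\<close>

locale lattice_pair = dual_haar +
  fixes M :: "'a set" and r :: nat and \<mu> :: "nat \<Rightarrow> 'a \<Rightarrow> complex" and \<Omega> :: "('a \<Rightarrow> complex) set"
  assumes M_sub: "add_subgroup M" and MH: "M \<subseteq> H"
    and \<mu>_bij: "bij_betw \<mu> {..<r} (annihilator H M)" and \<mu>_0: "\<mu> 0 = dual_zero H"
    and section_\<Omega>: "borel_section H m (annihilator H M) \<Omega>"
begin

abbreviation N where "N \<equiv> annihilator H M"

lemma N_D: "\<nu> \<in> N \<Longrightarrow> \<nu> \<in> D" and N_M: "\<nu> \<in> N \<Longrightarrow> x \<in> M \<Longrightarrow> \<nu> x = 1"
  by (auto simp: annihilator_def)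

lemma \<mu>_N: "k < r \<Longrightarrow> \<mu> k \<in> N"
  using \<mu>_bij by (auto simp: bij_betw_def)

lemma \<mu>_D: "k < r \<Longrightarrow> \<mu> k \<in> D"
  using \<mu>_N N_D by blast

lemma translate_N: assumes "\<nu> \<in> N" "\<nu>' \<in> N" shows "\<nu> \<boxplus> \<nu>' \<in> N"
  unfolding annihilator_def
  using assms MH by (auto simp: N_D translate_closed translate_apply N_M subset_iff)

lemma neg_N: assumes "\<nu> \<in> N" shows "neg \<nu> \<in> N"
  unfolding annihilator_def
  using assms MH by (auto simp: N_D neg_closed N_M subset_iff) (auto simp: neg_def N_M)

lemma zero_N: "dual_zero H \<in> N"
  unfolding annihilator_def using MH zero_closed by (auto simp: dual_zero_def)

lemma r_pos: "0 < r"
proof -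
  have "dual_zero H \<in> \<mu> ` {..<r}" using zero_N \<mu>_bij by (simp add: bij_betw_def)
  then show ?thesis by (cases r) auto
qed

lemma translate_bij_N: assumes "\<nu> \<in> N" shows "bij_betw ((\<boxplus>) \<nu>) N N"
proof (rule bij_betw_byWitness[where f' = "(\<boxplus>) (neg \<nu>)"])
  show "\<forall>\<delta>\<in>N. neg \<nu> \<boxplus> (\<nu> \<boxplus> \<delta>) = \<delta>" using assms N_D neg_translate by blast
  show "\<forall>\<delta>\<in>N. \<nu> \<boxplus> (neg \<nu> \<boxplus> \<delta>) = \<delta>" using assms N_D translate_neg by blast
  show "(\<boxplus>) \<nu> ` N \<subseteq> N" using assms translate_N by blast
  show "(\<boxplus>) (neg \<nu>) ` N \<subseteq> N" using assms neg_N translate_N by blast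
qed

lemma sum_\<mu>: "(\<Sum>k<r. f (\<mu> k)) = (\<Sum>\<nu>\<in>N. f \<nu>)"
  by (rule sum.reindex_bij_betw[OF \<mu>_bij])

lemma sum_\<mu>_translate: assumes "\<nu> \<in> N" shows "(\<Sum>k<r. f (\<nu> \<boxplus> \<mu> k)) = (\<Sum>k<r. f (\<mu> k))"
  using sum_\<mu>[of "\<lambda>\<delta>. f (\<nu> \<boxplus> \<delta>)"] sum_\<mu>[of f] sum.reindex_bij_betw[OF translate_bij_N[OF assms], of f] by simp

text \<open>For h outside M some \<delta> in the annihilator has \<delta> h different from 1, and
  translating the sum by \<delta>, which only permutes it, multiplies it by \<delta> h.\<close>

lemma sum_\<mu>_char: assumes h: "h \<in> H" shows "(\<Sum>k<r. \<mu> k h) = (if h \<in> M then of_nat r else 0)"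
proof (cases "h \<in> M")
  case True
  then show ?thesis using N_M[OF \<mu>_N] by simp
next
  case False
  obtain \<delta> where d: "\<delta> \<in> D" "\<forall>x\<in>M. \<delta> x = 1" "\<delta> h \<noteq> 1"
    using exists_character_separating[OF sub disc M_sub MH h False] by blast
  then have "\<delta> \<in> N" by (simp add: annihilator_def)
  then have "(\<Sum>k<r. \<mu> k h) = (\<Sum>k<r. (\<delta> \<boxplus> \<mu> k) h)"
    using sum_\<mu>_translate[of \<delta> "\<lambda>\<nu>. \<nu> h"] by simp
  also have "\<dots> = \<delta> h * (\<Sum>k<r. \<mu> k h)"
    using h by (simp add: translate_apply sum_distrib_left)
  finally show ?thesis using d(3) False by simp
qed

definition periodize :: "(('a \<Rightarrow> complex) \<Rightarrow> complex) \<Rightarrow> ('a \<Rightarrow> complex) \<Rightarrow> complex" where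
  "periodize F \<xi> = (1 / of_nat r) * (\<Sum>k<r. F (\<xi> \<boxplus> \<mu> k))"

lemma translate_measurable_comp:
  assumes "\<nu> \<in> D" "F \<in> borel_measurable m"
  shows "(\<lambda>\<xi>. F (\<nu> \<boxplus> \<xi>)) \<in> borel_measurable m" "(\<lambda>\<xi>. F (\<xi> \<boxplus> \<nu>)) \<in> borel_measurable m"
  using measurable_compose[OF translate_measurable[OF assms(1)] assms(2)]
  by (simp_all add: translate_commute[of _ \<nu>])

lemma translate_L2: assumes "\<nu> \<in> D" "F \<in> L2 m"
  shows "(\<lambda>\<xi>. F (\<nu> \<boxplus> \<xi>)) \<in> L2 m" "(\<lambda>\<xi>. F (\<xi> \<boxplus> \<nu>)) \<in> L2 m"
proof -
  have "(\<lambda>\<xi>. (cmod (F \<xi>))\<^sup>2) \<in> borel_measurable m"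
    using L2_int[OF assms(2)] by simp
  from translate_integrable[OF assms(1) this]
  show "(\<lambda>\<xi>. F (\<nu> \<boxplus> \<xi>)) \<in> L2 m"
    using L2_int[OF assms(2)] translate_measurable_comp(1)[OF assms(1) L2_meas[OF assms(2)]] by (simp add: L2_def)
  then show "(\<lambda>\<xi>. F (\<xi> \<boxplus> \<nu>)) \<in> L2 m" by (simp add: translate_commute[of _ \<nu>])
qed

lemma periodize_L2: "F \<in> L2 m \<Longrightarrow> periodize F \<in> L2 m"
  unfolding periodize_def by (intro L2_scale L2_sum translate_L2(2)) (auto simp: \<mu>_D)

text \<open>Averaging over the annihilator multiplies the coefficient at h by the mean of the \<mu>
  k h, which is 1 on M and 0 elsewhere.\<close>

lemma fourier_periodize: assumes F: "F \<in> L2 m" and h: "h \<in> H" shows "fourier (periodize F) h = (if h \<in> M then fourier F h else 0)"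
proof -
  have "fourier (periodize F) h = 1 / of_nat r * (\<Sum>k<r. fourier (\<lambda>\<xi>. F (\<mu> k \<boxplus> \<xi>)) h)"
    unfolding periodize_def fourier_scale using h F
    by (subst fourier_sum) (auto simp: \<mu>_D translate_commute[of _ "\<mu> _"] intro!: translate_L2)
  also have "(\<Sum>k<r. fourier (\<lambda>\<xi>. F (\<mu> k \<boxplus> \<xi>)) h) = (\<Sum>k<r. \<mu> k h * fourier F h)"
    using L2_meas[OF F] h by (intro sum.cong refl fourier_translate) (auto simp: \<mu>_D)
  also have "\<dots> = (\<Sum>k<r. \<mu> k h) * fourier F h" by (rule sum_distrib_right[symmetric])
  finally show ?thesis using r_pos by (simp add: sum_\<mu>_char[OF h])
qed

lemma has_sum_periodize:
  assumes F: "F \<in> L2 m"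
  shows "((\<lambda>h. (cmod (fourier F h))\<^sup>2) has_sum sqnorm m (periodize F)) M"
proof -
  have "((\<lambda>h. (cmod (fourier (periodize F) h))\<^sup>2) has_sum sqnorm m (periodize F)) H" by (rule parseval[OF periodize_L2[OF F]])
  moreover have "((\<lambda>h. (cmod (fourier (periodize F) h))\<^sup>2) has_sum sqnorm m (periodize F)) H
      \<longleftrightarrow> ((\<lambda>h. (cmod (fourier F h))\<^sup>2) has_sum sqnorm m (periodize F)) M"
    by (rule has_sum_cong_neutral) (use MH in \<open>auto simp: fourier_periodize[OF F]\<close>)
  ultimately show ?thesis by blast
qed

lemma sqnorm_periodize_le: assumes F: "F \<in> L2 m" shows "sqnorm m (periodize F) \<le> sqnorm m F"
  by (rule has_sum_mono2[OF has_sum_periodize[OF F] parseval[OF F] MH]) simp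

lemma periodize_periodic: assumes "\<nu> \<in> N" "\<xi> \<in> D" shows "periodize F (\<nu> \<boxplus> \<xi>) = periodize F \<xi>"
proof -
  have "(\<Sum>k<r. F (\<nu> \<boxplus> \<xi> \<boxplus> \<mu> k)) = (\<Sum>k<r. F (\<xi> \<boxplus> (\<nu> \<boxplus> \<mu> k)))"
    by (simp add: translate_assoc[symmetric] translate_commute[of \<xi> \<nu>])
  then show ?thesis unfolding periodize_def using sum_\<mu>_translate[OF assms(1), of "\<lambda>\<nu>. F (\<xi> \<boxplus> \<nu>)"] by simp
qed

section \<open>Decomposition of the dual into translates of the section\<close>

definition piece where "piece k = (\<boxplus>) (\<mu> k) ` \<Omega>"

lemma \<Omega>_sets: "\<Omega> \<in> sets m"
  using section_\<Omega> by (simp add: borel_section_def)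

lemma \<Omega>_D: "\<Omega> \<subseteq> D"
  using sets_m_sub[OF \<Omega>_sets] .

lemma piece_sets: "k < r \<Longrightarrow> piece k \<in> sets m"
  unfolding piece_def by (rule translate_image_sets[OF \<mu>_D \<Omega>_sets])

lemma piece_cover: assumes "\<xi> \<in> D" obtains k where "k < r" "\<xi> \<in> piece k"
proof -
  have "\<xi> \<in> (\<Union>\<nu>\<in>N. (\<boxplus>) \<nu> ` \<Omega>)" using assms section_\<Omega> by (simp add: borel_section_def)
  then obtain \<nu> where "\<nu> \<in> N" "\<xi> \<in> (\<boxplus>) \<nu> ` \<Omega>" by blast
  moreover obtain k where "k < r" "\<nu> = \<mu> k" using \<open>\<nu> \<in> N\<close> \<mu>_bij by (auto simp: bij_betw_def)
  ultimately show ?thesis using that by (simp add: piece_def)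
qed

lemma \<mu>_eq_iff: "k < r \<Longrightarrow> l < r \<Longrightarrow> \<mu> k = \<mu> l \<longleftrightarrow> k = l"
  using \<mu>_bij by (auto simp: bij_betw_def inj_on_def)

lemma piece_unique: assumes "k < r" "l < r" "\<xi> \<in> piece k" "\<xi> \<in> piece l" shows "k = l"
proof (rule ccontr)
  assume "k \<noteq> l"
  then have "\<mu> k \<noteq> \<mu> l" using \<mu>_eq_iff assms by blast
  then have "piece k \<inter> piece l = {}"
    using section_\<Omega> \<mu>_N[OF assms(1)] \<mu>_N[OF assms(2)] unfolding borel_section_def disjoint_family_on_def piece_def
    by blast
  then show False using assms by blast
qed

lemma piece_iff: assumes "k < r" "\<xi> \<in> D" shows "\<mu> k \<boxplus> \<xi> \<in> piece k \<longleftrightarrow> \<xi> \<in> \<Omega>"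
proof
  assume "\<mu> k \<boxplus> \<xi> \<in> piece k"
  then obtain \<omega> where w: "\<omega> \<in> \<Omega>" "\<mu> k \<boxplus> \<xi> = \<mu> k \<boxplus> \<omega>" by (auto simp: piece_def)
  then have "\<xi> = \<omega>" using translate_cancel[OF \<mu>_D[OF assms(1)] assms(2), of \<omega>] \<Omega>_D by blast
  then show "\<xi> \<in> \<Omega>" using w by simp
qed (simp add: piece_def)

text \<open>The pieces partition the dual, and invariance of the measure moves each of them back to
  \<Omega>.\<close>

lemma integral_pieces:
  fixes f :: "_ \<Rightarrow> real"
  assumes f: "integrable m f"
  shows "(\<integral>\<xi>. f \<xi> \<partial>m) = (\<Sum>k<r. (\<integral>\<xi>. indicator \<Omega> \<xi> * f (\<mu> k \<boxplus> \<xi>) \<partial>m))"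
proof -
  have fm: "f \<in> borel_measurable m" using f by simp
  have "(\<integral>\<xi>. f \<xi> \<partial>m) = (\<integral>\<xi>. (\<Sum>k<r. indicator (piece k) \<xi> * f \<xi>) \<partial>m)"
  proof (rule integral_cong_D)
    fix \<xi> assume "\<xi> \<in> D"
    then obtain k where k: "k < r" "\<xi> \<in> piece k" by (rule piece_cover)
    have "(\<Sum>l<r. indicator (piece l) \<xi> * f \<xi>) = (\<Sum>l<r. if l = k then f \<xi> else 0)"
      using k piece_unique by (intro sum.cong) (auto simp: indicator_def)
    then show "f \<xi> = (\<Sum>l<r. indicator (piece l) \<xi> * f \<xi>)" using k by (simp add: sum.delta)
  qed
  also have "\<dots> = (\<Sum>k<r. (\<integral>\<xi>. indicator (piece k) \<xi> * f \<xi> \<partial>m))"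
  proof (rule Bochner_Integration.integral_sum)
    fix k assume "k \<in> {..<r}"
    then show "integrable m (\<lambda>\<xi>. indicator (piece k) \<xi> * f \<xi>)"
      using integrable_real_mult_indicator[OF piece_sets f, of k] by (simp add: mult.commute)
  qed
  also have "\<dots> = (\<Sum>k<r. (\<integral>\<xi>. indicator \<Omega> \<xi> * f (\<mu> k \<boxplus> \<xi>) \<partial>m))"
  proof (rule sum.cong[OF refl])
    fix k assume "k \<in> {..<r}"
    then have k: "k < r" by simp
    have "(\<integral>\<xi>. indicator (piece k) \<xi> * f \<xi> \<partial>m) = (\<integral>\<xi>. indicator (piece k) (\<mu> k \<boxplus> \<xi>) * f (\<mu> k \<boxplus> \<xi>) \<partial>m)"
      by (intro translate_integral[OF \<mu>_D[OF k], symmetric] borel_measurable_times borel_measurable_indicator fm piece_sets[OF k])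
    also have "\<dots> = (\<integral>\<xi>. indicator \<Omega> \<xi> * f (\<mu> k \<boxplus> \<xi>) \<partial>m)"
      by (rule integral_cong_D) (simp add: indicator_def piece_iff[OF k])
    finally show "(\<integral>\<xi>. indicator (piece k) \<xi> * f \<xi> \<partial>m) = (\<integral>\<xi>. indicator \<Omega> \<xi> * f (\<mu> k \<boxplus> \<xi>) \<partial>m)" .
  qed
  finally show ?thesis .
qed

text \<open>Carries almost everywhere statements from \<Omega> to the whole dual, since by
  \<open>\<Omega>_translate\<close> every point has a translate in \<Omega>.\<close>

lemma AE_\<Omega>_to_D:
  assumes "AE \<xi> in m. \<xi> \<in> \<Omega> \<longrightarrow> Q \<xi>"
  shows "AE \<xi> in m. \<forall>k<r. \<mu> k \<boxplus> \<xi> \<in> \<Omega> \<longrightarrow> Q (\<mu> k \<boxplus> \<xi>)"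
proof -
  have "AE \<xi> in m. \<mu> k \<boxplus> \<xi> \<in> \<Omega> \<longrightarrow> Q (\<mu> k \<boxplus> \<xi>)" if "k < r" for k
    using translate_AE[OF \<mu>_D[OF that] assms] .
  then have "AE \<xi> in m. \<forall>k\<in>{..<r}. \<mu> k \<boxplus> \<xi> \<in> \<Omega> \<longrightarrow> Q (\<mu> k \<boxplus> \<xi>)"
    by (intro AE_finite_allI) auto
  then show ?thesis unfolding Ball_def lessThan_iff .
qed

lemma \<Omega>_translate: assumes "\<xi> \<in> D" obtains k where "k < r" "\<mu> k \<boxplus> \<xi> \<in> \<Omega>"
proof -
  obtain l where l: "l < r" "\<xi> \<in> piece l" using assms by (rule piece_cover)
  then obtain \<omega> where w: "\<omega> \<in> \<Omega>" "\<xi> = \<mu> l \<boxplus> \<omega>" by (auto simp: piece_def)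
  have "neg (\<mu> l) \<in> N" using l \<mu>_N neg_N by blast
  then obtain k where k: "k < r" "neg (\<mu> l) = \<mu> k" using \<mu>_bij by (auto simp: bij_betw_def)
  have "\<mu> k \<boxplus> \<xi> = \<omega>" using w k(2)[symmetric] neg_translate[OF \<mu>_D[OF l(1)]] \<Omega>_D by auto
  then show ?thesis using that k w by simp
qed

end

lemma has_sum_finite_Times:
  fixes x :: "nat \<Rightarrow> 'b::{topological_comm_monoid_add, t2_space}"
  assumes "\<And>j. j < s \<Longrightarrow> (f j has_sum x j) M"
  shows "((\<lambda>(j, k). f j k) has_sum (\<Sum>j<s. x j)) ({..<s} \<times> M)"
  using assms
proof (induction s)
  case (Suc s)
  have "((\<lambda>(j, k). f j k) has_sum x s) (Pair s ` M)"
    using Suc.prems[of s] by (subst has_sum_reindex) (auto simp: inj_on_def o_def)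
  moreover have "((\<lambda>(j, k). f j k) has_sum (\<Sum>j<s. x j)) ({..<s} \<times> M)"
    using Suc by simp
  ultimately have "((\<lambda>(j, k). f j k) has_sum (\<Sum>j<s. x j) + x s) (({..<s} \<times> M) \<union> (Pair s ` M))"
    by (intro has_sum_Un_disjoint) auto
  moreover have "({..<s} \<times> M) \<union> (Pair s ` M) = {..<Suc s} \<times> M" by auto
  ultimately show ?case by simp
qed simp

section \<open>The synthesis isomorphism\<close>

locale sampling = lattice_pair +
  fixes U :: "'a \<Rightarrow> 'h::complex_hilbert_space \<Rightarrow> 'h" and a :: 'h and A B :: real
  assumes rep: "unitary_representation U" and A_pos: "0 < A"
    and riesz_lower: "\<And>J \<alpha>. finite J \<Longrightarrow> J \<subseteq> H \<Longrightarrow>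
      A * (\<Sum>h\<in>J. (cmod (\<alpha> h))\<^sup>2) \<le> (norm (\<Sum>h\<in>J. scaleC (\<alpha> h) (U h a)))\<^sup>2"
    and riesz_upper: "\<And>J \<alpha>. finite J \<Longrightarrow> J \<subseteq> H \<Longrightarrow>
      (norm (\<Sum>h\<in>J. scaleC (\<alpha> h) (U h a)))\<^sup>2 \<le> B * (\<Sum>h\<in>J. (cmod (\<alpha> h))\<^sup>2)"
begin

abbreviation V where "V \<equiv> closed_orbit_span U H a"

lemma U_linear: "Vector_Spaces.linear scaleC scaleC (U g)" and U_surj: "surj (U g)"
  and U_cinner: "cinner (U g x) (U g y) = cinner x y" and U_add: "U (g + k) x = U g (U k x)"
  using rep by (auto simp: unitary_representation_def fun_eq_iff)

lemma U_plus: "U g (x + y) = U g x + U g y" and U_scaleC: "U g (scaleC c x) = scaleC c (U g x)"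
  using U_linear[of g] by (auto simp: Vector_Spaces.linear_iff)

lemma U_norm: "norm (U g x) = norm x"
proof -
  have "complex_of_real ((norm (U g x))\<^sup>2) = of_real ((norm x)\<^sup>2)"
    using U_cinner[of g x x] by (simp only: cinner_self)
  then have "(norm (U g x))\<^sup>2 = (norm x)\<^sup>2" using of_real_eq_iff by blast
  then show ?thesis by (simp add: power2_eq_iff_nonneg)
qed

lemma U_zero: "U 0 x = x"
proof -
  obtain y where "x = U 0 y" using U_surj by (metis surjD)
  then show ?thesis using U_add[of 0 0 y] by simp
qed

lemma U_bounded_linear: "bounded_linear (U g)"
  by (rule bounded_linear_intro[where K = 1]) (simp_all add: U_plus U_scaleC scaleR_scaleC U_norm)

lemma cinner_U: "cinner (U h x) (U k y) = cinner x (U (k - h) y)"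
proof -
  have "U k y = U h (U (k - h) y)" by (simp add: U_add[symmetric])
  then show ?thesis by (simp add: U_cinner)
qed

text \<open>An explicit form of \<open>T_iso\<close>, with the Fourier coefficients in place of a
  family characterized by convergence; \<open>T_iso_eq\<close> shows that the two agree on
  L2.\<close>

definition T :: "(('a \<Rightarrow> complex) \<Rightarrow> complex) \<Rightarrow> 'h" where
  "T F = (\<Sum>\<^sub>\<infinity>h\<in>H. scaleC (fourier F h) (U h a))"

lemma T_has_sum: "F \<in> L2 m \<Longrightarrow> ((\<lambda>h. scaleC (fourier F h) (U h a)) has_sum T F) H"
  unfolding T_def
  using riesz_sequence_synthesis(1)[where f = "\<lambda>h. U h a", OF riesz_lower riesz_upper parseval]
  by (rule has_sum_infsum)

lemma T_lower: "F \<in> L2 m \<Longrightarrow> A * sqnorm m F \<le> (norm (T F))\<^sup>2"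
  unfolding T_def
  using riesz_sequence_synthesis(2)[where f = "\<lambda>h. U h a", OF riesz_lower riesz_upper parseval] .

lemma T_upper: "F \<in> L2 m \<Longrightarrow> (norm (T F))\<^sup>2 \<le> B * sqnorm m F"
  unfolding T_def
  using riesz_sequence_synthesis(3)[where f = "\<lambda>h. U h a", OF riesz_lower riesz_upper parseval] .

lemma T_cong: "(\<And>h. h \<in> H \<Longrightarrow> fourier F h = fourier K h) \<Longrightarrow> T F = T K"
  unfolding T_def by (rule infsum_cong) simp

lemma T_cong_AE:
  "F \<in> L2 m \<Longrightarrow> K \<in> L2 m \<Longrightarrow> AE \<xi> in m. F \<xi> = K \<xi> \<Longrightarrow> T F = T K"
  by (intro T_cong fourier_cong_AE L2_meas)

lemma T_add: assumes "F \<in> L2 m" "K \<in> L2 m" shows "T (\<lambda>\<xi>. F \<xi> + K \<xi>) = T F + T K"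
proof (rule has_sum_unique[OF T_has_sum[OF L2_add(1)[OF assms]]])
  have "((\<lambda>h. scaleC (fourier F h) (U h a) + scaleC (fourier K h) (U h a)) has_sum T F + T K) H"
    using assms by (intro has_sum_add T_has_sum)
  then show "((\<lambda>h. scaleC (fourier (\<lambda>\<xi>. F \<xi> + K \<xi>) h) (U h a)) has_sum T F + T K) H"
    using assms by (subst has_sum_cong) (auto simp: fourier_add scaleC_add_left)
qed

lemma T_scale: assumes "F \<in> L2 m" shows "T (\<lambda>\<xi>. c * F \<xi>) = scaleC c (T F)"
proof (rule has_sum_unique[OF T_has_sum[OF L2_scale[OF assms]]])
  show "((\<lambda>h. scaleC (fourier (\<lambda>\<xi>. c * F \<xi>) h) (U h a)) has_sum scaleC c (T F)) H"
    using has_sum_bounded_linear[OF bounded_linear_scaleC T_has_sum[OF assms], of c]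
    by (simp add: fourier_scale scaleC_scaleC)
qed

lemma T_diff: assumes "F \<in> L2 m" "K \<in> L2 m" shows "T (\<lambda>\<xi>. F \<xi> - K \<xi>) = T F - T K"
proof -
  have "T (\<lambda>\<xi>. (F \<xi> - K \<xi>) + K \<xi>) = T (\<lambda>\<xi>. F \<xi> - K \<xi>) + T K"
    using assms by (intro T_add L2_diff(1))
  then show ?thesis by simp
qed

lemma T_zero: "T (\<lambda>_. 0) = 0"
  by (simp add: T_def fourier_def)

lemma T_sum: "finite I \<Longrightarrow> (\<And>i. i \<in> I \<Longrightarrow> F i \<in> L2 m) \<Longrightarrow> T (\<lambda>\<xi>. \<Sum>i\<in>I. F i \<xi>) = (\<Sum>i\<in>I. T (F i))"
proof (induction I rule: finite_induct)
  case (insert i I)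
  then show ?case using T_add[OF _ L2_sum, of "F i" I F] by simp
qed (simp add: T_zero)

lemma T_inj: assumes "F \<in> L2 m" "K \<in> L2 m" "T F = T K" shows "AE \<xi> in m. F \<xi> = K \<xi>"
proof -
  have "A * sqnorm m (\<lambda>\<xi>. F \<xi> - K \<xi>) \<le> 0"
    using T_lower[OF L2_diff(1)[OF assms(1,2)]] T_diff[OF assms(1,2)] assms(3) by simp
  then have "sqnorm m (\<lambda>\<xi>. F \<xi> - K \<xi>) = 0"
    using A_pos sqnorm_nonneg[of m "\<lambda>\<xi>. F \<xi> - K \<xi>"] by (simp add: mult_le_0_iff)
  then show ?thesis using sqnorm_eq_0_iff[OF L2_diff(1)[OF assms(1,2)]] by simp
qed

lemma T_iso_eq: assumes F: "F \<in> L2 m" shows "T_iso m U H a F = T F"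
  unfolding T_iso_def
proof (rule the_equality)
  show "\<exists>\<alpha>. L2_has_sum m (\<lambda>h \<gamma>. \<alpha> h * \<gamma> h) F H \<and> ((\<lambda>h. scaleC (\<alpha> h) (U h a)) has_sum T F) H"
    using L2_has_sum_fourier[OF F] T_has_sum[OF F] by blast
next
  fix x assume "\<exists>\<alpha>. L2_has_sum m (\<lambda>h \<gamma>. \<alpha> h * \<gamma> h) F H \<and> ((\<lambda>h. scaleC (\<alpha> h) (U h a)) has_sum x) H"
  then obtain \<alpha> where \<alpha>: "L2_has_sum m (\<lambda>h \<gamma>. \<alpha> h * \<gamma> h) F H" "((\<lambda>h. scaleC (\<alpha> h) (U h a)) has_sum x) H"
    by blast
  have "((\<lambda>h. scaleC (fourier F h) (U h a)) has_sum x) H"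
    using \<alpha>(2) by (subst has_sum_cong[symmetric]) (auto simp: L2_has_sum_unique[OF \<alpha>(1)])
  then show "x = T F" using has_sum_unique T_has_sum[OF F] by blast
qed

text \<open>Multiplication by the character at k shifts the Fourier coefficients by k, and U k
  shifts the orbit of a in the same way; the two sums differ by a reindexing of H.\<close>

lemma T_shift: assumes F: "F \<in> L2 m" and k: "k \<in> H" shows "T (\<lambda>\<gamma>. \<gamma> k * F \<gamma>) = U k (T F)"
proof (rule has_sum_unique[OF T_has_sum[OF char_mult_L2[OF k F]]])
  have "((\<lambda>h. scaleC (fourier F h) (U (k + h) a)) has_sum U k (T F)) H"
    using has_sum_bounded_linear[OF U_bounded_linear T_has_sum[OF F], of k]
    by (simp add: U_scaleC U_add)
  moreover have "((\<lambda>h. scaleC (fourier F h) (U (k + h) a)) has_sum U k (T F)) H \<longleftrightarrow>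
      ((\<lambda>h. scaleC (fourier (\<lambda>\<gamma>. \<gamma> k * F \<gamma>) h) (U h a)) has_sum U k (T F)) H"
    using k by (intro has_sum_reindex_bij_witness[where i = "\<lambda>h. h - k" and j = "\<lambda>h. k + h"])
      (auto simp: H_add H_diff fourier_char_mult)
  ultimately show "((\<lambda>h. scaleC (fourier (\<lambda>\<gamma>. \<gamma> k * F \<gamma>) h) (U h a)) has_sum U k (T F)) H"
    by blast
qed

lemma T_trig: assumes J: "finite J" "J \<subseteq> H"
  shows "T (\<lambda>\<gamma>. \<Sum>h\<in>J. c h * \<gamma> h) = (\<Sum>h\<in>J. scaleC (c h) (U h a))"
proof (rule has_sum_unique[OF T_has_sum[OF trig_L2[OF J(2)]]])
  have "((\<lambda>h. scaleC (c h) (U h a)) has_sum (\<Sum>h\<in>J. scaleC (c h) (U h a))) J"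
    by (rule has_sum_finite[OF J(1)])
  then show "((\<lambda>h. scaleC (fourier (\<lambda>\<gamma>. \<Sum>h\<in>J. c h * \<gamma> h) h) (U h a)) has_sum (\<Sum>h\<in>J. scaleC (c h) (U h a))) H"
    by (subst has_sum_cong_neutral[where T = J and g = "\<lambda>h. scaleC (c h) (U h a)"])
      (use J in \<open>auto simp: fourier_trig subset_iff\<close>)
qed

lemma T_char: "k \<in> H \<Longrightarrow> T (\<lambda>\<gamma>. \<gamma> k) = U k a"
  using T_trig[of "{k}" "\<lambda>_. 1"] by (simp add: scaleC_one)

lemma T_V: assumes F: "F \<in> L2 m" shows "T F \<in> V"
  unfolding closed_orbit_span_def
proof (rule Lim_in_closed_set[OF closed_closure _ finite_subsets_at_top_neq_bot])
  show "((\<lambda>J. \<Sum>h\<in>J. scaleC (fourier F h) (U h a)) \<longlongrightarrow> T F) (finite_subsets_at_top H)"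
    using T_has_sum[OF F] by (simp add: has_sum_def)
  show "eventually (\<lambda>J. (\<Sum>h\<in>J. scaleC (fourier F h) (U h a)) \<in> closure (complex_vector.span ((\<lambda>h. U h a) ` H)))
      (finite_subsets_at_top H)"
    by (intro eventually_finite_subsets_at_top_weakI subsetD[OF closure_subset] complex_vector.span_sum
        complex_vector.span_scale complex_vector.span_base) auto
qed

text \<open>Elements of the span have explicit preimages. The lower Riesz bound makes the preimages
  of a convergent sequence Cauchy, completeness of L2 supplies a limit, and the upper bound shows
  that this limit is mapped to x.\<close>

lemma V_T: assumes x: "x \<in> V" obtains F where "F \<in> L2 m" "x = T F"
proof -
  have span: "\<exists>F\<in>L2 m. y = T F" if "y \<in> complex_vector.span ((\<lambda>h. U h a) ` H)" for y
    using that
  proof (induction rule: complex_vector.span_induct_alt)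
    case base
    show ?case using T_zero L2_zero by (intro bexI[of _ "\<lambda>_. 0"]) auto
  next
    case (step c x y)
    then obtain h F where h: "h \<in> H" "x = U h a" and F: "F \<in> L2 m" "y = T F" by blast
    have "T (\<lambda>\<gamma>. c * \<gamma> h + F \<gamma>) = scaleC c x + y"
      using h F by (simp add: T_add L2_scale char_L2 T_scale T_char)
    moreover have "(\<lambda>\<gamma>. c * \<gamma> h + F \<gamma>) \<in> L2 m" using h F by (intro L2_add L2_scale char_L2)
    ultimately show ?case by (intro bexI) auto
  qed
  obtain X where X: "\<And>n. X n \<in> complex_vector.span ((\<lambda>h. U h a) ` H)" "X \<longlonglongrightarrow> x"
    using x unfolding closed_orbit_span_def closure_sequential by blast
  then have "\<forall>n. \<exists>F\<in>L2 m. X n = T F" using span by blast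
  then obtain F where F: "\<And>n. F n \<in> L2 m" "\<And>n. X n = T (F n)" by metis
  have le: "sqnorm m (\<lambda>\<xi>. F i \<xi> - F j \<xi>) \<le> (norm (X i - X j))\<^sup>2 / A" for i j
    using T_lower[OF L2_diff(1)[OF F(1) F(1), of i j]] A_pos
    by (simp add: T_diff[OF F(1) F(1)] F(2) field_simps)
  have "\<exists>N. \<forall>i\<ge>N. \<forall>j\<ge>N. sqnorm m (\<lambda>\<xi>. F i \<xi> - F j \<xi>) < e" if "e > 0" for e
  proof -
    have "sqrt (A * e) > 0" using A_pos that by simp
    then obtain N where N: "\<And>i j. i \<ge> N \<Longrightarrow> j \<ge> N \<Longrightarrow> norm (X i - X j) < sqrt (A * e)"
      using LIMSEQ_imp_Cauchy[OF X(2)] unfolding Cauchy_iff by metis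
    have "sqnorm m (\<lambda>\<xi>. F i \<xi> - F j \<xi>) < e" if "i \<ge> N" "j \<ge> N" for i j
    proof -
      have "(norm (X i - X j))\<^sup>2 < (sqrt (A * e))\<^sup>2"
        using N[OF that] by (intro power_strict_mono) auto
      then have "(norm (X i - X j))\<^sup>2 < A * e" using A_pos \<open>e > 0\<close> by simp
      then have "(norm (X i - X j))\<^sup>2 / A < e" using A_pos by (simp add: field_simps)
      then show ?thesis using le[of i j] by linarith
    qed
    then show ?thesis by blast
  qed
  from L2_complete[OF F(1) this] obtain K where K: "K \<in> L2 m"
    "(\<lambda>n. sqnorm m (\<lambda>\<xi>. K \<xi> - F n \<xi>)) \<longlonglongrightarrow> 0" by blast
  have "(\<lambda>n. (norm (T K - X n))\<^sup>2) \<longlonglongrightarrow> 0"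
  proof (rule tendsto_sandwich[OF _ _ tendsto_const])
    show "eventually (\<lambda>n. (norm (T K - X n))\<^sup>2 \<le> B * sqnorm m (\<lambda>\<xi>. K \<xi> - F n \<xi>)) sequentially"
      using T_upper[OF L2_diff(1)[OF K(1) F(1)]] by (simp add: T_diff[OF K(1) F(1)] F(2))
    show "(\<lambda>n. B * sqnorm m (\<lambda>\<xi>. K \<xi> - F n \<xi>)) \<longlonglongrightarrow> 0" using tendsto_mult_right_zero[OF K(2)] .
  qed simp
  moreover have "(\<lambda>n. (norm (T K - X n))\<^sup>2) \<longlonglongrightarrow> (norm (T K - x))\<^sup>2"
    using X(2) by (intro tendsto_intros)
  ultimately have "(norm (T K - x))\<^sup>2 = 0" using LIMSEQ_unique by blast
  then show ?thesis using that K by simp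
qed

text \<open>The inner product with \<open>U h b\<close> is taken termwise. Its value on
  \<open>U k a\<close> is \<open>fourier G (h - k)\<close>, the conjugate of a Fourier coefficient
  of the character at h times the conjugate of G, so the polarized Parseval identity sums the
  series.\<close>

lemma U_system_T:
  assumes F: "F \<in> L2 m" and G: "G \<in> L2 m" "G \<in> Linf m" and GU: "\<And>h. h \<in> H \<Longrightarrow> fourier G h = U_system U b a h"
    and h: "h \<in> H"
  shows "U_system U b (T F) h = fourier (\<lambda>\<xi>. F \<xi> * G \<xi>) h"
proof -
  have K: "(\<lambda>\<gamma>. \<gamma> h * cnj (G \<gamma>)) \<in> L2 m" by (rule char_mult_L2[OF h L2_cnj[OF G(1)]])
  have "((\<lambda>k. fourier F k * cinner (U k a) (U h b)) has_sum U_system U b (T F) h) H"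
    using has_sum_bounded_linear[OF bounded_linear_cinner_left T_has_sum[OF F]]
    by (simp add: cinner_scaleC_left U_system_def)
  moreover have "fourier F k * cinner (U k a) (U h b) = fourier F k * cnj (fourier (\<lambda>\<gamma>. \<gamma> h * cnj (G \<gamma>)) k)" if k: "k \<in> H" for k
  proof -
    have "cnj (fourier (\<lambda>\<gamma>. \<gamma> h * cnj (G \<gamma>)) k) = (\<integral>\<gamma>. cnj (\<gamma> h * cnj (G \<gamma>) * cnj (\<gamma> k)) \<partial>m)"
      unfolding fourier_def by (rule Bochner_Integration.integral_cnj[symmetric])
    also have "\<dots> = fourier G (h - k)"
      unfolding fourier_def using h k by (intro integral_cong_D) (simp add: char_diff mult_ac)
    also have "\<dots> = cinner (U k a) (U h b)"
      using GU[OF H_diff[OF h k]] by (simp add: U_system_def cinner_U)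
    finally show ?thesis by simp
  qed
  ultimately have "((\<lambda>k. fourier F k * cnj (fourier (\<lambda>\<gamma>. \<gamma> h * cnj (G \<gamma>)) k)) has_sum U_system U b (T F) h) H"
    by (simp cong: has_sum_cong)
  then have "U_system U b (T F) h = (\<integral>\<gamma>. F \<gamma> * cnj (\<gamma> h * cnj (G \<gamma>)) \<partial>m)"
    using has_sum_unique parseval_polarized[OF F K] by blast
  then show ?thesis by (simp add: fourier_def mult_ac)
qed

text \<open>Since \<open>U k (T C)\<close> is the image of the character at k times C, a finite sum
  is the image of C times a partial sum of K. Boundedness of C reduces the error to that of the
  Fourier series of K, whose frequencies lie in M.\<close>

lemma has_sum_translates:
  assumes C: "C \<in> Linf m" and K: "K \<in> L2 m" "\<And>h. h \<in> H \<Longrightarrow> h \<notin> M \<Longrightarrow> fourier K h = 0"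
  shows "((\<lambda>k. scaleC (fourier K k) (U k (T C))) has_sum T (\<lambda>\<xi>. C \<xi> * K \<xi>)) M"
proof -
  obtain c where c: "AE \<xi> in m. cmod (C \<xi>) \<le> c" and Cm: "C \<in> borel_measurable m" using C by (auto simp: Linf_def)
  have C2: "C \<in> L2 m" by (rule L2_of_Linf[OF C])
  have CK: "(\<lambda>\<xi>. C \<xi> * F \<xi>) \<in> L2 m" if "F \<in> L2 m" for F by (rule L2_mult_Linf[OF that C])
  have PM: "((\<lambda>h. (cmod (fourier K h))\<^sup>2) has_sum sqnorm m K) M"
  proof -
    have "((\<lambda>h. (cmod (fourier K h))\<^sup>2) has_sum sqnorm m K) H \<longleftrightarrow> ((\<lambda>h. (cmod (fourier K h))\<^sup>2) has_sum sqnorm m K) M"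
      by (rule has_sum_cong_neutral) (use MH K(2) in auto)
    then show ?thesis using parseval[OF K(1)] by blast
  qed
  have fin: "(norm ((\<Sum>k\<in>J. scaleC (fourier K k) (U k (T C))) - T (\<lambda>\<xi>. C \<xi> * K \<xi>)))\<^sup>2
      \<le> \<bar>B\<bar> * (c\<^sup>2 * (sqnorm m K - (\<Sum>h\<in>J. (cmod (fourier K h))\<^sup>2)))" if J: "finite J" "J \<subseteq> M" for J
  proof -
    have JH: "J \<subseteq> H" using J MH by blast
    have p: "partial_sum K J \<in> L2 m" by (rule partial_sum_L2[OF JH])
    have "T (\<lambda>\<xi>. C \<xi> * partial_sum K J \<xi>) = T (\<lambda>\<xi>. \<Sum>k\<in>J. fourier K k * (\<xi> k * C \<xi>))"
      by (simp add: partial_sum_def sum_distrib_left mult_ac)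
    also have "\<dots> = (\<Sum>k\<in>J. T (\<lambda>\<xi>. fourier K k * (\<xi> k * C \<xi>)))"
      using J JH C2 by (intro T_sum L2_scale char_mult_L2) auto
    also have "\<dots> = (\<Sum>k\<in>J. scaleC (fourier K k) (U k (T C)))"
    proof (rule sum.cong[OF refl])
      fix k assume "k \<in> J"
      then have k: "k \<in> H" using JH by blast
      show "T (\<lambda>\<xi>. fourier K k * (\<xi> k * C \<xi>)) = scaleC (fourier K k) (U k (T C))"
        using T_scale[OF char_mult_L2[OF k C2]] T_shift[OF C2 k] by simp
    qed
    finally have "T (\<lambda>\<xi>. C \<xi> * K \<xi>) - (\<Sum>k\<in>J. scaleC (fourier K k) (U k (T C)))
        = T (\<lambda>\<xi>. C \<xi> * K \<xi> - C \<xi> * partial_sum K J \<xi>)"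
      using T_diff[OF CK[OF K(1)] CK[OF p]] by simp
    also have "\<dots> = T (\<lambda>\<xi>. C \<xi> * (K \<xi> - partial_sum K J \<xi>))" by (simp add: right_diff_distrib)
    finally have "norm ((\<Sum>k\<in>J. scaleC (fourier K k) (U k (T C))) - T (\<lambda>\<xi>. C \<xi> * K \<xi>))
        = norm (T (\<lambda>\<xi>. C \<xi> * (K \<xi> - partial_sum K J \<xi>)))"
      by (subst norm_minus_commute) (rule arg_cong)
    then have "(norm ((\<Sum>k\<in>J. scaleC (fourier K k) (U k (T C))) - T (\<lambda>\<xi>. C \<xi> * K \<xi>)))\<^sup>2
        \<le> B * sqnorm m (\<lambda>\<xi>. C \<xi> * (K \<xi> - partial_sum K J \<xi>))"
      using T_upper[OF CK[OF L2_diff(1)[OF K(1) p]]] by simp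
    \<comment> \<open>The upper Riesz constant carries no sign condition; its absolute value allows
      the next factor to be enlarged.\<close>
    also have "\<dots> \<le> \<bar>B\<bar> * sqnorm m (\<lambda>\<xi>. C \<xi> * (K \<xi> - partial_sum K J \<xi>))"
      by (intro mult_right_mono) auto
    also have "\<dots> \<le> \<bar>B\<bar> * (c\<^sup>2 * sqnorm m (\<lambda>\<xi>. K \<xi> - partial_sum K J \<xi>))"
      by (intro mult_left_mono L2_mult_bounded(2)[OF L2_diff(1)[OF K(1) p] Cm c]) simp
    finally show ?thesis using sqnorm_partial_sum[OF K(1) J(1) JH] by simp
  qed
  have "((\<lambda>J. \<bar>B\<bar> * (c\<^sup>2 * (sqnorm m K - (\<Sum>h\<in>J. (cmod (fourier K h))\<^sup>2)))) \<longlongrightarrow> \<bar>B\<bar> * (c\<^sup>2 * (sqnorm m K - sqnorm m K)))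
      (finite_subsets_at_top M)"
    using PM unfolding has_sum_def by (intro tendsto_intros)
  then have "((\<lambda>J. \<bar>B\<bar> * (c\<^sup>2 * (sqnorm m K - (\<Sum>h\<in>J. (cmod (fourier K h))\<^sup>2)))) \<longlongrightarrow> 0) (finite_subsets_at_top M)"
    by simp
  then have "((\<lambda>J. (norm ((\<Sum>k\<in>J. scaleC (fourier K k) (U k (T C))) - T (\<lambda>\<xi>. C \<xi> * K \<xi>)))\<^sup>2) \<longlongrightarrow> 0)
      (finite_subsets_at_top M)"
    by (rule tendsto_sandwich[OF _ _ tendsto_const, rotated -1])
      (auto intro: eventually_finite_subsets_at_top_weakI fin)
  then have "((\<lambda>J. sqrt ((norm ((\<Sum>k\<in>J. scaleC (fourier K k) (U k (T C))) - T (\<lambda>\<xi>. C \<xi> * K \<xi>)))\<^sup>2)) \<longlongrightarrow> sqrt 0)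
      (finite_subsets_at_top M)"
    by (rule tendsto_real_sqrt)
  then have "((\<lambda>J. norm ((\<Sum>k\<in>J. scaleC (fourier K k) (U k (T C))) - T (\<lambda>\<xi>. C \<xi> * K \<xi>))) \<longlongrightarrow> 0)
      (finite_subsets_at_top M)"
    by simp
  then show ?thesis unfolding has_sum_def by (simp add: tendsto_norm_zero_iff LIM_zero_iff)
qed

end

section \<open>Gram matrices\<close>

text \<open>The squared norm of A v, which is the Hermitian form of \<open>gram_mat A\<close> at v.
  Vectors are plain functions, read at the indices below \<open>dim_col A\<close>.\<close>

definition qform :: "complex mat \<Rightarrow> (nat \<Rightarrow> complex) \<Rightarrow> real" where
  "qform A v = (\<Sum>j<dim_row A. (cmod (\<Sum>k<dim_col A. A $$ (j, k) * v k))\<^sup>2)"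

lemma gram_carrier: "A \<in> carrier_mat s r \<Longrightarrow> gram_mat A \<in> carrier_mat r r"
  unfolding gram_mat_def mat_adjoint_def by auto

lemma gram_entry:
  assumes A: "A \<in> carrier_mat s r" and "i < r" "k < r"
  shows "gram_mat A $$ (i, k) = (\<Sum>j<s. cnj (A $$ (j, i)) * A $$ (j, k))"
  using assms unfolding gram_mat_def mat_adjoint_def
  by (simp add: scalar_prod_def conjugate_complex_def atLeast0LessThan)

lemma gram_eigen_qform:
  assumes A: "A \<in> carrier_mat s r" and e: "eigenvalue (gram_mat A) e"
  obtains v where "\<exists>i<r. v i \<noteq> 0" "e * of_real (\<Sum>i<r. (cmod (v i))\<^sup>2) = of_real (qform A v)"
proof -
  note Gc = gram_carrier[OF A]
  obtain w where w: "w \<in> carrier_vec r" "w \<noteq> 0\<^sub>v r" "gram_mat A *\<^sub>v w = e \<cdot>\<^sub>v w"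
    using e Gc unfolding eigenvalue_def eigenvector_def by auto
  define v where "v = vec_index w"
  have nz: "\<exists>i<r. v i \<noteq> 0"
  proof (rule ccontr)
    assume "\<not> ?thesis"
    then have "w = 0\<^sub>v r" using w(1) by (intro eq_vecI) (auto simp: v_def)
    then show False using w(2) by simp
  qed
  have row: "(\<Sum>k<r. gram_mat A $$ (i, k) * v k) = e * v i" if "i < r" for i
  proof -
    have "vec_index (gram_mat A *\<^sub>v w) i = (\<Sum>k<r. gram_mat A $$ (i, k) * v k)"
      using that Gc w(1) by (simp add: scalar_prod_def v_def atLeast0LessThan)
    then show ?thesis using that w by (simp add: v_def)
  qed
  have "of_real (qform A v) = (\<Sum>j<s. (\<Sum>i<r. A $$ (j, i) * v i) * cnj (\<Sum>i<r. A $$ (j, i) * v i))"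
    using A unfolding qform_def of_real_sum complex_norm_square by simp
  also have "\<dots> = (\<Sum>j<s. \<Sum>i<r. \<Sum>k<r. cnj (v i) * (cnj (A $$ (j, i)) * A $$ (j, k)) * v k)"
    by (intro sum.cong refl) (simp add: sum_distrib_left sum_distrib_right mult_ac)
  also have "\<dots> = (\<Sum>i<r. \<Sum>k<r. \<Sum>j<s. cnj (v i) * (cnj (A $$ (j, i)) * A $$ (j, k)) * v k)"
    by (subst sum.swap) (intro sum.cong refl sum.swap)
  also have "\<dots> = (\<Sum>i<r. cnj (v i) * (\<Sum>k<r. gram_mat A $$ (i, k) * v k))"
    by (intro sum.cong refl) (simp add: gram_entry[OF A] sum_distrib_left sum_distrib_right mult_ac)
  also have "\<dots> = (\<Sum>i<r. e * of_real ((cmod (v i))\<^sup>2))"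
  proof (intro sum.cong refl)
    fix i assume "i \<in> {..<r}"
    then have "(\<Sum>k<r. gram_mat A $$ (i, k) * v k) = e * v i" using row by simp
    then show "cnj (v i) * (\<Sum>k<r. gram_mat A $$ (i, k) * v k) = e * of_real ((cmod (v i))\<^sup>2)"
      unfolding complex_norm_square by (simp add: mult_ac)
  qed
  finally have "e * of_real (\<Sum>i<r. (cmod (v i))\<^sup>2) = of_real (qform A v)"
    by (simp add: sum_distrib_left)
  then show ?thesis using that nz by blast
qed

lemma sum_cmod_sq_pos: "\<exists>i<r. v i \<noteq> 0 \<Longrightarrow> 0 < (\<Sum>i<r::nat. (cmod (v i))\<^sup>2)"
  by (auto intro!: sum_pos2)

lemma qform_nonneg: "0 \<le> qform A v"
  unfolding qform_def by (rule sum_nonneg) simp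

text \<open>The eigenvalue is the Rayleigh quotient at its eigenvector, and \<open>qform\<close> is
  nonnegative.\<close>

lemma gram_eigenvalue_real:
  assumes A: "A \<in> carrier_mat s r" and e: "eigenvalue (gram_mat A) e"
  obtains v t where "e = of_real t" "0 \<le> t" "\<exists>i<r. v i \<noteq> 0" "t * (\<Sum>i<r. (cmod (v i))\<^sup>2) = qform A v"
proof -
  obtain v where v: "\<exists>i<r. v i \<noteq> 0" "e * of_real (\<Sum>i<r. (cmod (v i))\<^sup>2) = of_real (qform A v)"
    using gram_eigen_qform[OF A e] .
  define S where "S = (\<Sum>i<r. (cmod (v i))\<^sup>2)"
  have S: "0 < S" unfolding S_def by (rule sum_cmod_sq_pos[OF v(1)])
  have "e = of_real (qform A v / S)" using v(2) S unfolding S_def[symmetric] by (simp add: field_simps)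
  moreover have "0 \<le> qform A v / S" using S qform_nonneg by simp
  moreover have "qform A v / S * S = qform A v" using S by simp
  ultimately show ?thesis using that v(1) unfolding S_def by blast
qed

section \<open>Eigenvalues with multiplicity, determinant and trace\<close>

lemma sum_diag_mult_commute:
  fixes X Y :: "complex mat"
  assumes "X \<in> carrier_mat n n" "Y \<in> carrier_mat n n"
  shows "(\<Sum>i<n. (X * Y) $$ (i, i)) = (\<Sum>i<n. (Y * X) $$ (i, i))"
proof -
  have "(\<Sum>i<n. (X * Y) $$ (i, i)) = (\<Sum>i<n. \<Sum>k<n. X $$ (i, k) * Y $$ (k, i))"
    using assms by (intro sum.cong refl) (simp add: scalar_prod_def atLeast0LessThan)
  also have "\<dots> = (\<Sum>k<n. \<Sum>i<n. Y $$ (k, i) * X $$ (i, k))"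
    by (subst sum.swap) (simp add: mult.commute)
  also have "\<dots> = (\<Sum>i<n. (Y * X) $$ (i, i))"
    using assms by (intro sum.cong refl) (simp add: scalar_prod_def atLeast0LessThan)
  finally show ?thesis .
qed

text \<open>Schur triangularization: the diagonal of a similar triangular matrix lists the
  eigenvalues with multiplicity, and determinant, trace and characteristic polynomial are similarity
  invariants.\<close>

lemma complex_mat_eigenvalue_list:
  fixes X :: "complex mat"
  assumes X: "X \<in> carrier_mat n n"
  obtains es where "length es = n" "\<And>e. eigenvalue X e \<longleftrightarrow> e \<in> set es"
    "Determinant.det X = prod_list es" "(\<Sum>i<n. X $$ (i, i)) = sum_list es"
    "\<And>x. Determinant.det (x \<cdot>\<^sub>m 1\<^sub>m n - X) = (\<Prod>e\<leftarrow>es. x - e)"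
proof -
  obtain as where "char_poly X = (\<Prod>a\<leftarrow>as. [:- a, 1:])" using char_poly_factorized[OF X] by blast
  then obtain Y where Y: "Y \<in> carrier_mat n n" "upper_triangular Y" "similar_mat X Y"
    using schur_decomposition_exists[OF X] by blast
  define es where "es = diag_mat Y"
  have len: "length es = n" using Y by (simp add: es_def diag_mat_def)
  have cp: "char_poly X = (\<Prod>a\<leftarrow>es. [:- a, 1:])"
    using char_poly_similar[OF Y(3)] char_poly_upper_triangular[OF Y(1,2)] by (simp add: es_def)
  have poly: "poly (char_poly X) x = (\<Prod>e\<leftarrow>es. x - e)" for x
    unfolding cp by (induction es) (simp_all add: algebra_simps)
  have ev: "eigenvalue X e \<longleftrightarrow> e \<in> set es" for e
    unfolding eigenvalue_root_char_poly[OF X] poly by (induction es) auto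
  have det: "Determinant.det X = prod_list es"
    using det_similar[OF Y(3)] det_upper_triangular[OF Y(2,1)] by (simp add: es_def)
  obtain P Q where "similar_mat_wit X Y P Q" using Y(3) by (auto simp: similar_mat_def)
  then have PQ: "P \<in> carrier_mat n n" "Q \<in> carrier_mat n n" "Q * P = 1\<^sub>m n" "X = P * Y * Q"
    using X by (auto simp: similar_mat_wit_def Let_def)
  have "(\<Sum>i<n. X $$ (i, i)) = (\<Sum>i<n. (Q * (P * Y)) $$ (i, i))"
    unfolding PQ(4) using PQ Y by (intro sum_diag_mult_commute) auto
  also have "Q * (P * Y) = Y" using assoc_mult_mat[OF PQ(2,1) Y(1)] PQ(3) Y(1) by simp
  also have "(\<Sum>i<n. Y $$ (i, i)) = sum_list es"
    using Y(1) by (simp add: es_def diag_mat_def sum_list_sum_nth atLeast0LessThan interv_sum_list_conv_sum_set_nat)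
  finally have tr: "(\<Sum>i<n. X $$ (i, i)) = sum_list es" .
  have "Determinant.det (x \<cdot>\<^sub>m 1\<^sub>m n - X) = (\<Prod>e\<leftarrow>es. x - e)" for x
  proof -
    have "- char_matrix X x = x \<cdot>\<^sub>m 1\<^sub>m n - X"
      using X by (intro eq_matI) (auto simp: char_matrix_def)
    then show ?thesis using char_poly_matrix[OF X, of x] poly by simp
  qed
  then show ?thesis using that len ev det tr by blast
qed

lemma gram_eigenvalue_list:
  assumes A: "A \<in> carrier_mat s r"
  obtains ts :: "real list" where "length ts = r" "\<And>t. t \<in> set ts \<Longrightarrow> 0 \<le> t"
    "{t. eigenvalue (gram_mat A) (of_real t)} = set ts"
    "Determinant.det (gram_mat A) = of_real (prod_list ts)"
    "(\<Sum>k<r. gram_mat A $$ (k, k)) = of_real (sum_list ts)"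
    "\<And>x. Determinant.det (of_real x \<cdot>\<^sub>m 1\<^sub>m r - gram_mat A) = of_real (\<Prod>t\<leftarrow>ts. x - t)"
proof -
  obtain es where es: "length es = r" "\<And>e. eigenvalue (gram_mat A) e \<longleftrightarrow> e \<in> set es"
    "Determinant.det (gram_mat A) = prod_list es" "(\<Sum>k<r. gram_mat A $$ (k, k)) = sum_list es"
    "\<And>x. Determinant.det (x \<cdot>\<^sub>m 1\<^sub>m r - gram_mat A) = (\<Prod>e\<leftarrow>es. x - e)"
    using complex_mat_eigenvalue_list[OF gram_carrier[OF A]] by blast
  define ts where "ts = map Re es"
  have real: "\<exists>t\<ge>0. e = of_real t" if "e \<in> set es" for e
    using gram_eigenvalue_real[OF A, of e] es(2) that by metis
  have es_ts: "es = map of_real ts"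
    unfolding ts_def map_map o_def using real by (intro map_idI[symmetric]) force
  have pl: "prod_list (map complex_of_real ts) = of_real (prod_list ts)" by (induction ts) simp_all
  have sl: "sum_list (map complex_of_real ts) = of_real (sum_list ts)" by (induction ts) simp_all
  have ml: "(\<Prod>e\<leftarrow>map complex_of_real ts. of_real x - e) = of_real (\<Prod>t\<leftarrow>ts. x - t)" for x
    by (induction ts) simp_all
  show ?thesis
  proof (rule that[of ts])
    show "length ts = r" by (simp add: ts_def es(1))
    show "0 \<le> t" if "t \<in> set ts" for t using that real unfolding ts_def by force
    show "{t. eigenvalue (gram_mat A) (of_real t)} = set ts"
      unfolding es(2) unfolding es_ts by auto
    show "Determinant.det (gram_mat A) = of_real (prod_list ts)"
      unfolding es(3) unfolding es_ts by (rule pl)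
    show "(\<Sum>k<r. gram_mat A $$ (k, k)) = of_real (sum_list ts)"
      unfolding es(4) unfolding es_ts by (rule sl)
    show "Determinant.det (of_real x \<cdot>\<^sub>m 1\<^sub>m r - gram_mat A) = of_real (\<Prod>t\<leftarrow>ts. x - t)" for x
      unfolding es(5) unfolding es_ts by (rule ml)
  qed
qed

lemma lambda_eq:
  assumes "{t. eigenvalue X (complex_of_real t)} = set ts"
  shows "lambda_min X = Min (set ts)" "lambda_max X = Max (set ts)"
  using assms by (simp_all add: lambda_min_def lambda_max_def)

text \<open>Every eigenvalue is a Rayleigh quotient, so a lower bound for the form bounds the
  spectrum from below. Positivity of r makes the set of eigenvalues nonempty, as \<open>Min\<close>
  requires.\<close>

lemma lambda_min_ge:
  assumes A: "A \<in> carrier_mat s r" and "0 < r"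
    and Q: "\<And>v. c * (\<Sum>i<r. (cmod (v i))\<^sup>2) \<le> qform A v"
  shows "c \<le> lambda_min (gram_mat A)"
proof -
  obtain ts where ts: "length ts = r" "{t. eigenvalue (gram_mat A) (complex_of_real t)} = set ts"
    using gram_eigenvalue_list[OF A] by metis
  have "c \<le> t" if "t \<in> set ts" for t
  proof -
    have "eigenvalue (gram_mat A) (of_real t)" using that ts(2) by blast
    then obtain v where v: "\<exists>i<r. v i \<noteq> 0" "t * (\<Sum>i<r. (cmod (v i))\<^sup>2) = qform A v"
      using gram_eigenvalue_real[OF A] of_real_eq_iff by metis
    then have "c * (\<Sum>i<r. (cmod (v i))\<^sup>2) \<le> t * (\<Sum>i<r. (cmod (v i))\<^sup>2)" using Q[of v] by simp
    then show ?thesis using sum_cmod_sq_pos[OF v(1)] by simp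
  qed
  moreover have "ts \<noteq> []" using ts(1) \<open>0 < r\<close> by auto
  ultimately show ?thesis by (simp add: lambda_eq(1)[OF ts(2)])
qed

lemma prod_list_ge_power:
  fixes c :: real
  assumes "0 \<le> c" "\<And>t. t \<in> set ts \<Longrightarrow> c \<le> f t"
  shows "c ^ length ts \<le> (\<Prod>t\<leftarrow>ts. f t)"
  using assms(2)
proof (induction ts)
  case (Cons t ts)
  then have "c * c ^ length ts \<le> f t * (\<Prod>t\<leftarrow>ts. f t)"
    using assms(1) by (intro mult_mono) (auto intro: order.trans)
  then show ?case by simp
qed simp

lemma det_gram_ge:
  assumes A: "A \<in> carrier_mat s r" and "0 < r" and c: "0 \<le> c" "c \<le> lambda_min (gram_mat A)"
  shows "c ^ r \<le> Re (Determinant.det (gram_mat A))"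
proof -
  obtain ts where ts: "length ts = r" "{t. eigenvalue (gram_mat A) (complex_of_real t)} = set ts"
    "Determinant.det (gram_mat A) = of_real (prod_list ts)"
    using gram_eigenvalue_list[OF A] by metis
  have "c \<le> t" if "t \<in> set ts" for t
    using order.trans[OF c(2)[unfolded lambda_eq(1)[OF ts(2)]] Min_le[OF finite_set that]] .
  then have "c ^ length ts \<le> (\<Prod>t\<leftarrow>ts. t)" by (intro prod_list_ge_power c(1))
  then show ?thesis using ts by simp
qed

text \<open>Cauchy-Schwarz in each of the s rows, with r entries of size at most C, bounds the
  Rayleigh quotients.\<close>

lemma lambda_max_le:
  assumes A: "A \<in> carrier_mat s r" and "0 < r"
    and C: "\<And>j k. j < s \<Longrightarrow> k < r \<Longrightarrow> cmod (A $$ (j, k)) \<le> C"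
  shows "lambda_max (gram_mat A) \<le> real s * (real r * C\<^sup>2)"
proof -
  obtain ts where ts: "length ts = r" "{t. eigenvalue (gram_mat A) (complex_of_real t)} = set ts"
    using gram_eigenvalue_list[OF A] by metis
  have "t \<le> real s * (real r * C\<^sup>2)" if "t \<in> set ts" for t
  proof -
    have "eigenvalue (gram_mat A) (of_real t)" using that ts(2) by blast
    then obtain v where v: "\<exists>i<r. v i \<noteq> 0" "t * (\<Sum>i<r. (cmod (v i))\<^sup>2) = qform A v"
      using gram_eigenvalue_real[OF A] of_real_eq_iff by metis
    have "qform A v = (\<Sum>j<s. (cmod (\<Sum>k<r. A $$ (j, k) * v k))\<^sup>2)"
      unfolding qform_def using A by simp
    also have "\<dots> \<le> (\<Sum>j<s. real r * C\<^sup>2 * (\<Sum>k<r. (cmod (v k))\<^sup>2))"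
    proof (rule sum_mono)
      fix j assume "j \<in> {..<s}"
      then have j: "j < s" by simp
      have "(cmod (\<Sum>k<r. A $$ (j, k) * v k))\<^sup>2 \<le> (\<Sum>k<r. cmod (A $$ (j, k)) * cmod (v k))\<^sup>2"
        by (intro power_mono) (auto intro!: order.trans[OF norm_sum] simp: norm_mult)
      also have "\<dots> \<le> (\<Sum>k<r. (cmod (A $$ (j, k)))\<^sup>2) * (\<Sum>k<r. (cmod (v k))\<^sup>2)"
        by (rule Cauchy_Schwarz_ineq_sum)
      also have "\<dots> \<le> (\<Sum>k<r. C\<^sup>2) * (\<Sum>k<r. (cmod (v k))\<^sup>2)"
        using C[OF j] by (intro mult_right_mono sum_mono power_mono sum_nonneg) auto
      finally show "(cmod (\<Sum>k<r. A $$ (j, k) * v k))\<^sup>2 \<le> real r * C\<^sup>2 * (\<Sum>k<r. (cmod (v k))\<^sup>2)"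
        by simp
    qed
    also have "\<dots> = real s * (real r * C\<^sup>2) * (\<Sum>k<r. (cmod (v k))\<^sup>2)" by simp
    finally show ?thesis using v(2) sum_cmod_sq_pos[OF v(1)] by (metis mult_le_cancel_right_pos)
  qed
  moreover have "ts \<noteq> []" using ts(1) \<open>0 < r\<close> by auto
  ultimately show ?thesis by (simp add: lambda_eq(2)[OF ts(2)])
qed

text \<open>The trace of the Gram matrix is the sum of all squared entries and also the sum of r
  eigenvalues, each at most \<open>lambda_max\<close>.\<close>

lemma entry_le_lambda_max:
  assumes A: "A \<in> carrier_mat s r" and jk: "j < s" "k < r"
  shows "(cmod (A $$ (j, k)))\<^sup>2 \<le> real r * lambda_max (gram_mat A)"
proof -
  obtain ts where ts: "length ts = r" "{t. eigenvalue (gram_mat A) (complex_of_real t)} = set ts"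
    "(\<Sum>k<r. gram_mat A $$ (k, k)) = of_real (sum_list ts)"
    using gram_eigenvalue_list[OF A] by metis
  have "complex_of_real (\<Sum>k<r. \<Sum>j<s. (cmod (A $$ (j, k)))\<^sup>2) = (\<Sum>k<r. gram_mat A $$ (k, k))"
    unfolding of_real_sum complex_norm_square
    by (intro sum.cong refl) (simp add: gram_entry[OF A] mult.commute)
  then have eq: "(\<Sum>k<r. \<Sum>j<s. (cmod (A $$ (j, k)))\<^sup>2) = sum_list ts"
    unfolding ts(3) using of_real_eq_iff by blast
  have "(cmod (A $$ (j, k)))\<^sup>2 \<le> (\<Sum>j<s. (cmod (A $$ (j, k)))\<^sup>2)"
    using jk by (intro member_le_sum) auto
  also have "\<dots> \<le> (\<Sum>k<r. \<Sum>j<s. (cmod (A $$ (j, k)))\<^sup>2)"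
    using jk by (intro member_le_sum[of k "{..<r}" "\<lambda>k. \<Sum>j<s. (cmod (A $$ (j, k)))\<^sup>2"]) (auto intro: sum_nonneg)
  also have "\<dots> = (\<Sum>t\<leftarrow>ts. t)" using eq by simp
  also have "\<dots> \<le> (\<Sum>t\<leftarrow>ts. lambda_max (gram_mat A))"
    by (intro sum_list_mono) (simp add: lambda_eq(2)[OF ts(2)])
  also have "\<dots> = real r * lambda_max (gram_mat A)"
    using ts(1) by (simp add: sum_list_triv)
  finally show ?thesis .
qed

text \<open>This criterion involves only determinants, so it makes the largest eigenvalue a measurable
  function of the matrix entries.\<close>

lemma lambda_max_le_iff:
  assumes A: "A \<in> carrier_mat s r" and "0 < r"
  shows "lambda_max (gram_mat A) \<le> y \<longleftrightarrow>
    (\<forall>x\<in>\<rat>. y < x \<longrightarrow> (x - y) ^ r \<le> Re (Determinant.det (of_real x \<cdot>\<^sub>m 1\<^sub>m r - gram_mat A)))"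
proof -
  obtain ts where ts: "length ts = r" "{t. eigenvalue (gram_mat A) (complex_of_real t)} = set ts"
    "\<And>x. Determinant.det (of_real x \<cdot>\<^sub>m 1\<^sub>m r - gram_mat A) = of_real (\<Prod>t\<leftarrow>ts. x - t)"
    using gram_eigenvalue_list[OF A] by metis
  have ne: "ts \<noteq> []" using ts(1) \<open>0 < r\<close> by auto
  have mx: "lambda_max (gram_mat A) = Max (set ts)" by (rule lambda_eq(2)[OF ts(2)])
  show ?thesis
    unfolding ts(3) Re_complex_of_real mx
  proof
    assume "Max (set ts) \<le> y"
    then have le: "\<And>t. t \<in> set ts \<Longrightarrow> t \<le> y" using ne by simp
    show "\<forall>x\<in>\<rat>. y < x \<longrightarrow> (x - y) ^ r \<le> (\<Prod>t\<leftarrow>ts. x - t)"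
      using prod_list_ge_power[of "_ - y" ts] le unfolding ts(1) by (smt (verit))
  next
    assume *: "\<forall>x\<in>\<rat>. y < x \<longrightarrow> (x - y) ^ r \<le> (\<Prod>t\<leftarrow>ts. x - t)"
    show "Max (set ts) \<le> y"
    proof (rule ccontr)
      define e where "e = Max (set ts)"
      assume "\<not> Max (set ts) \<le> y"
      then have e: "y < e" unfolding e_def by (rule not_le_imp_less)
      have e_in: "e \<in> set ts" unfolding e_def using ne by (intro Max_in) auto
      \<comment> \<open>The rationals X n approach the largest eigenvalue e from above. In the limit
        the product acquires the factor 0, while the left side tends to \<open>(e - y) ^ r\<close>,
        which is positive.\<close>
      have "\<exists>X. \<forall>n. X n \<in> \<rat> \<and> e < X n \<and> X n < e + 1 / real (Suc n)"
      proof (rule choice, rule allI)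
        fix n show "\<exists>x. x \<in> \<rat> \<and> e < x \<and> x < e + 1 / real (Suc n)"
          using Rats_dense_in_real[of e "e + 1 / real (Suc n)"] by auto
      qed
      then obtain X where X: "\<And>n. X n \<in> \<rat>" "\<And>n. e < X n" "\<And>n. X n < e + 1 / real (Suc n)" by blast
      have lim: "X \<longlonglongrightarrow> e"
      proof (rule tendsto_sandwich[OF _ _ tendsto_const])
        show "(\<lambda>n. e + 1 / real (Suc n)) \<longlonglongrightarrow> e"
          using tendsto_add[OF tendsto_const LIMSEQ_inverse_real_of_nat, of e] by (simp add: inverse_eq_divide)
      qed (use X in \<open>auto intro!: always_eventually less_imp_le\<close>)
      have L: "(\<lambda>n. (X n - y) ^ r) \<longlonglongrightarrow> (e - y) ^ r" by (intro tendsto_intros lim)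
      have R: "(\<lambda>n. \<Prod>t\<leftarrow>us. X n - t) \<longlonglongrightarrow> (\<Prod>t\<leftarrow>us. e - t)" for us
        by (induction us) (auto intro!: tendsto_intros lim)
      have "(e - y) ^ r \<le> (\<Prod>t\<leftarrow>ts. e - t)"
        using * X e by (intro LIMSEQ_le[OF L R]) (meson less_trans)
      moreover have "(\<Prod>t\<leftarrow>ts. e - t) = 0" using e_in by (auto simp: prod_list_zero_iff)
      moreover have "0 < (e - y) ^ r" using e by simp
      ultimately show False by simp
    qed
  qed
qed

section \<open>Determinants: bounds, measurability and the pseudoinverse row\<close>

lemma det_bound:
  fixes X :: "complex mat"
  assumes X: "X \<in> carrier_mat n n" and C: "\<And>i k. i < n \<Longrightarrow> k < n \<Longrightarrow> cmod (X $$ (i, k)) \<le> C"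
  shows "cmod (Determinant.det X) \<le> fact n * C ^ n"
proof -
  have "cmod (Determinant.det X) \<le> (\<Sum>p\<in>{p. p permutes {0..<n}}. C ^ n)"
    unfolding det_def'[OF X]
  proof (rule order.trans[OF norm_sum sum_mono])
    fix p assume "p \<in> {p. p permutes {0..<n}}"
    then have p: "p permutes {0..<n}" by simp
    have "cmod (signof p * (\<Prod>i = 0..<n. X $$ (i, p i))) = (\<Prod>i = 0..<n. cmod (X $$ (i, p i)))"
      by (simp add: norm_mult prod_norm sign_def)
    also have "\<dots> \<le> (\<Prod>i = 0..<n. C)"
      using p C permutes_in_image[OF p] by (intro prod_mono) auto
    finally show "cmod (signof p * (\<Prod>i = 0..<n. X $$ (i, p i))) \<le> C ^ n" by simp
  qed
  also have "\<dots> = fact n * C ^ n" by (simp add: card_permutations[of "{0..<n}" n])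
  finally show ?thesis .
qed

lemma det_measurable:
  fixes X :: "'x \<Rightarrow> complex mat"
  assumes X: "\<And>\<xi>. X \<xi> \<in> carrier_mat n n"
    and meas: "\<And>i k. i < n \<Longrightarrow> k < n \<Longrightarrow> (\<lambda>\<xi>. X \<xi> $$ (i, k)) \<in> borel_measurable M"
  shows "(\<lambda>\<xi>. Determinant.det (X \<xi>)) \<in> borel_measurable M"
  unfolding det_def'[OF X]
proof (intro borel_measurable_sum borel_measurable_times borel_measurable_const borel_measurable_prod meas)
  fix p i assume "p \<in> {p. p permutes {0..<n}}" "i \<in> {0..<n}"
  then show "i < n" "p i < n" using permutes_in_image[of p "{0..<n}" i] by auto
qed

text \<open>The sign of p enters once for the rows and once for the columns.\<close>

lemma det_permute_both:
  fixes X :: "complex mat"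
  assumes X: "X \<in> carrier_mat n n" and p: "p permutes {0..<n}"
  shows "Determinant.det (Matrix.mat n n (\<lambda>(i, k). X $$ (p i, p k))) = Determinant.det X"
proof -
  define Y where "Y = Matrix.mat n n (\<lambda>(i, k). X $$ (p i, k))"
  have Y: "Y \<in> carrier_mat n n" by (simp add: Y_def)
  have pn: "p k < n" if "k < n" for k using permutes_in_image[OF p, of k] that by simp
  have YT: "transpose_mat Y \<in> carrier_mat n n" using Y by simp
  have "Matrix.mat n n (\<lambda>(i, k). X $$ (p i, p k))
      = transpose_mat (Matrix.mat n n (\<lambda>(i, k). transpose_mat Y $$ (p i, k)))"
    using Y pn by (intro eq_matI) (auto simp: Y_def)
  then have "Determinant.det (Matrix.mat n n (\<lambda>(i, k). X $$ (p i, p k)))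
      = Determinant.det (Matrix.mat n n (\<lambda>(i, k). transpose_mat Y $$ (p i, k)))"
    using det_transpose[of "Matrix.mat n n (\<lambda>(i, k). transpose_mat Y $$ (p i, k))" n] by simp
  also have "\<dots> = signof p * Determinant.det (transpose_mat Y)" by (rule det_permute_rows[OF YT p])
  also have "\<dots> = signof p * (signof p * Determinant.det X)"
    using det_transpose[OF Y] det_permute_rows[OF X p] by (simp add: Y_def)
  also have "\<dots> = Determinant.det X" by (simp add: sign_def)
  finally show ?thesis .
qed

text \<open>The first row of \<open>(A\<^sup>* A)\<^sup>-\<^sup>1 A\<^sup>*\<close>; where the determinant vanishes, \<open>x / 0 = 0\<close> makes it zero.\<close>

definition pinv_row :: "complex mat \<Rightarrow> nat \<Rightarrow> complex" where
  "pinv_row A j = (\<Sum>i<dim_col A. adj_mat (gram_mat A) $$ (0, i) * cnj (A $$ (j, i)))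
     / Determinant.det (gram_mat A)"

text \<open>The adjugate times the Gram matrix is the determinant times the identity; the claim is
  its first row divided by the determinant.\<close>

lemma pinv_row_left_inverse:
  assumes A: "A \<in> carrier_mat s r" and k: "k < r" and det: "Determinant.det (gram_mat A) \<noteq> 0"
  shows "(\<Sum>j<s. pinv_row A j * A $$ (j, k)) = (if k = 0 then 1 else 0)"
proof -
  note Gc = gram_carrier[OF A]
  have "(\<Sum>j<s. (\<Sum>i<r. adj_mat (gram_mat A) $$ (0, i) * cnj (A $$ (j, i))) * A $$ (j, k))
      = (\<Sum>i<r. adj_mat (gram_mat A) $$ (0, i) * (\<Sum>j<s. cnj (A $$ (j, i)) * A $$ (j, k)))"
    unfolding sum_distrib_left sum_distrib_right by (subst sum.swap) (simp add: mult_ac)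
  also have "\<dots> = (\<Sum>i<r. adj_mat (gram_mat A) $$ (0, i) * gram_mat A $$ (i, k))"
    using k by (intro sum.cong refl) (simp add: gram_entry[OF A])
  also have "\<dots> = (adj_mat (gram_mat A) * gram_mat A) $$ (0, k)"
    using k Gc adj_mat(1)[OF Gc] by (simp add: scalar_prod_def atLeast0LessThan)
  also have "\<dots> = (if k = 0 then Determinant.det (gram_mat A) else 0)"
    using k unfolding adj_mat(3)[OF Gc] by simp
  finally show ?thesis using det A
    by (simp add: pinv_row_def sum_divide_distrib[symmetric])
qed

lemma gram_entry_bound:
  assumes A: "A \<in> carrier_mat s r" and C: "\<And>j k. j < s \<Longrightarrow> k < r \<Longrightarrow> cmod (A $$ (j, k)) \<le> C"
    and ik: "i < r" "k < r"
  shows "cmod (gram_mat A $$ (i, k)) \<le> real s * C\<^sup>2"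
proof -
  have "cmod (gram_mat A $$ (i, k)) \<le> (\<Sum>j<s. C * C)"
    unfolding gram_entry[OF A ik]
  proof (rule order.trans[OF norm_sum sum_mono])
    fix j assume "j \<in> {..<s}"
    then have j: "j < s" by simp
    have "0 \<le> C" using C[OF j ik(1)] norm_ge_zero order.trans by blast
    then show "cmod (cnj (A $$ (j, i)) * A $$ (j, k)) \<le> C * C"
      unfolding norm_mult complex_mod_cnj using C j ik by (intro mult_mono) auto
  qed
  then show ?thesis by (simp add: power2_eq_square)
qed

lemma adj_entry:
  assumes X: "X \<in> carrier_mat r r" "i < r" "0 < r"
  shows "adj_mat X $$ (0, i) = (- 1) ^ i * Determinant.det (mat_delete X i 0)"
  using assms by (simp add: adj_mat_def cofactor_def)

lemma mat_delete_entry: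
  assumes X: "X \<in> carrier_mat r r" and "i' < r - 1" "k' < r - 1"
  shows "mat_delete X i 0 $$ (i', k') = X $$ (if i' < i then i' else Suc i', Suc k')"
  using assms by (simp add: mat_delete_def)

text \<open>There are r summands. In each, the entry of the adjugate is a minor of size r - 1 whose
  entries are at most s C^2 by \<open>gram_entry_bound\<close>, and the other factor is an entry of
  A; d bounds the denominator.\<close>

lemma pinv_row_bound:
  assumes A: "A \<in> carrier_mat s r" and r: "0 < r" and C: "\<And>j k. j < s \<Longrightarrow> k < r \<Longrightarrow> cmod (A $$ (j, k)) \<le> C"
    and d: "0 < d" "d \<le> cmod (Determinant.det (gram_mat A))" and j: "j < s"
  shows "cmod (pinv_row A j) \<le> real r * (fact (r - 1) * (real s * C\<^sup>2) ^ (r - 1) * C) / d"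
proof -
  note Gc = gram_carrier[OF A]
  have C0: "0 \<le> C" using C[OF j r] norm_ge_zero order.trans by blast
  have adj: "cmod (adj_mat (gram_mat A) $$ (0, i)) \<le> fact (r - 1) * (real s * C\<^sup>2) ^ (r - 1)" if i: "i < r" for i
  proof -
    have "cmod (Determinant.det (mat_delete (gram_mat A) i 0)) \<le> fact (r - 1) * (real s * C\<^sup>2) ^ (r - 1)"
      using i by (intro det_bound[OF mat_delete_carrier[OF Gc]])
        (auto simp: mat_delete_entry[OF Gc] intro!: gram_entry_bound[OF A C])
    then show ?thesis using adj_entry[OF Gc i r] by (simp add: norm_mult norm_power)
  qed
  have "cmod (\<Sum>i<r. adj_mat (gram_mat A) $$ (0, i) * cnj (A $$ (j, i)))
      \<le> (\<Sum>i<r. fact (r - 1) * (real s * C\<^sup>2) ^ (r - 1) * C)"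
  proof (rule order.trans[OF norm_sum sum_mono])
    fix i assume "i \<in> {..<r}"
    then show "cmod (adj_mat (gram_mat A) $$ (0, i) * cnj (A $$ (j, i)))
        \<le> fact (r - 1) * (real s * C\<^sup>2) ^ (r - 1) * C"
      unfolding norm_mult complex_mod_cnj using adj C j C0 by (intro mult_mono) auto
  qed
  then have "cmod (pinv_row A j) \<le> real r * (fact (r - 1) * (real s * C\<^sup>2) ^ (r - 1) * C)
      / cmod (Determinant.det (gram_mat A))"
    using A d unfolding pinv_row_def norm_divide by (intro divide_right_mono) auto
  also have "\<dots> \<le> real r * (fact (r - 1) * (real s * C\<^sup>2) ^ (r - 1) * C) / d"
    using d C0 by (intro divide_left_mono mult_nonneg_nonneg mult_pos_pos) auto
  finally show ?thesis .
qed

lemma gram_entry_measurable: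
  fixes X :: "'x \<Rightarrow> complex mat"
  assumes X: "\<And>\<xi>. X \<xi> \<in> carrier_mat s r"
    and meas: "\<And>j k. j < s \<Longrightarrow> k < r \<Longrightarrow> (\<lambda>\<xi>. X \<xi> $$ (j, k)) \<in> borel_measurable M"
    and ik: "i < r" "k < r"
  shows "(\<lambda>\<xi>. gram_mat (X \<xi>) $$ (i, k)) \<in> borel_measurable M"
  unfolding gram_entry[OF X ik]
proof (intro borel_measurable_sum borel_measurable_times)
  fix j assume "j \<in> {..<s}"
  then show "(\<lambda>\<xi>. X \<xi> $$ (j, k)) \<in> borel_measurable M" "(\<lambda>\<xi>. cnj (X \<xi> $$ (j, i))) \<in> borel_measurable M"
    using meas ik borel_measurable_continuous_on[of cnj "\<lambda>\<xi>. X \<xi> $$ (j, i)" M]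
    by (auto simp: continuous_on_cnj continuous_on_id)
qed

lemma det_gram_measurable:
  fixes X :: "'x \<Rightarrow> complex mat"
  assumes X: "\<And>\<xi>. X \<xi> \<in> carrier_mat s r"
    and meas: "\<And>j k. j < s \<Longrightarrow> k < r \<Longrightarrow> (\<lambda>\<xi>. X \<xi> $$ (j, k)) \<in> borel_measurable M"
  shows "(\<lambda>\<xi>. Determinant.det (gram_mat (X \<xi>))) \<in> borel_measurable M"
  by (rule det_measurable[OF gram_carrier[OF X] gram_entry_measurable[OF X meas]])

text \<open>By \<open>lambda_max_le_iff\<close> each sublevel set is cut out by conditions on
  determinants, one for each rational x.\<close>

lemma lambda_max_measurable:
  fixes X :: "'x \<Rightarrow> complex mat"
  assumes X: "\<And>\<xi>. X \<xi> \<in> carrier_mat s r" and r: "0 < r"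
    and meas: "\<And>j k. j < s \<Longrightarrow> k < r \<Longrightarrow> (\<lambda>\<xi>. X \<xi> $$ (j, k)) \<in> borel_measurable M"
  shows "(\<lambda>\<xi>. lambda_max (gram_mat (X \<xi>))) \<in> borel_measurable M"
proof (rule borel_measurable_iff_le[THEN iffD2], rule allI)
  fix y
  have [measurable]: "(\<lambda>\<xi>. Determinant.det (of_real x \<cdot>\<^sub>m 1\<^sub>m r - gram_mat (X \<xi>))) \<in> borel_measurable M" for x :: real
  proof (rule det_measurable)
    show "complex_of_real x \<cdot>\<^sub>m 1\<^sub>m r - gram_mat (X \<xi>) \<in> carrier_mat r r" for \<xi>
      by (intro minus_carrier_mat gram_carrier[OF X])
    fix i k assume ik: "i < r" "k < r"
    have eq: "(complex_of_real x \<cdot>\<^sub>m 1\<^sub>m r - gram_mat (X \<xi>)) $$ (i, k)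
        = of_real x * (if i = k then 1 else 0) - gram_mat (X \<xi>) $$ (i, k)" for \<xi>
      using ik gram_carrier[OF X, of \<xi>] by simp
    show "(\<lambda>\<xi>. (complex_of_real x \<cdot>\<^sub>m 1\<^sub>m r - gram_mat (X \<xi>)) $$ (i, k)) \<in> borel_measurable M"
      unfolding eq by (intro borel_measurable_diff borel_measurable_const gram_entry_measurable[OF X meas ik])
  qed
  have "{\<xi> \<in> space M. lambda_max (gram_mat (X \<xi>)) \<le> y} = {\<xi> \<in> space M. \<forall>x\<in>\<rat>. y < x \<longrightarrow>
      (x - y) ^ r \<le> Re (Determinant.det (of_real x \<cdot>\<^sub>m 1\<^sub>m r - gram_mat (X \<xi>)))}"
    unfolding lambda_max_le_iff[OF X r] ..
  also have "\<dots> \<in> sets M"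
    \<comment> \<open>As the range of \<open>of_rat\<close> the rationals are indexed by a countable
      type, which makes the quantifier a countable intersection.\<close>
    unfolding Rats_def ball_simps by measurable
  finally show "{\<xi> \<in> space M. lambda_max (gram_mat (X \<xi>)) \<le> y} \<in> sets M" .
qed

lemma pinv_row_measurable:
  fixes X :: "'x \<Rightarrow> complex mat"
  assumes X: "\<And>\<xi>. X \<xi> \<in> carrier_mat s r" and r: "0 < r"
    and meas: "\<And>j k. j < s \<Longrightarrow> k < r \<Longrightarrow> (\<lambda>\<xi>. X \<xi> $$ (j, k)) \<in> borel_measurable M" and j: "j < s"
  shows "(\<lambda>\<xi>. pinv_row (X \<xi>) j) \<in> borel_measurable M"
proof -
  have adj: "(\<lambda>\<xi>. adj_mat (gram_mat (X \<xi>)) $$ (0, i)) \<in> borel_measurable M" if i: "i < r" for i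
    unfolding adj_entry[OF gram_carrier[OF X] i r]
  proof (intro borel_measurable_times borel_measurable_const det_measurable)
    show "mat_delete (gram_mat (X \<xi>)) i 0 \<in> carrier_mat (r - 1) (r - 1)" for \<xi>
      by (rule mat_delete_carrier[OF gram_carrier[OF X]])
    show "(\<lambda>\<xi>. mat_delete (gram_mat (X \<xi>)) i 0 $$ (i', k')) \<in> borel_measurable M" if "i' < r - 1" "k' < r - 1" for i' k'
      unfolding mat_delete_entry[OF gram_carrier[OF X] that]
      using that by (intro gram_entry_measurable[OF X meas]) auto
  qed
  have dim: "dim_col (X \<xi>) = r" for \<xi> using X[of \<xi>] by simp
  have "(\<lambda>\<xi>. cnj (X \<xi> $$ (j, i))) \<in> borel_measurable M" if "i < r" for i
    using meas[OF j that] borel_measurable_continuous_on[of cnj "\<lambda>\<xi>. X \<xi> $$ (j, i)" M]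
    by (auto simp: continuous_on_cnj continuous_on_id)
  then show ?thesis
    unfolding pinv_row_def dim
    by (intro borel_measurable_divide borel_measurable_sum borel_measurable_times adj
        det_gram_measurable[OF X meas]) auto
qed

section \<open>Essential bounds\<close>

text \<open>A positive supremum exceeds 0 at some admissible bound, possibly infinite, and a real d
  fits between the two.\<close>

lemma essinf_pos_iff: "0 < essinf M f \<longleftrightarrow> (\<exists>d>0. AE x in M. ereal d \<le> f x)"
proof
  assume "0 < essinf M f"
  then obtain c where c: "AE x in M. c \<le> f x" "0 < c"
    unfolding essinf_def less_Sup_iff by blast
  then obtain d where d: "0 < ereal d" "ereal d < c" using ereal_dense2 by blast
  have "AE x in M. ereal d \<le> f x"
    using c(1) by eventually_elim (use d in \<open>auto intro: order.trans less_imp_le\<close>)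
  then show "\<exists>d>0. AE x in M. ereal d \<le> f x" using d(1) by auto
next
  assume "\<exists>d>0. AE x in M. ereal d \<le> f x"
  then obtain d where d: "d > 0" "AE x in M. ereal d \<le> f x" by blast
  then have "ereal d \<le> essinf M f" unfolding essinf_def by (intro Sup_upper) simp
  then show "0 < essinf M f" using d(1) by (simp add: less_le_trans[of 0 "ereal d"])
qed

lemma Linf_common_bound:
  fixes s :: nat
  assumes "\<forall>j<s. f j \<in> Linf M"
  obtains C where "0 \<le> C" "\<And>j. j < s \<Longrightarrow> AE x in M. cmod (f j x) \<le> C"
proof -
  have "\<exists>c. AE x in M. cmod (f j x) \<le> c" if "j < s" for j using assms that by (auto simp: Linf_def)
  then obtain c where c: "\<And>j. j < s \<Longrightarrow> AE x in M. cmod (f j x) \<le> c j" by metis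
  have le: "c j \<le> (\<Sum>j<s. \<bar>c j\<bar>)" if "j < s" for j
    using that by (intro order.trans[OF abs_ge_self member_le_sum[of j "{..<s}" "\<lambda>j. \<bar>c j\<bar>"]]) auto
  have "AE x in M. cmod (f j x) \<le> (\<Sum>j<s. \<bar>c j\<bar>)" if "j < s" for j
    using c[OF that] by eventually_elim (use le[OF that] in simp)
  then show ?thesis by (intro that[of "\<Sum>j<s. \<bar>c j\<bar>"]) (auto intro: sum_nonneg)
qed

section \<open>The sampled system\<close>

locale sampled_system = sampling H m M r \<mu> \<Omega> U a A B
  for H :: "'g::topological_ab_group_add set" and m M r \<mu> \<Omega>
    and U :: "'g \<Rightarrow> 'h::complex_hilbert_space \<Rightarrow> 'h" and a A B +
  fixes b :: "nat \<Rightarrow> 'h" and s :: nat and G :: "nat \<Rightarrow> ('g \<Rightarrow> complex) \<Rightarrow> complex"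
  assumes G_sum: "\<And>j. j < s \<Longrightarrow> L2_has_sum m (\<lambda>h \<gamma>. U_system U (b j) a h * \<gamma> h) (G j) H"
begin

abbreviation GG where "GG \<equiv> G_mat H s r \<mu> G"

lemma GG_carrier: "GG \<xi> \<in> carrier_mat s r"
  by (simp add: G_mat_def)

lemma GG_entry: "j < s \<Longrightarrow> k < r \<Longrightarrow> GG \<xi> $$ (j, k) = G j (\<xi> \<boxplus> \<mu> k)"
  by (simp add: G_mat_def)

lemma G_L2: "j < s \<Longrightarrow> G j \<in> L2 m"
  using G_sum by (auto simp: L2_has_sum_def)

lemma fourier_G: "j < s \<Longrightarrow> h \<in> H \<Longrightarrow> fourier (G j) h = U_system U (b j) a h"
  using L2_has_sum_unique[OF G_sum] by simp

lemma GG_measurable: "j < s \<Longrightarrow> k < r \<Longrightarrow> (\<lambda>\<xi>. GG \<xi> $$ (j, k)) \<in> borel_measurable m"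
  unfolding GG_entry by (intro translate_measurable_comp(2) \<mu>_D L2_meas G_L2)

lemma AE_\<Omega>: "(AE \<xi> in restrict_space m \<Omega>. Q \<xi>) \<longleftrightarrow> (AE \<xi> in m. \<xi> \<in> \<Omega> \<longrightarrow> Q \<xi>)"
  by (rule AE_restrict_space_iff) (simp add: \<Omega>_sets)

lemma tr_\<mu>_0: "\<xi> \<in> D \<Longrightarrow> \<xi> \<boxplus> \<mu> 0 = \<xi>"
  by (simp add: \<mu>_0 translate_zero)

lemma AE_translates:
  assumes "AE \<xi> in m. Q \<xi>"
  shows "AE \<xi> in m. \<forall>k<r. Q (\<xi> \<boxplus> \<mu> k)"
proof -
  have "AE \<xi> in m. Q (\<xi> \<boxplus> \<mu> k)" if "k < r" for k
    using translate_AE[OF \<mu>_D[OF that] assms] by (simp add: translate_commute[of _ "\<mu> k"])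
  then have "AE \<xi> in m. \<forall>k\<in>{..<r}. Q (\<xi> \<boxplus> \<mu> k)" by (intro AE_finite_allI) auto
  then show ?thesis unfolding Ball_def lessThan_iff .
qed

lemma GG_bounded:
  assumes "\<forall>j<s. G j \<in> Linf m"
  obtains C where "0 \<le> C" "AE \<xi> in m. \<forall>j<s. \<forall>k<r. cmod (GG \<xi> $$ (j, k)) \<le> C"
proof -
  obtain C where C: "0 \<le> C" "\<And>j. j < s \<Longrightarrow> AE x in m. cmod (G j x) \<le> C"
    by (rule Linf_common_bound[OF assms]) blast
  have "AE \<xi> in m. \<forall>j\<in>{..<s}. \<forall>k<r. cmod (G j (\<xi> \<boxplus> \<mu> k)) \<le> C"
    using C(2) by (intro AE_finite_allI AE_translates) auto
  then have "AE \<xi> in m. \<forall>j<s. \<forall>k<r. cmod (GG \<xi> $$ (j, k)) \<le> C"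
    by eventually_elim (simp add: GG_entry)
  then show ?thesis using that C(1) by blast
qed

text \<open>Measurability of the largest eigenvalue enters here: it gives \<open>esssup\<close> its
  description through almost everywhere bounds.\<close>

lemma esssup_lambda_max:
  "esssup (restrict_space m \<Omega>) (\<lambda>\<xi>. ereal (lambda_max (gram_mat (GG \<xi>))))
    = Inf {z. AE \<xi> in m. \<xi> \<in> \<Omega> \<longrightarrow> ereal (lambda_max (gram_mat (GG \<xi>))) \<le> z}"
proof -
  have "(\<lambda>\<xi>. ereal (lambda_max (gram_mat (GG \<xi>)))) \<in> borel_measurable m"
    by (intro borel_measurable_ereal lambda_max_measurable[OF GG_carrier r_pos] GG_measurable)
  then show ?thesis
    by (subst esssup_eq_AE) (auto intro: measurable_restrict_space1 simp: AE_\<Omega>)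
qed

text \<open>One direction is \<open>lambda_max_le\<close>. The other is
  \<open>entry_le_lambda_max\<close>, which bounds every \<open>G j\<close> at the translates of
  points of \<Omega>, hence almost everywhere on the dual.\<close>

theorem Linf_iff_beta_finite: "(\<forall>j<s. G j \<in> Linf m) \<longleftrightarrow> beta_G m \<Omega> GG < \<infinity>"
proof
  assume "\<forall>j<s. G j \<in> Linf m"
  then obtain C where C: "AE \<xi> in m. \<forall>j<s. \<forall>k<r. cmod (GG \<xi> $$ (j, k)) \<le> C"
    by (rule GG_bounded) blast
  define K where "K = real s * (real r * C\<^sup>2)"
  have "AE \<xi> in m. \<xi> \<in> \<Omega> \<longrightarrow> ereal (lambda_max (gram_mat (GG \<xi>))) \<le> ereal K"
    using C by eventually_elim (simp add: K_def lambda_max_le[OF GG_carrier r_pos])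
  then have "beta_G m \<Omega> GG \<le> ereal K"
    unfolding beta_G_def esssup_lambda_max by (intro Inf_lower) simp
  then show "beta_G m \<Omega> GG < \<infinity>" by (rule le_less_trans) simp
next
  assume "beta_G m \<Omega> GG < \<infinity>"
  then obtain z where z: "AE \<xi> in m. \<xi> \<in> \<Omega> \<longrightarrow> ereal (lambda_max (gram_mat (GG \<xi>))) \<le> z" "z < \<infinity>"
    unfolding beta_G_def esssup_lambda_max Inf_less_iff by blast
  then obtain n :: nat where n: "z < ereal (real n)" using less_PInf_Ex_of_nat by auto
  define K where "K = real r * real n"
  have "AE \<xi> in m. \<xi> \<in> \<Omega> \<longrightarrow> (\<forall>j<s. \<forall>k<r. (cmod (G j (\<xi> \<boxplus> \<mu> k)))\<^sup>2 \<le> K)"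
    using z(1)
  proof eventually_elim
    case (elim \<xi>)
    show ?case
    proof (intro impI allI)
      fix j k assume "\<xi> \<in> \<Omega>" and jk: "j < s" "k < r"
      then have "ereal (lambda_max (gram_mat (GG \<xi>))) < ereal (real n)" using elim n by (blast intro: le_less_trans)
      then have "real r * lambda_max (gram_mat (GG \<xi>)) \<le> K" unfolding K_def by (intro mult_left_mono) auto
      then show "(cmod (G j (\<xi> \<boxplus> \<mu> k)))\<^sup>2 \<le> K"
        using entry_le_lambda_max[OF GG_carrier jk, of \<xi>] GG_entry[OF jk, of \<xi>] by simp
    qed
  qed
  from AE_\<Omega>_to_D[OF this] have bound: "AE \<xi> in m. \<forall>j<s. (cmod (G j \<xi>))\<^sup>2 \<le> K"
    using AE_space
  proof eventually_elim
    case (elim \<xi>)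
    then have xi: "\<xi> \<in> D" by (simp add: space_m)
    then obtain k where k: "k < r" "\<mu> k \<boxplus> \<xi> \<in> \<Omega>" by (rule \<Omega>_translate)
    \<comment> \<open>The way back from \<Omega> to \<xi> is again translation by some \<mu> l, so
      the value of \<open>G j\<close> at \<xi> is an entry of the matrix at a point of
      \<Omega>.\<close>
    have "neg (\<mu> k) \<in> N" using k \<mu>_N neg_N by blast
    then obtain l where l: "l < r" "neg (\<mu> k) = \<mu> l" using \<mu>_bij by (auto simp: bij_betw_def)
    have "\<mu> k \<boxplus> \<xi> \<boxplus> \<mu> l = \<xi>"
      using neg_translate[OF \<mu>_D[OF k(1)] xi] unfolding l(2) by (simp only: translate_commute[of _ "\<mu> l"])
    then show ?case using elim(1) k l(1) by metis
  qed
  show "\<forall>j<s. G j \<in> Linf m"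
    unfolding Linf_def
  proof (intro allI impI CollectI conjI exI[of _ "K + 1"])
    fix j assume j: "j < s"
    show "G j \<in> borel_measurable m" using L2_meas[OF G_L2[OF j]] .
    \<comment> \<open>This replaces the square root of K as a bound.\<close>
    have sq: "z \<le> K + 1" if "z\<^sup>2 \<le> K" for z :: real
    proof -
      have "0 \<le> (z - 1)\<^sup>2" by simp
      then have "2 * z \<le> z\<^sup>2 + 1" by (simp add: power2_eq_square algebra_simps)
      moreover have "0 \<le> K" using that zero_le_power2 order.trans by blast
      ultimately show ?thesis using that by linarith
    qed
    show "AE \<xi> in m. cmod (G j \<xi>) \<le> K + 1"
      using bound by eventually_elim (use j sq in blast)
  qed
qed

lemma left_inverse_row_iff:
  "left_inverse_row m s r GG F \<longleftrightarrow> (\<forall>j<s. F j \<in> Linf m) \<and>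
    (AE \<xi> in m. \<forall>k<r. (\<Sum>j<s. F j \<xi> * G j (\<xi> \<boxplus> \<mu> k)) = (if k = 0 then 1 else 0))"
proof -
  have "mat_of_row (Matrix.vec s (\<lambda>j. F j \<xi>)) * GG \<xi> = mat_of_row (unit_vec r 0) \<longleftrightarrow>
      (\<forall>k<r. (\<Sum>j<s. F j \<xi> * G j (\<xi> \<boxplus> \<mu> k)) = (if k = 0 then 1 else 0))" for \<xi>
  proof -
    have e: "(mat_of_row (Matrix.vec s (\<lambda>j. F j \<xi>)) * GG \<xi>) $$ (0, k) = (\<Sum>j<s. F j \<xi> * G j (\<xi> \<boxplus> \<mu> k))"
      if "k < r" for k
      using that by (simp add: scalar_prod_def G_mat_def mat_of_row_def atLeast0LessThan)
    have u: "mat_of_row (unit_vec r 0) $$ (0, k) = (if k = 0 then 1 else (0::complex))" if "k < r" for k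
      using that by (simp add: mat_of_row_def)
    have dims: "dim_row (mat_of_row (Matrix.vec s (\<lambda>j. F j \<xi>)) * GG \<xi>) = 1"
      "dim_col (mat_of_row (Matrix.vec s (\<lambda>j. F j \<xi>)) * GG \<xi>) = r"
      by (simp_all add: mat_of_row_def G_mat_def)
    show ?thesis
    proof
      assume "mat_of_row (Matrix.vec s (\<lambda>j. F j \<xi>)) * GG \<xi> = mat_of_row (unit_vec r 0)"
      then show "\<forall>k<r. (\<Sum>j<s. F j \<xi> * G j (\<xi> \<boxplus> \<mu> k)) = (if k = 0 then 1 else 0)"
        using e u by metis
    next
      assume *: "\<forall>k<r. (\<Sum>j<s. F j \<xi> * G j (\<xi> \<boxplus> \<mu> k)) = (if k = 0 then 1 else 0)"
      show "mat_of_row (Matrix.vec s (\<lambda>j. F j \<xi>)) * GG \<xi> = mat_of_row (unit_vec r 0)"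
      proof (rule eq_matI)
        fix i k assume "i < dim_row (mat_of_row (unit_vec r 0 :: complex vec))"
          and "k < dim_col (mat_of_row (unit_vec r 0 :: complex vec))"
        then have "i = 0" "k < r" by (simp_all add: mat_of_row_def)
        then show "(mat_of_row (Matrix.vec s (\<lambda>j. F j \<xi>)) * GG \<xi>) $$ (i, k) = mat_of_row (unit_vec r 0) $$ (i, k)"
          using e u * by metis
      qed (simp_all only: dims, simp_all add: mat_of_row_def)
    qed
  qed
  then show ?thesis unfolding left_inverse_row_def by simp
qed

text \<open>Translation by \<mu> k permutes the columns of the matrix, hence permutes rows and
  columns of its Gram matrix alike.\<close>

lemma det_gram_periodic:
  assumes k: "k < r" and xi: "\<xi> \<in> D"
  shows "Determinant.det (gram_mat (GG (\<mu> k \<boxplus> \<xi>))) = Determinant.det (gram_mat (GG \<xi>))"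
proof -
  have "bij_betw (\<lambda>i. the_inv_into {..<r} \<mu> (\<mu> k \<boxplus> \<mu> i)) {..<r} {..<r}"
    using bij_betw_trans[OF bij_betw_trans[OF \<mu>_bij translate_bij_N[OF \<mu>_N[OF k]]] bij_betw_the_inv_into[OF \<mu>_bij]]
    by (simp add: o_def)
  \<comment> \<open>From r on the map is the identity, as \<open>permutes\<close> demands.\<close>
  moreover define p where "p i = (if i < r then the_inv_into {..<r} \<mu> (\<mu> k \<boxplus> \<mu> i) else i)" for i
  ultimately have bp: "bij_betw p {..<r} {..<r}"
    by (subst bij_betw_cong[where g = "\<lambda>i. the_inv_into {..<r} \<mu> (\<mu> k \<boxplus> \<mu> i)"]) auto
  then have perm: "p permutes {0..<r}"
    unfolding atLeast0LessThan by (rule bij_imp_permutes) (simp add: p_def)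
  have pr: "p i < r" if "i < r" for i using bp that by (auto simp: bij_betw_def)
  have p: "\<mu> (p i) = \<mu> k \<boxplus> \<mu> i" if "i < r" for i
    using that translate_N[OF \<mu>_N[OF k] \<mu>_N[OF that]] f_the_inv_into_f_bij_betw[OF \<mu>_bij] by (simp add: p_def)
  have shift: "\<mu> k \<boxplus> \<xi> \<boxplus> \<mu> i = \<xi> \<boxplus> \<mu> (p i)" if "i < r" for i
    using p[OF that] by (simp add: translate_assoc[symmetric] translate_commute[of "\<mu> k" \<xi>])
  have "gram_mat (GG (\<mu> k \<boxplus> \<xi>)) = Matrix.mat r r (\<lambda>(i, l). gram_mat (GG \<xi>) $$ (p i, p l))"
  proof (rule eq_matI)
    fix i l assume "i < dim_row (Matrix.mat r r (\<lambda>(i, l). gram_mat (GG \<xi>) $$ (p i, p l)))"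
      and "l < dim_col (Matrix.mat r r (\<lambda>(i, l). gram_mat (GG \<xi>) $$ (p i, p l)))"
    then have il: "i < r" "l < r" by simp_all
    then show "gram_mat (GG (\<mu> k \<boxplus> \<xi>)) $$ (i, l)
        = Matrix.mat r r (\<lambda>(i, l). gram_mat (GG \<xi>) $$ (p i, p l)) $$ (i, l)"
      using pr by (simp add: gram_entry[OF GG_carrier] GG_entry shift)
  qed (use gram_carrier[OF GG_carrier, of "\<mu> k \<boxplus> \<xi>"] in auto)
  then show ?thesis using det_permute_both[OF gram_carrier[OF GG_carrier] perm, of \<xi>] by simp
qed

end

section \<open>Bounded systems: from the determinant to a frame and back to a lower bound\<close>

locale bounded_system = sampled_system +
  assumes G_Linf: "\<And>j. j < s \<Longrightarrow> G j \<in> Linf m"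
begin

lemma all_Linf: "\<forall>j<s. G j \<in> Linf m"
  using G_Linf by blast

lemma FG_L2: "F \<in> L2 m \<Longrightarrow> j < s \<Longrightarrow> (\<lambda>\<xi>. F \<xi> * G j \<xi>) \<in> L2 m"
  using L2_mult_Linf[OF _ G_Linf, of F j] by (simp add: mult.commute)

text \<open>The lower bound on \<Omega> holds on the whole dual because the determinant is periodic,
  and there the pseudoinverse row is bounded.\<close>

theorem left_inverse_of_det:
  assumes "0 < essinf_det m \<Omega> GG"
  shows "\<exists>F. left_inverse_row m s r GG F"
proof -
  obtain d where d: "0 < d" "AE \<xi> in m. \<xi> \<in> \<Omega> \<longrightarrow> d \<le> Re (Determinant.det (gram_mat (GG \<xi>)))"
    using assms unfolding essinf_det_def essinf_pos_iff AE_\<Omega> by auto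
  have dD: "AE \<xi> in m. d \<le> cmod (Determinant.det (gram_mat (GG \<xi>)))"
    using AE_\<Omega>_to_D[OF d(2)] AE_space
  proof eventually_elim
    case (elim \<xi>)
    then have xi: "\<xi> \<in> D" by (simp add: space_m)
    then obtain k where k: "k < r" "\<mu> k \<boxplus> \<xi> \<in> \<Omega>" by (rule \<Omega>_translate)
    then have "d \<le> Re (Determinant.det (gram_mat (GG (\<mu> k \<boxplus> \<xi>))))" using elim(1) by blast
    also have "\<dots> = Re (Determinant.det (gram_mat (GG \<xi>)))" using det_gram_periodic[OF k(1) xi] by simp
    also have "\<dots> \<le> cmod (Determinant.det (gram_mat (GG \<xi>)))" by (rule complex_Re_le_cmod)
    finally show ?case .
  qed
  obtain C where C: "AE \<xi> in m. \<forall>j<s. \<forall>k<r. cmod (GG \<xi> $$ (j, k)) \<le> C"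
    by (rule GG_bounded[OF all_Linf]) blast
  have "left_inverse_row m s r GG (\<lambda>j \<xi>. pinv_row (GG \<xi>) j)"
    unfolding left_inverse_row_iff
  proof (intro conjI allI impI)
    fix j assume j: "j < s"
    have "AE \<xi> in m. cmod (pinv_row (GG \<xi>) j) \<le> real r * (fact (r - 1) * (real s * C\<^sup>2) ^ (r - 1) * C) / d"
      using C dD
    proof eventually_elim
      case (elim \<xi>)
      show ?case by (rule pinv_row_bound[OF GG_carrier r_pos _ d(1) elim(2) j]) (use elim(1) in blast)
    qed
    moreover have "(\<lambda>\<xi>. pinv_row (GG \<xi>) j) \<in> borel_measurable m"
      by (rule pinv_row_measurable[OF GG_carrier r_pos GG_measurable j])
    ultimately show "(\<lambda>\<xi>. pinv_row (GG \<xi>) j) \<in> Linf m" unfolding Linf_def by blast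
  next
    show "AE \<xi> in m. \<forall>k<r. (\<Sum>j<s. pinv_row (GG \<xi>) j * G j (\<xi> \<boxplus> \<mu> k)) = (if k = 0 then 1 else 0)"
      using dD
    proof eventually_elim
      case (elim \<xi>)
      then have nz: "Determinant.det (gram_mat (GG \<xi>)) \<noteq> 0" using d(1) by auto
      show ?case
      proof (intro allI impI)
        fix k assume k: "k < r"
        show "(\<Sum>j<s. pinv_row (GG \<xi>) j * G j (\<xi> \<boxplus> \<mu> k)) = (if k = 0 then 1 else 0)"
          using pinv_row_left_inverse[OF GG_carrier k nz] k by (simp add: GG_entry)
      qed
    qed
  qed
  then show ?thesis by blast
qed

lemma samples_has_sum:
  assumes F: "F \<in> L2 m" and j: "j < s"
  shows "((\<lambda>k. (cmod (U_system U (b j) (T F) k))\<^sup>2) has_sum sqnorm m (periodize (\<lambda>\<xi>. F \<xi> * G j \<xi>))) M"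
  using has_sum_periodize[OF FG_L2[OF F j]]
  by (subst has_sum_cong[where g = "\<lambda>k. (cmod (fourier (\<lambda>\<xi>. F \<xi> * G j \<xi>) k))\<^sup>2"])
    (use MH in \<open>auto simp: U_system_T[OF F G_L2[OF j] G_Linf[OF j] fourier_G[OF j]] subset_iff\<close>)

lemma samples_has_sum_Times:
  assumes F: "F \<in> L2 m"
  shows "((\<lambda>i. (cmod ((\<lambda>(j, k). U_system U (b j) (T F) k) i))\<^sup>2) has_sum
    (\<Sum>j<s. sqnorm m (periodize (\<lambda>\<xi>. F \<xi> * G j \<xi>)))) ({..<s} \<times> M)"
proof -
  have "((\<lambda>(j, k). (cmod (U_system U (b j) (T F) k))\<^sup>2) has_sum
      (\<Sum>j<s. sqnorm m (periodize (\<lambda>\<xi>. F \<xi> * G j \<xi>)))) ({..<s} \<times> M)"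
    using samples_has_sum[OF F] by (rule has_sum_finite_Times)
  then show ?thesis by (simp add: case_prod_unfold)
qed

text \<open>The samples on M are the Fourier coefficients of the periodization of F times
  \<open>G j\<close>, so each j contributes a series of the kind summed in
  \<open>has_sum_translates\<close>.\<close>

lemma expansion_has_sum:
  assumes F: "F \<in> L2 m" and C: "\<forall>j<s. C j \<in> Linf m"
  shows "((\<lambda>(j, k). scaleC (U_system U (b j) (T F) k) (U k (T (C j)))) has_sum
    T (\<lambda>\<xi>. \<Sum>j<s. C j \<xi> * periodize (\<lambda>\<xi>. F \<xi> * G j \<xi>) \<xi>)) ({..<s} \<times> M)"
proof -
  have one: "((\<lambda>k. scaleC (U_system U (b j) (T F) k) (U k (T (C j)))) has_sum
      T (\<lambda>\<xi>. C j \<xi> * periodize (\<lambda>\<xi>. F \<xi> * G j \<xi>) \<xi>)) M" if j: "j < s" for j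
  proof -
    have FG: "(\<lambda>\<xi>. F \<xi> * G j \<xi>) \<in> L2 m" by (rule FG_L2[OF F j])
    have "((\<lambda>k. scaleC (fourier (periodize (\<lambda>\<xi>. F \<xi> * G j \<xi>)) k) (U k (T (C j)))) has_sum
        T (\<lambda>\<xi>. C j \<xi> * periodize (\<lambda>\<xi>. F \<xi> * G j \<xi>) \<xi>)) M"
      by (rule has_sum_translates[OF C[rule_format, OF j] periodize_L2[OF FG]]) (simp add: fourier_periodize[OF FG])
    then show ?thesis
      by (subst has_sum_cong[where g = "\<lambda>k. scaleC (fourier (periodize (\<lambda>\<xi>. F \<xi> * G j \<xi>)) k) (U k (T (C j)))"])
        (use MH in \<open>auto simp: U_system_T[OF F G_L2[OF j] G_Linf[OF j] fourier_G[OF j]] fourier_periodize[OF FG] subset_iff\<close>)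
  qed
  have "(\<Sum>j<s. T (\<lambda>\<xi>. C j \<xi> * periodize (\<lambda>\<xi>. F \<xi> * G j \<xi>) \<xi>)) = T (\<lambda>\<xi>. \<Sum>j<s. C j \<xi> * periodize (\<lambda>\<xi>. F \<xi> * G j \<xi>) \<xi>)"
    using C by (intro T_sum[symmetric] L2_mult_Linf periodize_L2 FG_L2 F) auto
  moreover have "((\<lambda>(j, k). scaleC (U_system U (b j) (T F) k) (U k (T (C j)))) has_sum
      (\<Sum>j<s. T (\<lambda>\<xi>. C j \<xi> * periodize (\<lambda>\<xi>. F \<xi> * G j \<xi>) \<xi>))) ({..<s} \<times> M)"
    using one by (rule has_sum_finite_Times)
  ultimately show ?thesis by simp
qed

lemma sqnorm_trig: "finite J \<Longrightarrow> J \<subseteq> H \<Longrightarrow> sqnorm m (\<lambda>\<gamma>. \<Sum>h\<in>J. d h * \<gamma> h) = (\<Sum>h\<in>J. (cmod (d h))\<^sup>2)"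
  using sqnorm_approx[OF L2_zero, of J d] sqnorm_zero[of m] by (simp add: fourier_def sqnorm_def)

lemma T_mult_trig:
  assumes C: "C \<in> L2 m" and J: "finite J" "J \<subseteq> H"
  shows "(\<lambda>\<xi>. (\<Sum>h\<in>J. d h * \<xi> h) * C \<xi>) \<in> L2 m"
    "T (\<lambda>\<xi>. (\<Sum>h\<in>J. d h * \<xi> h) * C \<xi>) = (\<Sum>k\<in>J. scaleC (d k) (U k (T C)))"
proof -
  have eq: "(\<lambda>\<xi>. (\<Sum>h\<in>J. d h * \<xi> h) * C \<xi>) = (\<lambda>\<xi>. \<Sum>h\<in>J. d h * (\<xi> h * C \<xi>))"
    by (simp add: sum_distrib_right mult.assoc)
  show "(\<lambda>\<xi>. (\<Sum>h\<in>J. d h * \<xi> h) * C \<xi>) \<in> L2 m"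
    unfolding eq using J C by (intro L2_sum L2_scale char_mult_L2) auto
  have "T (\<lambda>\<xi>. \<Sum>h\<in>J. d h * (\<xi> h * C \<xi>)) = (\<Sum>h\<in>J. T (\<lambda>\<xi>. d h * (\<xi> h * C \<xi>)))"
    using J C by (intro T_sum L2_scale char_mult_L2) auto
  also have "\<dots> = (\<Sum>k\<in>J. scaleC (d k) (U k (T C)))"
  proof (rule sum.cong[OF refl])
    fix k assume "k \<in> J"
    then have k: "k \<in> H" using J by blast
    show "T (\<lambda>\<xi>. d k * (\<xi> k * C \<xi>)) = scaleC (d k) (U k (T C))"
      using T_scale[OF char_mult_L2[OF k C]] T_shift[OF C k] by simp
  qed
  finally show "T (\<lambda>\<xi>. (\<Sum>h\<in>J. d h * \<xi> h) * C \<xi>) = (\<Sum>k\<in>J. scaleC (d k) (U k (T C)))" unfolding eq .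
qed

text \<open>By duality it suffices to bound finite combinations of the translates. These are images
  of a trigonometric polynomial times C, controlled by the bound c of C and the upper Riesz
  constant.\<close>

lemma translates_bessel:
  assumes C: "C \<in> Linf m"
  obtains K where "0 \<le> K" "\<And>x J. finite J \<Longrightarrow> J \<subseteq> H \<Longrightarrow> (\<Sum>k\<in>J. (cmod (cinner x (U k (T C))))\<^sup>2) \<le> K * (norm x)\<^sup>2"
proof -
  obtain c where Cm: "C \<in> borel_measurable m" and c: "AE \<xi> in m. cmod (C \<xi>) \<le> c"
    using C by (auto simp: Linf_def)
  define K where "K = \<bar>B\<bar> * c\<^sup>2"
  have K: "0 \<le> K" by (simp add: K_def)
  have "(\<Sum>k\<in>J. (cmod (cinner x (U k (T C))))\<^sup>2) \<le> K * (norm x)\<^sup>2" if J: "finite J" "J \<subseteq> H" for x J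
  proof (rule analysis_bound_of_synthesis_bound[OF K])
    fix d :: "_ \<Rightarrow> complex"
    let ?p = "\<lambda>\<xi>. \<Sum>h\<in>J. d h * \<xi> h"
    note TC = T_mult_trig[OF L2_of_Linf[OF C] J, of d]
    have "(norm (\<Sum>k\<in>J. scaleC (d k) (U k (T C))))\<^sup>2 \<le> B * sqnorm m (\<lambda>\<xi>. ?p \<xi> * C \<xi>)"
      unfolding TC(2)[symmetric] by (rule T_upper[OF TC(1)])
    also have "\<dots> \<le> \<bar>B\<bar> * sqnorm m (\<lambda>\<xi>. ?p \<xi> * C \<xi>)" by (intro mult_right_mono) auto
    also have "sqnorm m (\<lambda>\<xi>. ?p \<xi> * C \<xi>) \<le> c\<^sup>2 * sqnorm m ?p"
      using L2_mult_bounded(2)[OF trig_L2[OF J(2)] Cm c, of d] by (simp add: mult.commute)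
    also have "sqnorm m ?p = (\<Sum>k\<in>J. (cmod (d k))\<^sup>2)" by (rule sqnorm_trig[OF J])
    finally show "(norm (\<Sum>k\<in>J. scaleC (d k) (U k (T C))))\<^sup>2 \<le> K * (\<Sum>k\<in>J. (cmod (d k))\<^sup>2)"
      by (simp add: K_def mult.assoc mult_left_mono)
  qed
  then show ?thesis using that K by blast
qed

lemma samples_upper:
  obtains K where "0 \<le> K" "\<And>F. F \<in> L2 m \<Longrightarrow> (\<Sum>j<s. sqnorm m (periodize (\<lambda>\<xi>. F \<xi> * G j \<xi>))) \<le> K * sqnorm m F"
proof -
  obtain C where C: "0 \<le> C" "\<And>j. j < s \<Longrightarrow> AE \<xi> in m. cmod (G j \<xi>) \<le> C"
    by (rule Linf_common_bound[OF all_Linf]) blast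
  have "(\<Sum>j<s. sqnorm m (periodize (\<lambda>\<xi>. F \<xi> * G j \<xi>))) \<le> (real s * C\<^sup>2) * sqnorm m F" if F: "F \<in> L2 m" for F
  proof -
    have "(\<Sum>j<s. sqnorm m (periodize (\<lambda>\<xi>. F \<xi> * G j \<xi>))) \<le> (\<Sum>j<s. C\<^sup>2 * sqnorm m F)"
    proof (rule sum_mono)
      fix j assume "j \<in> {..<s}"
      then have j: "j < s" by simp
      have "sqnorm m (periodize (\<lambda>\<xi>. F \<xi> * G j \<xi>)) \<le> sqnorm m (\<lambda>\<xi>. F \<xi> * G j \<xi>)" by (rule sqnorm_periodize_le[OF FG_L2[OF F j]])
      also have "\<dots> \<le> C\<^sup>2 * sqnorm m F"
        using L2_mult_bounded(2)[OF F L2_meas[OF G_L2[OF j]] C(2)[OF j]] by (simp add: mult.commute)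
      finally show "sqnorm m (periodize (\<lambda>\<xi>. F \<xi> * G j \<xi>)) \<le> C\<^sup>2 * sqnorm m F" .
    qed
    then show ?thesis by simp
  qed
  then show ?thesis by (intro that[of "real s * C\<^sup>2"]) auto
qed

text \<open>The pointwise identity gives the expansion of every x. The upper frame bound comes from
  \<open>translates_bessel\<close>, the lower one from \<open>has_sum_norm_lower\<close> together
  with the bound \<open>samples_upper\<close> for the energy of the samples.\<close>

theorem frame_expansion_of_left_inverse:
  assumes F: "left_inverse_row m s r GG F"
  shows "\<exists>c. (\<forall>j<s. c j \<in> V) \<and> frame_expansion U M V s b (\<lambda>j k. U k (c j))"
proof -
  \<comment> \<open>The factor r cancels the 1 / r in \<open>periodize\<close>.\<close>
  define C where "C j \<xi> = of_nat r * F j \<xi>" for j \<xi>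
  have FL: "\<And>j. j < s \<Longrightarrow> F j \<in> Linf m"
    and inv: "AE \<xi> in m. \<forall>k<r. (\<Sum>j<s. F j \<xi> * G j (\<xi> \<boxplus> \<mu> k)) = (if k = 0 then 1 else 0)"
    using F unfolding left_inverse_row_iff by blast+
  have CL: "C j \<in> Linf m" if j: "j < s" for j
  proof -
    obtain c where c: "AE \<xi> in m. cmod (F j \<xi>) \<le> c" and Fm: "F j \<in> borel_measurable m"
      using FL[OF j] by (auto simp: Linf_def)
    have "AE \<xi> in m. cmod (C j \<xi>) \<le> real r * c"
      using c by eventually_elim (simp add: C_def norm_mult mult_left_mono)
    moreover have "C j \<in> borel_measurable m" unfolding C_def using Fm by simp
    ultimately show ?thesis unfolding Linf_def by blast
  qed
  define c where "c j = T (C j)" for j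
  have UcV: "U k (c j) \<in> V" if "j < s" "k \<in> H" for j k
    using T_V[OF char_mult_L2[OF that(2) L2_of_Linf[OF CL[OF that(1)]]]]
      T_shift[OF L2_of_Linf[OF CL[OF that(1)]] that(2)] by (simp add: c_def)
  have expand: "((\<lambda>(j, k). scaleC (U_system U (b j) x k) (U k (c j))) has_sum x) ({..<s} \<times> M)"
    if x: "x \<in> V" for x
  proof -
    obtain K where K: "K \<in> L2 m" "x = T K" using x by (rule V_T)
    let ?S = "\<lambda>\<xi>. \<Sum>j<s. C j \<xi> * periodize (\<lambda>\<xi>. K \<xi> * G j \<xi>) \<xi>"
    have S: "?S \<in> L2 m"
      using CL by (intro L2_sum L2_mult_Linf periodize_L2 FG_L2 K) auto
    have "AE \<xi> in m. ?S \<xi> = K \<xi>"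
      using inv AE_space
    proof eventually_elim
      case (elim \<xi>)
      have "?S \<xi> = (\<Sum>j<s. \<Sum>k<r. K (\<xi> \<boxplus> \<mu> k) * (F j \<xi> * G j (\<xi> \<boxplus> \<mu> k)))"
        using r_pos by (simp add: C_def periodize_def sum_distrib_left mult_ac)
      \<comment> \<open>After the exchange the inner sum is an entry of the left inverse identity,
        so that only k = 0 survives.\<close>
      also have "\<dots> = (\<Sum>k<r. K (\<xi> \<boxplus> \<mu> k) * (\<Sum>j<s. F j \<xi> * G j (\<xi> \<boxplus> \<mu> k)))"
        unfolding sum_distrib_left by (rule sum.swap)
      also have "\<dots> = (\<Sum>k<r. if k = 0 then K (\<xi> \<boxplus> \<mu> k) else 0)"
        using elim(1) by (intro sum.cong refl) simp
      also have "\<dots> = K (\<xi> \<boxplus> \<mu> 0)" using r_pos by (simp add: sum.delta)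
      also have "\<dots> = K \<xi>" using elim(2) by (simp add: tr_\<mu>_0 space_m)
      finally show ?case .
    qed
    then have "T ?S = x" using T_cong_AE[OF S K(1)] K(2) by simp
    then show ?thesis using expansion_has_sum[OF K(1), of C] CL K(2) by (simp add: c_def)
  qed
  have "\<exists>K\<ge>0. \<forall>x J. finite J \<longrightarrow> J \<subseteq> H \<longrightarrow> (\<Sum>k\<in>J. (cmod (cinner x (U k (c j))))\<^sup>2) \<le> K * (norm x)\<^sup>2" if j: "j < s" for j
  proof -
    obtain K where "0 \<le> K" "\<And>x J. finite J \<Longrightarrow> J \<subseteq> H \<Longrightarrow>
        (\<Sum>k\<in>J. (cmod (cinner x (U k (T (C j)))))\<^sup>2) \<le> K * (norm x)\<^sup>2"
      by (rule translates_bessel[OF CL[OF j]]) blast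
    then show ?thesis unfolding c_def by blast
  qed
  then obtain K where K: "\<And>j x J. j < s \<Longrightarrow> finite J \<Longrightarrow> J \<subseteq> H \<Longrightarrow>
      (\<Sum>k\<in>J. (cmod (cinner x (U k (c j))))\<^sup>2) \<le> K j * (norm x)\<^sup>2" by metis
  obtain L where L: "0 \<le> L" "\<And>F. F \<in> L2 m \<Longrightarrow> (\<Sum>j<s. sqnorm m (periodize (\<lambda>\<xi>. F \<xi> * G j \<xi>))) \<le> L * sqnorm m F"
    by (rule samples_upper) blast
  define E where "E x = (\<Sum>j<s. \<Sum>\<^sub>\<infinity>k\<in>M. (cmod (cinner x (U k (c j))))\<^sup>2)" for x
  have sm: "(\<lambda>k. (cmod (cinner x (U k (c j))))\<^sup>2) summable_on M" if "j < s" for x j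
    using K[OF that] MH by (intro nonneg_bounded_partial_sums_imp_summable_on[of _ _ "K j * (norm x)\<^sup>2"])
      (auto intro: eventually_finite_subsets_at_top_weakI)
  have Es: "((\<lambda>i. (cmod (cinner x ((\<lambda>(j, k). U k (c j)) i)))\<^sup>2) has_sum E x) ({..<s} \<times> M)" for x
  proof -
    have "((\<lambda>(j, k). (cmod (cinner x (U k (c j))))\<^sup>2) has_sum E x) ({..<s} \<times> M)"
      unfolding E_def by (rule has_sum_finite_Times, rule has_sum_infsum, rule sm)
    then show ?thesis by (simp add: case_prod_unfold)
  qed
  have upper: "E x \<le> (\<Sum>j<s. K j) * (norm x)\<^sup>2" for x
    unfolding E_def sum_distrib_right
  proof (rule sum_mono)
    fix j assume "j \<in> {..<s}"
    then show "(\<Sum>\<^sub>\<infinity>k\<in>M. (cmod (cinner x (U k (c j))))\<^sup>2) \<le> K j * (norm x)\<^sup>2"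
      using sm[of j x] K MH by (intro infsum_le_finite_sums) auto
  qed
  \<comment> \<open>L may be 0; L + 1 keeps the denominator positive.\<close>
  have lower: "(A / (L + 1)) * (norm x)\<^sup>2 \<le> E x" if x: "x \<in> V" for x
  proof (cases "x = 0")
    case True
    have "0 \<le> E x" unfolding E_def by (intro sum_nonneg infsum_nonneg) simp
    then show ?thesis using True by simp
  next
    case False
    obtain F' where F': "F' \<in> L2 m" "x = T F'" using x by (rule V_T)
    have E0: "0 \<le> E x" unfolding E_def by (intro sum_nonneg infsum_nonneg) simp
    have "((norm x)\<^sup>2)\<^sup>2 \<le> (\<Sum>j<s. sqnorm m (periodize (\<lambda>\<xi>. F' \<xi> * G j \<xi>))) * E x"
      using has_sum_norm_lower[OF _ samples_has_sum_Times[OF F'(1)] Es] expand[OF x] F'(2)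
      by (simp add: case_prod_unfold)
    also have "\<dots> \<le> (L * sqnorm m F') * E x" by (rule mult_right_mono[OF L(2)[OF F'(1)] E0])
    also have "\<dots> \<le> ((L + 1) * ((norm x)\<^sup>2 / A)) * E x"
      using T_lower[OF F'(1)] A_pos L(1) F'(2) E0
      by (intro mult_right_mono mult_mono) (auto simp: field_simps)
    finally have "(norm x)\<^sup>2 * (norm x)\<^sup>2 \<le> (norm x)\<^sup>2 * ((L + 1) / A * E x)"
      by (simp add: power2_eq_square mult_ac)
    then have "(norm x)\<^sup>2 \<le> (L + 1) / A * E x" by (rule mult_left_le_imp_le) (simp add: False)
    then show ?thesis using A_pos L(1) by (simp add: field_simps)
  qed
  have "frame_for V ({..<s} \<times> M) (\<lambda>(j, k). U k (c j))"
    unfolding frame_for_def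
  proof (rule conjI, rule ballI)
    show "(case i of (j, k) \<Rightarrow> U k (c j)) \<in> V" if "i \<in> {..<s} \<times> M" for i
      using that UcV MH by auto
    have pos: "0 < A / (L + 1)" using A_pos L(1) by simp
    have "(\<lambda>i. (cmod (cinner x (case i of (j, k) \<Rightarrow> U k (c j))))\<^sup>2) summable_on {..<s} \<times> M \<and>
        A / (L + 1) * (norm x)\<^sup>2 \<le> (\<Sum>\<^sub>\<infinity>i\<in>{..<s} \<times> M. (cmod (cinner x (case i of (j, k) \<Rightarrow> U k (c j))))\<^sup>2) \<and>
        (\<Sum>\<^sub>\<infinity>i\<in>{..<s} \<times> M. (cmod (cinner x (case i of (j, k) \<Rightarrow> U k (c j))))\<^sup>2) \<le> (\<Sum>j<s. K j) * (norm x)\<^sup>2"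
      if x: "x \<in> V" for x
      unfolding infsumI[OF Es[of x]] using lower[OF x] upper[of x] Es[of x] unfolding summable_on_def by blast
    then show "\<exists>A B. 0 < A \<and> (\<forall>x\<in>V. (\<lambda>i. (cmod (cinner x (case i of (j, k) \<Rightarrow> U k (c j))))\<^sup>2) summable_on {..<s} \<times> M \<and>
        A * (norm x)\<^sup>2 \<le> (\<Sum>\<^sub>\<infinity>i\<in>{..<s} \<times> M. (cmod (cinner x (case i of (j, k) \<Rightarrow> U k (c j))))\<^sup>2) \<and>
        (\<Sum>\<^sub>\<infinity>i\<in>{..<s} \<times> M. (cmod (cinner x (case i of (j, k) \<Rightarrow> U k (c j))))\<^sup>2) \<le> B * (norm x)\<^sup>2)"
      by - (rule exI[of _ "A / (L + 1)"], rule exI[of _ "\<Sum>j<s. K j"], intro conjI[OF pos] ballI)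
  qed
  moreover have "c j \<in> V" if "j < s" for j using UcV[OF that H0] by (simp add: U_zero)
  ultimately show ?thesis using expand unfolding frame_expansion_def by blast
qed

text \<open>For x = T F the expansion and the upper frame bound B' bound the fourth power of norm x
  by S B' (norm x)^2, with S the energy of the samples. The lower Riesz bound then passes from x to
  F.\<close>

lemma frame_expansion_lower:
  assumes C: "frame_expansion U M V s b C"
  obtains \<kappa> where "0 < \<kappa>" "\<And>F. F \<in> L2 m \<Longrightarrow> \<kappa> * sqnorm m F \<le> (\<Sum>j<s. sqnorm m (periodize (\<lambda>\<xi>. F \<xi> * G j \<xi>)))"
proof -
  let ?C = "\<lambda>(j, k). C j k"
  have fr: "frame_for V ({..<s} \<times> M) ?C" and
    ex: "\<And>x. x \<in> V \<Longrightarrow> ((\<lambda>(j, k). scaleC (U_system U (b j) x k) (C j k)) has_sum x) ({..<s} \<times> M)"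
    using C unfolding frame_expansion_def by blast+
  obtain B' where B': "\<And>x. x \<in> V \<Longrightarrow> (\<lambda>i. (cmod (cinner x (?C i)))\<^sup>2) summable_on ({..<s} \<times> M)"
    "\<And>x. x \<in> V \<Longrightarrow> (\<Sum>\<^sub>\<infinity>i\<in>{..<s} \<times> M. (cmod (cinner x (?C i)))\<^sup>2) \<le> B' * (norm x)\<^sup>2"
    using fr unfolding frame_for_def by blast
  have "A / (\<bar>B'\<bar> + 1) * sqnorm m F \<le> (\<Sum>j<s. sqnorm m (periodize (\<lambda>\<xi>. F \<xi> * G j \<xi>)))" if F: "F \<in> L2 m" for F
  proof (cases "T F = 0")
    case True
    then have "A * sqnorm m F \<le> 0" using T_lower[OF F] by simp
    then have "sqnorm m F = 0" using A_pos sqnorm_nonneg[of m F] by (simp add: mult_le_0_iff)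
    then show ?thesis by (simp add: sum_nonneg)
  next
    case False
    define S where "S = (\<Sum>j<s. sqnorm m (periodize (\<lambda>\<xi>. F \<xi> * G j \<xi>)))"
    have S0: "0 \<le> S" unfolding S_def by (simp add: sum_nonneg)
    have V: "T F \<in> V" by (rule T_V[OF F])
    have "((norm (T F))\<^sup>2)\<^sup>2 \<le> S * (\<Sum>\<^sub>\<infinity>i\<in>{..<s} \<times> M. (cmod (cinner (T F) (?C i)))\<^sup>2)"
      using has_sum_norm_lower[OF _ samples_has_sum_Times[OF F] has_sum_infsum[OF B'(1)[OF V]]] ex[OF V]
      by (simp add: case_prod_unfold S_def)
    also have "\<dots> \<le> S * (B' * (norm (T F))\<^sup>2)" by (rule mult_left_mono[OF B'(2)[OF V] S0])
    also have "\<dots> \<le> S * ((\<bar>B'\<bar> + 1) * (norm (T F))\<^sup>2)"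
      using S0 by (intro mult_left_mono mult_right_mono) auto
    finally have "(norm (T F))\<^sup>2 * (norm (T F))\<^sup>2 \<le> (norm (T F))\<^sup>2 * ((\<bar>B'\<bar> + 1) * S)"
      by (simp add: power2_eq_square mult_ac)
    then have "(norm (T F))\<^sup>2 \<le> (\<bar>B'\<bar> + 1) * S" by (rule mult_left_le_imp_le) (simp add: False)
    then have "A * sqnorm m F \<le> (\<bar>B'\<bar> + 1) * S" using T_lower[OF F] by linarith
    moreover have "0 < \<bar>B'\<bar> + 1" by simp
    ultimately show ?thesis unfolding S_def[symmetric] by (simp add: divide_le_eq mult.commute)
  qed
  moreover have "0 < A / (\<bar>B'\<bar> + 1)" using A_pos by simp
  ultimately show ?thesis using that by blast
qed

end

lemma complex_countable_dense:
  obtains Q :: "complex set" where "countable Q" "\<And>z. \<exists>q. (\<forall>n. q n \<in> Q) \<and> q \<longlonglongrightarrow> z"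
proof -
  obtain Q :: "complex set" where Q: "countable Q" "\<And>X. open X \<Longrightarrow> X \<noteq> {} \<Longrightarrow> \<exists>d\<in>Q. d \<in> X"
    by (erule countable_dense_setE)
  have "\<exists>q. (\<forall>n. q n \<in> Q) \<and> q \<longlonglongrightarrow> z" for z
  proof -
    have "z \<in> closure Q"
      unfolding closure_approachable
    proof (intro allI impI)
      fix e :: real assume "e > 0"
      then show "\<exists>y\<in>Q. dist y z < e" using Q(2)[of "ball z e"] by (auto simp: dist_commute)
    qed
    then show ?thesis unfolding closure_sequential .
  qed
  then show ?thesis using that Q(1) by blast
qed

section \<open>Test functions and the smallest eigenvalue\<close>

context bounded_system
begin

text \<open>For E inside \<Omega> this takes the value v l on the translate of E by \<mu> l and
  vanishes elsewhere on the dual, so an arbitrary vector v appears as the values over one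
  fibre.\<close>

definition test_fun :: "(nat \<Rightarrow> complex) \<Rightarrow> _" where
  "test_fun v E \<xi> = (\<Sum>l<r. v l * indicator E (neg (\<mu> l) \<boxplus> \<xi>))"

lemma test_fun_L2: assumes "E \<in> sets m" shows "test_fun v E \<in> L2 m"
proof -
  have "(indicator E :: _ \<Rightarrow> complex) \<in> L2 m" by (rule trig_closure_L2[OF trig_closure_indicator[OF assms]])
  then show ?thesis
    unfolding test_fun_def by (intro L2_sum L2_scale translate_L2(1) neg_closed \<mu>_D) auto
qed

lemma test_fun_eq:
  assumes E: "E \<subseteq> \<Omega>" and k: "k < r" and xi: "\<xi> \<in> \<Omega>"
  shows "test_fun v E (\<mu> k \<boxplus> \<xi>) = v k * indicator E \<xi>"
proof -
  have xiD: "\<xi> \<in> D" using xi \<Omega>_D by blast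
  have "v l * indicator E (neg (\<mu> l) \<boxplus> (\<mu> k \<boxplus> \<xi>)) = (if l = k then v k * indicator E \<xi> else 0)"
    if l: "l < r" for l
  proof (cases "l = k")
    case True
    then show ?thesis using neg_translate[OF \<mu>_D[OF k] xiD] by simp
  next
    case False
    have "neg (\<mu> l) \<boxplus> (\<mu> k \<boxplus> \<xi>) \<notin> \<Omega>"
    proof
      assume "neg (\<mu> l) \<boxplus> (\<mu> k \<boxplus> \<xi>) \<in> \<Omega>"
      then have "\<mu> l \<boxplus> (neg (\<mu> l) \<boxplus> (\<mu> k \<boxplus> \<xi>)) \<in> piece l" unfolding piece_def by blast
      then have "\<mu> k \<boxplus> \<xi> \<in> piece l"
        using translate_neg[OF \<mu>_D[OF l] translate_closed[OF \<mu>_D[OF k] xiD]] by simp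
      moreover have "\<mu> k \<boxplus> \<xi> \<in> piece k" using xi unfolding piece_def by blast
      ultimately show False using piece_unique[OF l k] False by blast
    qed
    then show ?thesis using E False by (auto simp: indicator_def)
  qed
  then have "test_fun v E (\<mu> k \<boxplus> \<xi>) = (\<Sum>l<r. if l = k then v k * indicator E \<xi> else 0)"
    unfolding test_fun_def by (intro sum.cong refl) simp
  then show ?thesis using k by (simp add: sum.delta)
qed

lemma integral_indicator_\<Omega>:
  assumes E: "E \<subseteq> \<Omega>" and eq: "\<And>\<xi>. \<xi> \<in> \<Omega> \<Longrightarrow> f \<xi> = indicator E \<xi> * g \<xi>"
  shows "(\<integral>\<xi>. indicator \<Omega> \<xi> * f \<xi> \<partial>m) = (\<integral>\<xi>. indicator E \<xi> * (g \<xi> :: real) \<partial>m)"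
  using E by (intro integral_cong_D) (auto simp: indicator_def eq)

lemma sqnorm_test_fun:
  assumes E: "E \<in> sets m" "E \<subseteq> \<Omega>"
  shows "sqnorm m (test_fun v E) = (\<Sum>k<r. (cmod (v k))\<^sup>2) * measure m E"
proof -
  have "sqnorm m (test_fun v E) = (\<Sum>k<r. (\<integral>\<xi>. indicator \<Omega> \<xi> * (cmod (test_fun v E (\<mu> k \<boxplus> \<xi>)))\<^sup>2 \<partial>m))"
    unfolding sqnorm_def by (rule integral_pieces[OF L2_int[OF test_fun_L2[OF E(1)]]])
  also have "\<dots> = (\<Sum>k<r. (\<integral>\<xi>. indicator E \<xi> * (cmod (v k))\<^sup>2 \<partial>m))"
  proof (intro sum.cong refl integral_indicator_\<Omega>[OF E(2)])
    fix k \<xi> assume "k \<in> {..<r}" "\<xi> \<in> \<Omega>"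
    then show "(cmod (test_fun v E (\<mu> k \<boxplus> \<xi>)))\<^sup>2 = indicator E \<xi> * (cmod (v k))\<^sup>2"
      using test_fun_eq[OF E(2), of k \<xi> v] by (simp add: indicator_def)
  qed
  also have "\<dots> = (\<Sum>k<r. (cmod (v k))\<^sup>2 * measure m E)"
    using E(1) by (intro sum.cong refl) (simp add: mult.commute)
  finally show ?thesis by (simp add: sum_distrib_right)
qed

text \<open>On E the periodization is the row combination divided by r, and it repeats on all r
  pieces: the square contributes 1 / r^2 and the number of pieces r.\<close>

lemma sqnorm_periodize_test_fun:
  assumes E: "E \<in> sets m" "E \<subseteq> \<Omega>" and j: "j < s"
  shows "sqnorm m (periodize (\<lambda>\<xi>. test_fun v E \<xi> * G j \<xi>))
    = (1 / real r) * (\<integral>\<xi>. indicator E \<xi> * (cmod (\<Sum>k<r. GG \<xi> $$ (j, k) * v k))\<^sup>2 \<partial>m)"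
proof -
  let ?K = "periodize (\<lambda>\<xi>. test_fun v E \<xi> * G j \<xi>)"
  have K: "?K \<in> L2 m" by (rule periodize_L2[OF FG_L2[OF test_fun_L2[OF E(1)] j]])
  let ?q = "\<lambda>\<xi>. (1 / real r)\<^sup>2 * (cmod (\<Sum>k<r. GG \<xi> $$ (j, k) * v k))\<^sup>2"
  have val: "(cmod (?K \<xi>))\<^sup>2 = indicator E \<xi> * ?q \<xi>" if xi: "\<xi> \<in> \<Omega>" for \<xi>
  proof -
    have "?K \<xi> = (1 / of_nat r) * (\<Sum>k<r. indicator E \<xi> * (GG \<xi> $$ (j, k) * v k))"
      unfolding periodize_def using xi j
      by (intro arg_cong[where f = "(*) (1 / of_nat r)"] sum.cong refl)
        (simp add: translate_commute[of \<xi>] test_fun_eq[OF E(2) _ xi] GG_entry mult_ac)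
    also have "\<dots> = (1 / of_nat r) * (indicator E \<xi> * (\<Sum>k<r. GG \<xi> $$ (j, k) * v k))"
      by (simp add: sum_distrib_left)
    finally show ?thesis
      by (simp add: norm_mult norm_divide power_mult_distrib power_divide indicator_def)
  qed
  have "sqnorm m ?K = (\<Sum>k<r. (\<integral>\<xi>. indicator \<Omega> \<xi> * (cmod (?K (\<mu> k \<boxplus> \<xi>)))\<^sup>2 \<partial>m))"
    unfolding sqnorm_def by (rule integral_pieces[OF L2_int[OF K]])
  also have "\<dots> = (\<Sum>k<r. (\<integral>\<xi>. indicator E \<xi> * ?q \<xi> \<partial>m))"
  proof (intro sum.cong refl integral_indicator_\<Omega>[OF E(2)])
    fix k \<xi> assume k: "k \<in> {..<r}" and xi: "\<xi> \<in> \<Omega>"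
    then have "?K (\<mu> k \<boxplus> \<xi>) = ?K \<xi>" using \<Omega>_D by (intro periodize_periodic \<mu>_N) auto
    then show "(cmod (?K (\<mu> k \<boxplus> \<xi>)))\<^sup>2 = indicator E \<xi> * ?q \<xi>" using val[OF xi] by simp
  qed
  also have "\<dots> = real r * (\<integral>\<xi>. (1 / real r)\<^sup>2 * (indicator E \<xi> * (cmod (\<Sum>k<r. GG \<xi> $$ (j, k) * v k))\<^sup>2) \<partial>m)"
    by (simp add: mult.left_commute)
  also have "\<dots> = (1 / real r) * (\<integral>\<xi>. indicator E \<xi> * (cmod (\<Sum>k<r. GG \<xi> $$ (j, k) * v k))\<^sup>2 \<partial>m)"
    using r_pos by (simp add: power2_eq_square)
  finally show ?thesis .
qed

lemma row_combination_measurable: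
  "j < s \<Longrightarrow> (\<lambda>\<xi>. (cmod (\<Sum>k<r. GG \<xi> $$ (j, k) * v k))\<^sup>2) \<in> borel_measurable m"
  by (intro cmod_sq_measurable borel_measurable_sum borel_measurable_times GG_measurable
      borel_measurable_const) auto

lemma qform_GG: "qform (GG \<xi>) v = (\<Sum>j<s. (cmod (\<Sum>k<r. GG \<xi> $$ (j, k) * v k))\<^sup>2)"
  using GG_carrier[of \<xi>] by (simp add: qform_def)

lemma qform_measurable: "(\<lambda>\<xi>. qform (GG \<xi>) v) \<in> borel_measurable m"
  unfolding qform_GG by (intro borel_measurable_sum row_combination_measurable) auto

lemma row_combination_integrable:
  assumes E: "E \<in> sets m" and j: "j < s"
  shows "integrable m (\<lambda>\<xi>. indicator E \<xi> * (cmod (\<Sum>k<r. GG \<xi> $$ (j, k) * v k))\<^sup>2)"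
proof -
  have "(\<lambda>\<xi>. \<Sum>k<r. v k * G j (\<xi> \<boxplus> \<mu> k)) \<in> L2 m"
    using j by (intro L2_sum L2_scale translate_L2(2) G_L2 \<mu>_D) auto
  from L2_int[OF this] have "integrable m (\<lambda>\<xi>. (cmod (\<Sum>k<r. GG \<xi> $$ (j, k) * v k))\<^sup>2)"
    using j by (simp add: GG_entry mult.commute)
  from integrable_real_mult_indicator[OF E this] show ?thesis by (simp add: mult.commute)
qed

text \<open>Let E be the part of \<Omega> where the bound fails. The hypothesis, tested on
  \<open>test_fun v E\<close>, bounds \<kappa> S times the measure of E by half of itself, since the
  constant is half of the natural one \<kappa> r. Hence E is null.\<close>

lemma qform_lower_AE:
  assumes \<kappa>: "0 < \<kappa>"
    and lower: "\<And>F. F \<in> L2 m \<Longrightarrow> \<kappa> * sqnorm m F \<le> (\<Sum>j<s. sqnorm m (periodize (\<lambda>\<xi>. F \<xi> * G j \<xi>)))"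
  shows "AE \<xi> in m. \<xi> \<in> \<Omega> \<longrightarrow> (\<kappa> * real r / 2) * (\<Sum>k<r. (cmod (v k))\<^sup>2) \<le> qform (GG \<xi>) v"
proof -
  define S where "S = (\<Sum>k<r. (cmod (v k))\<^sup>2)"
  have S0: "0 \<le> S" unfolding S_def by (rule sum_nonneg) simp
  define c where "c = \<kappa> * real r / 2"
  define E where "E = {\<xi> \<in> space m. \<xi> \<in> \<Omega> \<and> qform (GG \<xi>) v < c * S}"
  have E: "E \<in> sets m"
    unfolding E_def using qform_measurable \<Omega>_sets by measurable
  have E\<Omega>: "E \<subseteq> \<Omega>" by (auto simp: E_def)
  have "\<kappa> * (S * measure m E) \<le> (\<Sum>j<s. sqnorm m (periodize (\<lambda>\<xi>. test_fun v E \<xi> * G j \<xi>)))"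
    using lower[OF test_fun_L2[OF E]] sqnorm_test_fun[OF E E\<Omega>] by (simp add: S_def)
  also have "\<dots> = (1 / real r) * (\<Sum>j<s. (\<integral>\<xi>. indicator E \<xi> * (cmod (\<Sum>k<r. GG \<xi> $$ (j, k) * v k))\<^sup>2 \<partial>m))"
    by (simp add: sqnorm_periodize_test_fun[OF E E\<Omega>] sum_distrib_left)
  also have "(\<Sum>j<s. (\<integral>\<xi>. indicator E \<xi> * (cmod (\<Sum>k<r. GG \<xi> $$ (j, k) * v k))\<^sup>2 \<partial>m))
      = (\<integral>\<xi>. (\<Sum>j<s. indicator E \<xi> * (cmod (\<Sum>k<r. GG \<xi> $$ (j, k) * v k))\<^sup>2) \<partial>m)"
    by (intro Bochner_Integration.integral_sum[symmetric] row_combination_integrable[OF E]) simp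
  also have "\<dots> \<le> (\<integral>\<xi>. indicator E \<xi> * (c * S) \<partial>m)"
  proof (rule integral_mono)
    show "integrable m (\<lambda>\<xi>. \<Sum>j<s. indicator E \<xi> * (cmod (\<Sum>k<r. GG \<xi> $$ (j, k) * v k))\<^sup>2)"
      by (intro Bochner_Integration.integrable_sum row_combination_integrable[OF E]) simp
    show "integrable m (\<lambda>\<xi>. indicator E \<xi> * (c * S))"
      using E by (intro integrable_mult_left integrable_real_indicator) (auto simp: less_top[symmetric])
    fix \<xi>
    show "(\<Sum>j<s. indicator E \<xi> * (cmod (\<Sum>k<r. GG \<xi> $$ (j, k) * v k))\<^sup>2) \<le> indicator E \<xi> * (c * S)"
      unfolding sum_distrib_left[symmetric] qform_GG[symmetric]
      by (auto simp: indicator_def E_def less_imp_le)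
  qed
  also have "\<dots> = c * S * measure m E" using E by simp
  finally have "\<kappa> * (S * measure m E) \<le> (1 / real r) * (c * S * measure m E)"
    using r_pos by (simp add: divide_right_mono)
  then have "\<kappa> * (S * measure m E) \<le> \<kappa> * (S * measure m E) / 2"
    using r_pos by (simp add: c_def)
  then have "\<kappa> * (S * measure m E) \<le> 0" by linarith
  then have "S * measure m E \<le> 0" using \<kappa> by (simp add: mult_le_0_iff)
  then have "S = 0 \<or> measure m E = 0"
    using S0 measure_nonneg[of m E] by (auto simp: mult_le_0_iff)
  then have null: "measure m E = 0"
  proof
    assume "S = 0"
    \<comment> \<open>For S = 0 the bound cannot fail anywhere, because \<open>qform\<close> is
      nonnegative.\<close>
    then have "E = {}" using qform_nonneg[of "GG _" v] by (auto simp: E_def not_less)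
    then show ?thesis by simp
  qed
  then have "E \<in> null_sets m" using E by (simp add: null_sets_def emeasure_eq_measure)
  from AE_not_in[OF this] have "AE \<xi> in m. \<xi> \<in> \<Omega> \<longrightarrow> c * S \<le> qform (GG \<xi>) v"
    using AE_space by eventually_elim (auto simp: E_def)
  then show ?thesis unfolding c_def S_def .
qed

text \<open>The exceptional null set of \<open>qform_lower_AE\<close> depends on v. Countably many v
  with entries in a dense set share one null set, and at each point of \<Omega> outside it
  continuity in v extends the bound to all vectors.\<close>

theorem alpha_pos_of_lower:
  assumes \<kappa>: "0 < \<kappa>"
    and lower: "\<And>F. F \<in> L2 m \<Longrightarrow> \<kappa> * sqnorm m F \<le> (\<Sum>j<s. sqnorm m (periodize (\<lambda>\<xi>. F \<xi> * G j \<xi>)))"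
  shows "0 < alpha_G m \<Omega> GG"
proof -
  define c where "c = \<kappa> * real r / 2"
  have c: "0 < c" using \<kappa> r_pos by (simp add: c_def)
  obtain Q :: "complex set" where Q: "countable Q" "\<And>z. \<exists>q. (\<forall>n. q n \<in> Q) \<and> q \<longlonglongrightarrow> z"
    using complex_countable_dense by blast
  have "countable ({..<r} \<rightarrow>\<^sub>E Q)" by (intro countable_PiE Q(1)) simp
  then have "AE \<xi> in m. \<forall>v\<in>{..<r} \<rightarrow>\<^sub>E Q. \<xi> \<in> \<Omega> \<longrightarrow> c * (\<Sum>k<r. (cmod (v k))\<^sup>2) \<le> qform (GG \<xi>) v"
    unfolding c_def by (intro AE_ball_countable'[OF qform_lower_AE[OF \<kappa> lower]])
  then have "AE \<xi> in m. \<xi> \<in> \<Omega> \<longrightarrow> ereal c \<le> ereal (lambda_min (gram_mat (GG \<xi>)))"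
  proof eventually_elim
    case (elim \<xi>)
    show ?case
    proof
      assume xi: "\<xi> \<in> \<Omega>"
      have "c * (\<Sum>k<r. (cmod (v k))\<^sup>2) \<le> qform (GG \<xi>) v" for v
      proof -
        have "\<forall>k. \<exists>q. (\<forall>n. q n \<in> Q) \<and> q \<longlonglongrightarrow> v k" using Q(2) by blast
        then obtain q where q: "\<And>k n. q k n \<in> Q" "\<And>k. q k \<longlonglongrightarrow> v k" by metis
        define w where "w n = (\<lambda>k\<in>{..<r}. q k n)" for n
        have "c * (\<Sum>k<r. (cmod (w n k))\<^sup>2) \<le> qform (GG \<xi>) (w n)" for n
        proof -
          have "w n \<in> {..<r} \<rightarrow>\<^sub>E Q" unfolding w_def using q(1) by simp
          then show ?thesis using elim xi by blast
        qed
        then have le: "c * (\<Sum>k<r. (cmod (q k n))\<^sup>2) \<le> (\<Sum>j<s. (cmod (\<Sum>k<r. GG \<xi> $$ (j, k) * q k n))\<^sup>2)" for n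
          by (simp add: qform_GG w_def)
        have L: "(\<lambda>n. c * (\<Sum>k<r. (cmod (q k n))\<^sup>2)) \<longlonglongrightarrow> c * (\<Sum>k<r. (cmod (v k))\<^sup>2)"
          by (intro tendsto_intros q(2))
        have R: "(\<lambda>n. \<Sum>j<s. (cmod (\<Sum>k<r. GG \<xi> $$ (j, k) * q k n))\<^sup>2)
            \<longlonglongrightarrow> (\<Sum>j<s. (cmod (\<Sum>k<r. GG \<xi> $$ (j, k) * v k))\<^sup>2)"
          by (intro tendsto_intros q(2))
        show ?thesis unfolding qform_GG using LIMSEQ_le[OF L R] le by blast
      qed
      then show "ereal c \<le> ereal (lambda_min (gram_mat (GG \<xi>)))"
        using lambda_min_ge[OF GG_carrier r_pos] by simp
    qed
  qed
  then show ?thesis unfolding alpha_G_def essinf_pos_iff AE_\<Omega> using c by blast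
qed

theorem det_pos_of_alpha_pos:
  assumes "0 < alpha_G m \<Omega> GG"
  shows "0 < essinf_det m \<Omega> GG"
proof -
  obtain d where d: "0 < d" "AE \<xi> in m. \<xi> \<in> \<Omega> \<longrightarrow> d \<le> lambda_min (gram_mat (GG \<xi>))"
    using assms unfolding alpha_G_def essinf_pos_iff AE_\<Omega> by auto
  have "AE \<xi> in m. \<xi> \<in> \<Omega> \<longrightarrow> ereal (d ^ r) \<le> ereal (Re (Determinant.det (gram_mat (GG \<xi>))))"
    using d(2) by eventually_elim (use det_gram_ge[OF GG_carrier r_pos] d(1) in simp)
  then show ?thesis unfolding essinf_det_def essinf_pos_iff AE_\<Omega> using d(1) by (intro exI[of _ "d ^ r"]) simp
qed

section \<open>The generators of a translation-invariant expansion\<close>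

text \<open>Invariance of F under \<delta> multiplies the coefficient at h by \<delta> h, which
  differs from 1 for a suitable \<delta> in the annihilator.\<close>

lemma fourier_periodic_zero:
  assumes F: "F \<in> borel_measurable m" and per: "\<And>\<nu> \<xi>. \<nu> \<in> N \<Longrightarrow> \<xi> \<in> D \<Longrightarrow> F (\<nu> \<boxplus> \<xi>) = F \<xi>"
    and h: "h \<in> H" "h \<notin> M"
  shows "fourier F h = 0"
proof -
  obtain \<delta> where d: "\<delta> \<in> D" "\<forall>x\<in>M. \<delta> x = 1" "\<delta> h \<noteq> 1"
    using exists_character_separating[OF sub disc M_sub MH h] by blast
  then have "\<delta> \<in> N" by (simp add: annihilator_def)
  have "fourier F h = fourier (\<lambda>\<xi>. F (\<delta> \<boxplus> \<xi>)) h"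
    unfolding fourier_def by (rule integral_cong_D) (simp add: per[OF \<open>\<delta> \<in> N\<close>])
  also have "\<dots> = \<delta> h * fourier F h" by (rule fourier_translate[OF d(1) F h(1)])
  finally show ?thesis using d(3) by simp
qed

text \<open>The upper frame bound says that multiplication by \<open>C\<close> is bounded on the trigonometric
  polynomials with frequencies in \<open>M\<close>; Fatou's lemma extends this to indicators of periodic sets.\<close>

lemma periodic_integral_bound:
  assumes C: "C \<in> L2 m"
    and bd: "\<And>J d. finite J \<Longrightarrow> J \<subseteq> M \<Longrightarrow>
      sqnorm m (\<lambda>\<xi>. (\<Sum>h\<in>J. d h * \<xi> h) * C \<xi>) \<le> \<kappa> * (\<Sum>h\<in>J. (cmod (d h))\<^sup>2)" and \<kappa>: "0 \<le> \<kappa>"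
    and E: "E \<in> sets m" and per: "\<And>\<nu> \<xi>. \<nu> \<in> N \<Longrightarrow> \<xi> \<in> D \<Longrightarrow> \<nu> \<boxplus> \<xi> \<in> E \<longleftrightarrow> \<xi> \<in> E"
  shows "(\<integral>\<xi>. indicator E \<xi> * (cmod (C \<xi>))\<^sup>2 \<partial>m) \<le> \<kappa> * measure m E"
proof -
  let ?F = "indicator E :: _ \<Rightarrow> complex"
  have F: "?F \<in> L2 m" by (rule trig_closure_L2[OF trig_closure_indicator[OF E]])
  have nF: "sqnorm m ?F = measure m E"
  proof -
    have "sqnorm m ?F = (\<integral>\<xi>. indicator E \<xi> \<partial>m)" unfolding sqnorm_def by (rule integral_cong_D) (simp add: indicator_def)
    then show ?thesis using E by simp
  qed
  \<comment> \<open>The indicator of a periodic set has frequencies in M only, so it is approximated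
    by polynomials to which \<open>bd\<close> applies.\<close>
  have zero: "fourier ?F h = 0" if "h \<in> H" "h \<notin> M" for h
    by (rule fourier_periodic_zero[OF L2_meas[OF F] _ that]) (simp add: indicator_def per)
  have PM: "((\<lambda>h. (cmod (fourier ?F h))\<^sup>2) has_sum sqnorm m ?F) M"
  proof -
    have "((\<lambda>h. (cmod (fourier ?F h))\<^sup>2) has_sum sqnorm m ?F) H \<longleftrightarrow> ((\<lambda>h. (cmod (fourier ?F h))\<^sup>2) has_sum sqnorm m ?F) M"
      by (rule has_sum_cong_neutral) (use MH zero in auto)
    then show ?thesis using parseval[OF F] by blast
  qed
  have "\<exists>J. finite J \<and> J \<subseteq> M \<and> sqnorm m (\<lambda>\<xi>. ?F \<xi> - partial_sum ?F J \<xi>) < 1 / real (Suc n)" for n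
  proof -
    have "eventually (\<lambda>J. sqnorm m ?F - 1 / real (Suc n) < (\<Sum>h\<in>J. (cmod (fourier ?F h))\<^sup>2)) (finite_subsets_at_top M)"
      using PM unfolding has_sum_def by (rule order_tendstoD(1)) simp
    then obtain J where J: "finite J" "J \<subseteq> M" "sqnorm m ?F - 1 / real (Suc n) < (\<Sum>h\<in>J. (cmod (fourier ?F h))\<^sup>2)"
      unfolding eventually_finite_subsets_at_top by (meson order_refl)
    then show ?thesis using sqnorm_partial_sum[OF F J(1)] MH by (intro exI[of _ J]) auto
  qed
  then obtain J where J: "\<And>n. finite (J n)" "\<And>n. J n \<subseteq> M" "\<And>n. sqnorm m (\<lambda>\<xi>. ?F \<xi> - partial_sum ?F (J n) \<xi>) < 1 / real (Suc n)"
    by metis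
  have JH: "J n \<subseteq> H" for n using J(2) MH by blast
  let ?u = "\<lambda>n \<xi>. ?F \<xi> - partial_sum ?F (J n) \<xi>"
  have u: "?u n \<in> L2 m" for n by (rule L2_diff(1)[OF F partial_sum_L2[OF JH]])
  have "(\<lambda>n. sqnorm m (?u n)) \<longlonglongrightarrow> 0"
  proof (rule tendsto_sandwich[OF _ _ tendsto_const])
    show "(\<lambda>n. 1 / real (Suc n)) \<longlonglongrightarrow> 0" using LIMSEQ_inverse_real_of_nat by (simp add: inverse_eq_divide)
    show "eventually (\<lambda>n. sqnorm m (?u n) \<le> 1 / real (Suc n)) sequentially"
      using J(3) by (intro always_eventually allI less_imp_le)
  qed simp
  then have nu: "\<exists>n0. \<forall>n\<ge>n0. sqnorm m (?u n) < e" if "e > 0" for e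
    using order_tendstoD(2)[of _ 0 sequentially e] that unfolding eventually_sequentially by blast
  \<comment> \<open>L1 convergence serves to extract a subsequence converging almost everywhere, as
    Fatou's lemma requires.\<close>
  have "(\<lambda>n. \<integral>\<xi>. norm (?u n \<xi>) \<partial>m) \<longlonglongrightarrow> 0"
  proof (rule LIMSEQ_I)
    fix e :: real assume e: "e > 0"
    then obtain n0 where n0: "\<And>n. n \<ge> n0 \<Longrightarrow> sqnorm m (?u n) < e\<^sup>2" using nu[of "e\<^sup>2"] by auto
    have "(\<integral>\<xi>. cmod (?u n \<xi>) \<partial>m) < e" if "n \<ge> n0" for n
    proof -
      have "(\<integral>\<xi>. cmod (?u n \<xi>) \<partial>m) \<le> e / 2 + sqnorm m (?u n) / (2 * e)" by (rule L1_le_sqnorm[OF u e])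
      also have "\<dots> < e / 2 + e\<^sup>2 / (2 * e)"
        using n0[OF that] e by (intro add_strict_left_mono divide_strict_right_mono) auto
      also have "\<dots> = e" using e by (simp add: power2_eq_square)
      finally show ?thesis .
    qed
    then show "\<exists>n0. \<forall>n\<ge>n0. norm ((\<integral>\<xi>. norm (?u n \<xi>) \<partial>m) - 0) < e" by (intro exI[of _ n0]) simp
  qed
  from tendsto_L1_AE_subseq[OF L2_integrable[OF u] this]
  obtain q where q: "AE \<xi> in m. (\<lambda>n. ?u (q n) \<xi>) \<longlonglongrightarrow> 0" by blast
  let ?p = "\<lambda>n. partial_sum ?F (J (q n))"
  have pC: "(\<lambda>\<xi>. ?p n \<xi> * C \<xi>) \<in> L2 m" for n
    unfolding partial_sum_def by (rule T_mult_trig(1)[OF C J(1) JH])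
  have "(\<integral>\<xi>. (cmod (?F \<xi> * C \<xi>))\<^sup>2 \<partial>m) \<le> \<kappa> * sqnorm m ?F"
  proof (rule fatou_bound(2)[of m "\<lambda>n \<xi>. (cmod (?p n \<xi> * C \<xi>))\<^sup>2"])
    show "integrable m (\<lambda>\<xi>. (cmod (?p n \<xi> * C \<xi>))\<^sup>2)" for n by (rule L2_int[OF pC])
    show "(\<integral>\<xi>. (cmod (?p n \<xi> * C \<xi>))\<^sup>2 \<partial>m) \<le> \<kappa> * sqnorm m ?F" for n
    proof -
      have "sqnorm m (\<lambda>\<xi>. ?p n \<xi> * C \<xi>) \<le> \<kappa> * (\<Sum>h\<in>J (q n). (cmod (fourier ?F h))\<^sup>2)"
        unfolding partial_sum_def by (rule bd[OF J(1,2)])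
      also have "\<dots> \<le> \<kappa> * sqnorm m ?F" by (rule mult_left_mono[OF bessel[OF F J(1) JH] \<kappa>])
      finally show ?thesis unfolding sqnorm_def .
    qed
    show "(\<lambda>\<xi>. (cmod (?F \<xi> * C \<xi>))\<^sup>2) \<in> borel_measurable m"
      by (intro cmod_sq_measurable borel_measurable_times L2_meas F C)
    show "AE \<xi> in m. (\<lambda>n. (cmod (?p n \<xi> * C \<xi>))\<^sup>2) \<longlonglongrightarrow> (cmod (?F \<xi> * C \<xi>))\<^sup>2"
      using q
    proof eventually_elim
      case (elim \<xi>)
      have "(\<lambda>n. ?F \<xi> - ?u (q n) \<xi>) \<longlonglongrightarrow> ?F \<xi> - 0" by (intro tendsto_intros elim)
      then have "(\<lambda>n. ?p n \<xi>) \<longlonglongrightarrow> ?F \<xi>" by simp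
      then show ?case by (intro tendsto_intros)
    qed
  qed simp
  moreover have "(\<integral>\<xi>. (cmod (?F \<xi> * C \<xi>))\<^sup>2 \<partial>m) = (\<integral>\<xi>. indicator E \<xi> * (cmod (C \<xi>))\<^sup>2 \<partial>m)"
    by (rule integral_cong_D) (simp add: indicator_def)
  ultimately show ?thesis using nF by simp
qed

text \<open>The set where C is large may fail to be periodic, so the sum q of the squares over a
  fibre is used. On its periodic superlevel set E the integral of q is r times that of the square of
  C, which \<open>periodic_integral_bound\<close> limits to \<kappa> times the measure of E.\<close>

lemma generator_Linf:
  assumes C: "C \<in> L2 m"
    and bd: "\<And>J d. finite J \<Longrightarrow> J \<subseteq> M \<Longrightarrow>
      sqnorm m (\<lambda>\<xi>. (\<Sum>h\<in>J. d h * \<xi> h) * C \<xi>) \<le> \<kappa> * (\<Sum>h\<in>J. (cmod (d h))\<^sup>2)" and \<kappa>: "0 \<le> \<kappa>"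
  shows "C \<in> Linf m"
proof -
  define q where "q \<xi> = (\<Sum>k<r. (cmod (C (\<xi> \<boxplus> \<mu> k)))\<^sup>2)" for \<xi>
  \<comment> \<open>This exceeds r \<kappa> by r, so the comparison leaves r times the measure of E
    at most 0.\<close>
  define t where "t = real r * (\<kappa> + 1)"
  have q_meas [measurable]: "q \<in> borel_measurable m"
    unfolding q_def
    by (intro borel_measurable_sum cmod_sq_measurable translate_measurable_comp(2) \<mu>_D L2_meas[OF C]) simp
  have q_per: "q (\<nu> \<boxplus> \<xi>) = q \<xi>" if "\<nu> \<in> N" for \<nu> \<xi>
  proof -
    have "q (\<nu> \<boxplus> \<xi>) = (\<Sum>k<r. (cmod (C (\<xi> \<boxplus> (\<nu> \<boxplus> \<mu> k))))\<^sup>2)"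
      unfolding q_def by (simp add: translate_assoc[symmetric] translate_commute[of \<xi> \<nu>])
    then show ?thesis unfolding q_def using sum_\<mu>_translate[OF that, of "\<lambda>\<nu>. (cmod (C (\<xi> \<boxplus> \<nu>)))\<^sup>2"] by simp
  qed
  define E where "E = {\<xi> \<in> space m. t < q \<xi>}"
  have E: "E \<in> sets m" unfolding E_def by measurable
  have per: "\<nu> \<boxplus> \<xi> \<in> E \<longleftrightarrow> \<xi> \<in> E" if "\<nu> \<in> N" "\<xi> \<in> D" for \<nu> \<xi>
    using that q_per N_D translate_closed by (simp add: E_def space_m)
  have Ck: "(\<lambda>\<xi>. C (\<xi> \<boxplus> \<mu> k)) \<in> L2 m" if "k < r" for k by (rule translate_L2(2)[OF \<mu>_D[OF that] C])
  have int: "integrable m (\<lambda>\<xi>. indicator E \<xi> * (cmod (C (\<xi> \<boxplus> \<mu> k)))\<^sup>2)" if "k < r" for k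
    using integrable_real_mult_indicator[OF E L2_int[OF Ck[OF that]]] by (simp add: mult.commute)
  have eq: "(\<integral>\<xi>. indicator E \<xi> * (cmod (C (\<xi> \<boxplus> \<mu> k)))\<^sup>2 \<partial>m) = (\<integral>\<xi>. indicator E \<xi> * (cmod (C \<xi>))\<^sup>2 \<partial>m)"
    if k: "k < r" for k
  proof -
    have "(\<integral>\<xi>. indicator E (\<mu> k \<boxplus> \<xi>) * (cmod (C (\<mu> k \<boxplus> \<xi>)))\<^sup>2 \<partial>m) = (\<integral>\<xi>. indicator E \<xi> * (cmod (C \<xi>))\<^sup>2 \<partial>m)"
      by (intro translate_integral[OF \<mu>_D[OF k]] borel_measurable_times borel_measurable_indicator E
          cmod_sq_measurable L2_meas[OF C])
    moreover have "(\<integral>\<xi>. indicator E (\<mu> k \<boxplus> \<xi>) * (cmod (C (\<mu> k \<boxplus> \<xi>)))\<^sup>2 \<partial>m)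
        = (\<integral>\<xi>. indicator E \<xi> * (cmod (C (\<xi> \<boxplus> \<mu> k)))\<^sup>2 \<partial>m)"
      by (rule integral_cong_D) (simp add: indicator_def per[OF \<mu>_N[OF k]] translate_commute[of _ "\<mu> k"])
    ultimately show ?thesis by simp
  qed
  have "t * measure m E = (\<integral>\<xi>. indicator E \<xi> * t \<partial>m)" using E by simp
  also have "\<dots> \<le> (\<integral>\<xi>. (\<Sum>k<r. indicator E \<xi> * (cmod (C (\<xi> \<boxplus> \<mu> k)))\<^sup>2) \<partial>m)"
  proof (rule integral_mono)
    show "integrable m (\<lambda>\<xi>. indicator E \<xi> * t)"
      using E by (intro integrable_mult_left integrable_real_indicator) (auto simp: less_top[symmetric])
    show "integrable m (\<lambda>\<xi>. \<Sum>k<r. indicator E \<xi> * (cmod (C (\<xi> \<boxplus> \<mu> k)))\<^sup>2)"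
      using int by (intro Bochner_Integration.integrable_sum) simp
    show "indicator E \<xi> * t \<le> (\<Sum>k<r. indicator E \<xi> * (cmod (C (\<xi> \<boxplus> \<mu> k)))\<^sup>2)" for \<xi>
      unfolding sum_distrib_left[symmetric] q_def[symmetric] by (auto simp: indicator_def E_def)
  qed
  also have "\<dots> = (\<Sum>k<r. (\<integral>\<xi>. indicator E \<xi> * (cmod (C (\<xi> \<boxplus> \<mu> k)))\<^sup>2 \<partial>m))"
    using int by (intro Bochner_Integration.integral_sum) simp
  also have "\<dots> = real r * (\<integral>\<xi>. indicator E \<xi> * (cmod (C \<xi>))\<^sup>2 \<partial>m)" by (simp add: eq)
  also have "\<dots> \<le> real r * (\<kappa> * measure m E)"
    by (intro mult_left_mono periodic_integral_bound[OF C bd \<kappa> E per]) auto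
  finally have "real r * measure m E \<le> 0" by (simp add: t_def algebra_simps)
  then have "measure m E = 0" using r_pos measure_nonneg[of m E] by (simp add: mult_le_0_iff)
  then have "E \<in> null_sets m" using E by (simp add: null_sets_def emeasure_eq_measure)
  from AE_not_in[OF this] have "AE \<xi> in m. cmod (C \<xi>) \<le> t + 1"
    using AE_space
  proof eventually_elim
    case (elim \<xi>)
    then have xi: "\<xi> \<in> D" and le: "q \<xi> \<le> t" by (auto simp: E_def space_m)
    have "(cmod (C (\<xi> \<boxplus> \<mu> 0)))\<^sup>2 \<le> q \<xi>"
      unfolding q_def using r_pos by (intro member_le_sum[of 0 "{..<r}" "\<lambda>k. (cmod (C (\<xi> \<boxplus> \<mu> k)))\<^sup>2"]) auto
    then have "(cmod (C \<xi>))\<^sup>2 \<le> t" using le by (simp add: tr_\<mu>_0[OF xi])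
    moreover have "0 \<le> t" using \<kappa> by (simp add: t_def)
    \<comment> \<open>The bound t + 1 follows from the square without taking a root.\<close>
    moreover have "2 * cmod (C \<xi>) \<le> (cmod (C \<xi>))\<^sup>2 + 1"
      using zero_le_power2[of "cmod (C \<xi>) - 1"] by (simp add: power2_eq_square algebra_simps)
    ultimately show ?case by linarith
  qed
  then show ?thesis using L2_meas[OF C] unfolding Linf_def by blast
qed

text \<open>For y a combination of translates of one generator, Cauchy-Schwarz bounds the fourth
  power of norm y by the energy of the coefficients times the frame energy of y, which is at most a
  multiple of (norm y)^2. The lower Riesz bound carries this over to the hypothesis of
  \<open>generator_Linf\<close>.\<close>

lemma frame_generator_Linf:
  assumes fr: "frame_for V ({..<s} \<times> M) (\<lambda>(j, k). U k (c j))" and C: "C \<in> L2 m" "c j = T C" and j: "j < s"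
  shows "C \<in> Linf m"
proof -
  obtain B' where B': "\<And>x. x \<in> V \<Longrightarrow> (\<lambda>i. (cmod (cinner x (case i of (j, k) \<Rightarrow> U k (c j))))\<^sup>2) summable_on ({..<s} \<times> M)"
    "\<And>x. x \<in> V \<Longrightarrow> (\<Sum>\<^sub>\<infinity>i\<in>{..<s} \<times> M. (cmod (cinner x (case i of (j, k) \<Rightarrow> U k (c j))))\<^sup>2) \<le> B' * (norm x)\<^sup>2"
    using fr unfolding frame_for_def by blast
  show ?thesis
  proof (rule generator_Linf[OF C(1)])
    show "0 \<le> \<bar>B'\<bar> / A" using A_pos by simp
    fix J d assume J: "finite J" "J \<subseteq> M"
    have JH: "J \<subseteq> H" using J MH by blast
    let ?f = "\<lambda>\<xi>. (\<Sum>h\<in>J. d h * \<xi> h) * C \<xi>"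
    note TC = T_mult_trig[OF C(1) J(1) JH, of d]
    define y where "y = T ?f"
    have yV: "y \<in> V" unfolding y_def by (rule T_V[OF TC(1)])
    have y: "y = (\<Sum>k\<in>J. scaleC (d k) (U k (c j)))" unfolding y_def TC(2) C(2) ..
    define S where "S = (\<Sum>k\<in>J. (cmod (d k))\<^sup>2)"
    have S0: "0 \<le> S" unfolding S_def by (rule sum_nonneg) simp
    have "(\<Sum>k\<in>J. (cmod (cinner y (U k (c j))))\<^sup>2)
        = (\<Sum>i\<in>Pair j ` J. (cmod (cinner y (case i of (j, k) \<Rightarrow> U k (c j))))\<^sup>2)"
      by (subst sum.reindex) (auto simp: inj_on_def)
    also have "\<dots> \<le> (\<Sum>\<^sub>\<infinity>i\<in>{..<s} \<times> M. (cmod (cinner y (case i of (j, k) \<Rightarrow> U k (c j))))\<^sup>2)"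
      using J j by (intro finite_sum_le_infsum[OF B'(1)[OF yV]]) auto
    also have "\<dots> \<le> B' * (norm y)\<^sup>2" by (rule B'(2)[OF yV])
    also have "\<dots> \<le> \<bar>B'\<bar> * (norm y)\<^sup>2" by (intro mult_right_mono) auto
    finally have le: "(\<Sum>k\<in>J. (cmod (cinner y (U k (c j))))\<^sup>2) \<le> \<bar>B'\<bar> * (norm y)\<^sup>2" .
    have "cinner y y = (\<Sum>k\<in>J. d k * cinner (U k (c j)) y)"
      by (subst (1) y) (simp add: cinner_sum_left cinner_scaleC_left)
    then have "((norm y)\<^sup>2)\<^sup>2 = (cmod (\<Sum>k\<in>J. d k * cinner (U k (c j)) y))\<^sup>2"
      by (metis cinner_self norm_of_real abs_power2 power2_abs)
    also have "\<dots> \<le> S * (\<Sum>k\<in>J. (cmod (cinner y (U k (c j))))\<^sup>2)"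
      unfolding S_def by (rule sum_mult_cinner_le[OF J(1)])
    also have "\<dots> \<le> S * (\<bar>B'\<bar> * (norm y)\<^sup>2)" by (rule mult_left_mono[OF le S0])
    finally have *: "(norm y)\<^sup>2 * (norm y)\<^sup>2 \<le> (norm y)\<^sup>2 * (\<bar>B'\<bar> * S)" by (simp add: power2_eq_square mult_ac)
    have "(norm y)\<^sup>2 \<le> \<bar>B'\<bar> * S"
    proof (cases "y = 0")
      case True
      then show ?thesis using S0 by simp
    next
      case False
      show ?thesis using * by (rule mult_left_le_imp_le) (simp add: False)
    qed
    then have "A * sqnorm m ?f \<le> \<bar>B'\<bar> * S" using T_lower[OF TC(1)] unfolding y_def by linarith
    then show "sqnorm m ?f \<le> \<bar>B'\<bar> / A * (\<Sum>h\<in>J. (cmod (d h))\<^sup>2)"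
      using A_pos unfolding S_def by (simp add: field_simps)
  qed
qed

text \<open>Cancelling \<mu> l gives two points of \<Omega> that differ by some \<mu> t. The second
  lies in piece t and, being in \<Omega>, also in piece 0, so t = 0 by disjointness.\<close>

lemma piece_translate_unique:
  assumes xi: "\<xi> \<in> D" and kl: "k < r" "k' < r" "l < r" and "\<xi> \<boxplus> \<mu> k \<in> piece l" "\<xi> \<boxplus> \<mu> k' \<in> piece l"
  shows "k = k'"
proof -
  obtain \<omega> \<omega>' where w: "\<omega> \<in> \<Omega>" "\<xi> \<boxplus> \<mu> k = \<mu> l \<boxplus> \<omega>" and w': "\<omega>' \<in> \<Omega>" "\<xi> \<boxplus> \<mu> k' = \<mu> l \<boxplus> \<omega>'"
    using assms by (auto simp: piece_def)
  have wD: "\<omega> \<in> D" "\<omega>' \<in> D" using w w' \<Omega>_D by auto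
  have "neg (\<mu> k) \<boxplus> \<mu> k' \<in> N" by (intro translate_N neg_N \<mu>_N kl)
  then obtain t where t: "t < r" "neg (\<mu> k) \<boxplus> \<mu> k' = \<mu> t" using \<mu>_bij by (auto simp: bij_betw_def)
  have "\<mu> l \<boxplus> (\<mu> t \<boxplus> \<omega>) = \<mu> t \<boxplus> (\<mu> l \<boxplus> \<omega>)" by (metis translate_assoc translate_commute)
  also have "\<dots> = \<mu> t \<boxplus> (\<mu> k \<boxplus> \<xi>)" using w(2) by (simp add: translate_commute[of \<xi>])
  also have "\<dots> = neg (\<mu> k) \<boxplus> \<mu> k' \<boxplus> (\<mu> k \<boxplus> \<xi>)" using t(2) by simp
  also have "\<dots> = neg (\<mu> k) \<boxplus> (\<mu> k \<boxplus> (\<mu> k' \<boxplus> \<xi>))"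
  proof -
    have "\<mu> k' \<boxplus> (\<mu> k \<boxplus> \<xi>) = \<mu> k \<boxplus> (\<mu> k' \<boxplus> \<xi>)" by (metis translate_assoc translate_commute)
    then show ?thesis by (simp only: translate_assoc[of "neg (\<mu> k)"])
  qed
  also have "\<dots> = \<mu> k' \<boxplus> \<xi>" by (intro neg_translate \<mu>_D translate_closed kl xi)
  also have "\<dots> = \<mu> l \<boxplus> \<omega>'" using w'(2) by (simp add: translate_commute[of \<xi>])
  finally have "\<mu> t \<boxplus> \<omega> = \<omega>'"
    using translate_cancel[OF \<mu>_D[OF kl(3)] translate_closed[OF \<mu>_D[OF t(1)] wD(1)] wD(2)] by blast
  then have "\<omega>' \<in> piece t" using w(1) unfolding piece_def by blast
  moreover have "\<omega>' \<in> piece 0"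
    using w'(1) zero_translate[OF wD(2)] unfolding piece_def \<mu>_0 by (metis imageI)
  ultimately have "t = 0" using piece_unique[OF t(1) r_pos] by blast
  then have "\<mu> k \<boxplus> (neg (\<mu> k) \<boxplus> \<mu> k') = \<mu> k" using t(2) translate_zero[OF \<mu>_D[OF kl(1)]] by (simp add: \<mu>_0)
  then have "\<mu> k' = \<mu> k" using translate_neg[OF \<mu>_D[OF kl(1)] \<mu>_D[OF kl(2)]] by simp
  then show ?thesis using \<mu>_eq_iff[OF kl(1,2)] by simp
qed

text \<open>The expansion holds in particular for the indicators of the r pieces. At \<xi> the piece
  containing the translate by \<mu> k isolates one term of every periodization, and the
  reconstructed value is the k-th entry of the left inverse identity.\<close>

theorem generators_of_expansion:
  assumes c: "\<And>j. j < s \<Longrightarrow> c j \<in> V" and ex: "frame_expansion U M V s b (\<lambda>j k. U k (c j))"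
  shows "\<exists>F. left_inverse_row m s r GG F \<and> (\<forall>j<s. c j = T_iso m U H a (\<lambda>\<xi>. of_nat r * F j \<xi>))"
proof -
  have fr: "frame_for V ({..<s} \<times> M) (\<lambda>(j, k). U k (c j))"
    and hs: "\<And>x. x \<in> V \<Longrightarrow> ((\<lambda>(j, k). scaleC (U_system U (b j) x k) (U k (c j))) has_sum x) ({..<s} \<times> M)"
    using ex unfolding frame_expansion_def by blast+
  have "\<exists>C. C \<in> L2 m \<and> c j = T C" if "j < s" for j using V_T[OF c[OF that]] by metis
  then obtain C where C: "\<And>j. j < s \<Longrightarrow> C j \<in> L2 m" "\<And>j. j < s \<Longrightarrow> c j = T (C j)" by metis
  have CL: "C j \<in> Linf m" if "j < s" for j
    by (rule frame_generator_Linf[OF fr C(1)[OF that] C(2)[OF that] that])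
  define F where "F j \<xi> = (1 / of_nat r) * C j \<xi>" for j \<xi>
  have FL: "F j \<in> Linf m" if j: "j < s" for j
  proof -
    obtain K where K: "AE \<xi> in m. cmod (C j \<xi>) \<le> K" and Cm: "C j \<in> borel_measurable m"
      using CL[OF j] by (auto simp: Linf_def)
    have "AE \<xi> in m. cmod (F j \<xi>) \<le> 1 / real r * K"
      using K by eventually_elim (simp add: F_def norm_divide divide_right_mono)
    moreover have "F j \<in> borel_measurable m" unfolding F_def using Cm by simp
    ultimately show ?thesis unfolding Linf_def by blast
  qed
  have recon: "AE \<xi> in m. (\<Sum>j<s. C j \<xi> * periodize (\<lambda>\<xi>. K \<xi> * G j \<xi>) \<xi>) = K \<xi>" if K: "K \<in> L2 m" for K
  proof -
    have "((\<lambda>(j, k). scaleC (U_system U (b j) (T K) k) (U k (T (C j)))) has_sum T K) ({..<s} \<times> M)"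
      using hs[OF T_V[OF K]]
      by (subst has_sum_cong[where g = "\<lambda>(j, k). scaleC (U_system U (b j) (T K) k) (U k (c j))"])
        (auto simp: C(2))
    moreover have "\<forall>j<s. C j \<in> Linf m" using CL by blast
    ultimately have "T (\<lambda>\<xi>. \<Sum>j<s. C j \<xi> * periodize (\<lambda>\<xi>. K \<xi> * G j \<xi>) \<xi>) = T K"
      using has_sum_unique[OF expansion_has_sum[OF K]] by blast
    moreover have "(\<lambda>\<xi>. \<Sum>j<s. C j \<xi> * periodize (\<lambda>\<xi>. K \<xi> * G j \<xi>) \<xi>) \<in> L2 m"
      using CL by (intro L2_sum L2_mult_Linf periodize_L2 FG_L2 K) auto
    ultimately show ?thesis using T_inj K by blast
  qed
  \<comment> \<open>The piece used below depends on \<xi>, so all r of them are tested; being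
    finitely many, they share one exceptional null set.\<close>
  have "AE \<xi> in m. \<forall>l\<in>{..<r}. (\<Sum>j<s. C j \<xi> * periodize (\<lambda>\<xi>. indicator (piece l) \<xi> * G j \<xi>) \<xi>) = indicator (piece l) \<xi>"
    by (intro AE_finite_allI recon trig_closure_L2 trig_closure_indicator piece_sets) auto
  then have "AE \<xi> in m. \<forall>k<r. (\<Sum>j<s. F j \<xi> * G j (\<xi> \<boxplus> \<mu> k)) = (if k = 0 then 1 else 0)"
    using AE_space
  proof eventually_elim
    case (elim \<xi>)
    then have xi: "\<xi> \<in> D" by (simp add: space_m)
    show ?case
    proof (intro allI impI)
      fix k assume k: "k < r"
      obtain l where l: "l < r" "\<xi> \<boxplus> \<mu> k \<in> piece l" using piece_cover[OF translate_closed[OF xi \<mu>_D[OF k]]] by blast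
      have ind: "indicator (piece l) (\<xi> \<boxplus> \<mu> k') = (if k' = k then 1 else (0::complex))" if "k' < r" for k'
      proof (cases "k' = k")
        case True
        then show ?thesis using l(2) by simp
      next
        case False
        then have "\<xi> \<boxplus> \<mu> k' \<notin> piece l" using piece_translate_unique[OF xi that k l(1) _ l(2)] by blast
        then show ?thesis using False by simp
      qed
      have periodize: "periodize (\<lambda>\<xi>. indicator (piece l) \<xi> * G j \<xi>) \<xi> = (1 / of_nat r) * G j (\<xi> \<boxplus> \<mu> k)" for j
      proof -
        have "(\<Sum>k'<r. indicator (piece l) (\<xi> \<boxplus> \<mu> k') * G j (\<xi> \<boxplus> \<mu> k'))
            = (\<Sum>k'<r. if k' = k then G j (\<xi> \<boxplus> \<mu> k) else 0)"
          by (intro sum.cong refl) (simp add: ind)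
        also have "\<dots> = G j (\<xi> \<boxplus> \<mu> k)" using k by (simp add: sum.delta)
        finally show ?thesis unfolding periodize_def by simp
      qed
      have "(\<Sum>j<s. F j \<xi> * G j (\<xi> \<boxplus> \<mu> k)) = (\<Sum>j<s. C j \<xi> * periodize (\<lambda>\<xi>. indicator (piece l) \<xi> * G j \<xi>) \<xi>)"
        unfolding periodize F_def by (simp add: mult_ac)
      also have "\<dots> = indicator (piece l) \<xi>" using elim(1) l(1) by blast
      \<comment> \<open>Writing \<xi> as its translate by \<mu> 0 makes \<open>ind\<close>
        applicable with index 0: the piece contains \<xi> exactly when k = 0.\<close>
      also have "\<dots> = indicator (piece l) (\<xi> \<boxplus> \<mu> 0)" by (simp add: tr_\<mu>_0[OF xi])
      also have "\<dots> = (if k = 0 then 1 else 0)" using ind[OF r_pos] by simp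
      finally show "(\<Sum>j<s. F j \<xi> * G j (\<xi> \<boxplus> \<mu> k)) = (if k = 0 then 1 else 0)" .
    qed
  qed
  then have "left_inverse_row m s r GG F" unfolding left_inverse_row_iff using FL by blast
  moreover have "c j = T_iso m U H a (\<lambda>\<xi>. of_nat r * F j \<xi>)" if j: "j < s" for j
  proof -
    have "(\<lambda>\<xi>. of_nat r * F j \<xi>) = C j" using r_pos by (simp add: F_def)
    then show ?thesis using T_iso_eq[OF C(1)[OF j]] C(2)[OF j] by simp
  qed
  ultimately show ?thesis by blast
qed

end

section \<open>Equivalence of the five conditions and the form of the generators\<close>

theorem theorem1:
  fixes H M :: "'g::{topological_ab_group_add, second_countable_topology, t2_space} set"
    and U :: "'g \<Rightarrow> 'h::complex_hilbert_space \<Rightarrow> 'h"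
    and a :: 'h and b :: "nat \<Rightarrow> 'h" and s r :: nat
    and m :: "('g \<Rightarrow> complex) measure"
    and \<mu> :: "nat \<Rightarrow> 'g \<Rightarrow> complex" and \<Omega> :: "('g \<Rightarrow> complex) set"
    and G :: "nat \<Rightarrow> ('g \<Rightarrow> complex) \<Rightarrow> complex"
    and GG :: "('g \<Rightarrow> complex) \<Rightarrow> complex mat" and V :: "'h set"
  assumes "locally_compact_space (euclidean :: 'g topology)"
    and "uniform_lattice H" and "uniform_lattice M" and "M \<subseteq> H"
    and "countable H" and "countable M"
    and "normalized_haar_measure H m"
    and "unitary_representation U"
    and "riesz_sequence H (\<lambda>h. U h a)"
    and "V = closed_orbit_span U H a"
    and "bij_betw \<mu> {..<r} (annihilator H M)" and "\<mu> 0 = dual_zero H"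
    and "borel_section H m (annihilator H M) \<Omega>"
    and "1 \<le> s"
    and "\<forall>j<s. L2_has_sum m (\<lambda>h \<gamma>. U_system U (b j) a h * \<gamma> h) (G j) H"
    and "GG = G_mat H s r \<mu> G"
  shows
    "((\<forall>j<s. G j \<in> Linf m) \<longleftrightarrow> beta_G m \<Omega> GG < \<infinity>) \<and>
     ((\<forall>j<s. G j \<in> Linf m) \<longrightarrow>
       (0 < essinf_det m \<Omega> GG \<longleftrightarrow> 0 < alpha_G m \<Omega> GG) \<and>
       (0 < alpha_G m \<Omega> GG \<longleftrightarrow> (\<exists>F. left_inverse_row m s r GG F)) \<and>
       ((\<exists>F. left_inverse_row m s r GG F) \<longleftrightarrow>
         (\<exists>c. (\<forall>j<s. c j \<in> V) \<and> frame_expansion U M V s b (\<lambda>j k. U k (c j)))) \<and>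
       ((\<exists>c. (\<forall>j<s. c j \<in> V) \<and> frame_expansion U M V s b (\<lambda>j k. U k (c j))) \<longleftrightarrow>
         (\<exists>C. frame_expansion U M V s b C)) \<and>
       (\<forall>c. (\<forall>j<s. c j \<in> V) \<and> frame_expansion U M V s b (\<lambda>j k. U k (c j)) \<longrightarrow>
         (\<exists>F. left_inverse_row m s r GG F \<and>
           (\<forall>j<s. c j = T_iso m U H a (\<lambda>\<xi>. of_nat r * F j \<xi>)))))"
proof -
  obtain A B where A: "0 < A"
    and AB: "\<And>J \<alpha>. finite J \<and> J \<subseteq> H \<Longrightarrow>
      A * (\<Sum>i\<in>J. (cmod (\<alpha> i))\<^sup>2) \<le> (norm (\<Sum>i\<in>J. scaleC (\<alpha> i) (U i a)))\<^sup>2 \<and>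
      (norm (\<Sum>i\<in>J. scaleC (\<alpha> i) (U i a)))\<^sup>2 \<le> B * (\<Sum>i\<in>J. (cmod (\<alpha> i))\<^sup>2)"
    using assms(9) unfolding riesz_sequence_def by blast
  interpret sampled_system H m M r \<mu> \<Omega> U a A B b s G
  proof unfold_locales
    show "add_subgroup H" "discrete H" "add_subgroup M"
      using assms(2,3) by (simp_all only: uniform_lattice_def)
    show "A * (\<Sum>h\<in>J. (cmod (\<alpha> h))\<^sup>2) \<le> (norm (\<Sum>h\<in>J. scaleC (\<alpha> h) (U h a)))\<^sup>2"
      "(norm (\<Sum>h\<in>J. scaleC (\<alpha> h) (U h a)))\<^sup>2 \<le> B * (\<Sum>h\<in>J. (cmod (\<alpha> h))\<^sup>2)"
      if "finite J" "J \<subseteq> H" for J \<alpha>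
      using AB[of J \<alpha>] that by blast+
    show "L2_has_sum m (\<lambda>h \<gamma>. U_system U (b j) a h * \<gamma> h) (G j) H" if "j < s" for j
      using assms(15) that by blast
  qed (fact assms A)+
  have V: "V = closed_orbit_span U H a" and GG: "GG = G_mat H s r \<mu> G" by fact+
  show ?thesis
    unfolding V GG
  proof (intro conjI Linf_iff_beta_finite impI)
    assume GL: "\<forall>j<s. G j \<in> Linf m"
    then interpret bounded_system H m M r \<mu> \<Omega> U a A B b s G
      by unfold_locales blast
    let ?GG = "G_mat H s r \<mu> G" and ?V = "closed_orbit_span U H a"
    let ?d = "\<exists>c. (\<forall>j<s. c j \<in> ?V) \<and> frame_expansion U M ?V s b (\<lambda>j k. U k (c j))"
    \<comment> \<open>The letters a to e stand for the determinant, the smallest eigenvalue, the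
      left inverse, the translates of s generators and the general frame. The five implications
      close a cycle, of which each equivalence is a propositional consequence.\<close>
    have ac: "0 < essinf_det m \<Omega> ?GG \<Longrightarrow> \<exists>F. left_inverse_row m s r ?GG F"
      by (rule left_inverse_of_det)
    have cd: "\<exists>F. left_inverse_row m s r ?GG F \<Longrightarrow> ?d"
      using frame_expansion_of_left_inverse by blast
    have de: "?d \<Longrightarrow> \<exists>C. frame_expansion U M ?V s b C" by blast
    have eb: "0 < alpha_G m \<Omega> ?GG" if e: "\<exists>C. frame_expansion U M ?V s b C"
    proof -
      obtain C where C: "frame_expansion U M ?V s b C" using e by blast
      then obtain \<kappa> where "0 < \<kappa>"
        "\<And>F. F \<in> L2 m \<Longrightarrow> \<kappa> * sqnorm m F \<le> (\<Sum>j<s. sqnorm m (periodize (\<lambda>\<xi>. F \<xi> * G j \<xi>)))"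
        by (rule frame_expansion_lower) blast
      then show ?thesis by (rule alpha_pos_of_lower)
    qed
    have ba: "0 < alpha_G m \<Omega> ?GG \<Longrightarrow> 0 < essinf_det m \<Omega> ?GG"
      by (rule det_pos_of_alpha_pos)
    show "0 < essinf_det m \<Omega> ?GG \<longleftrightarrow> 0 < alpha_G m \<Omega> ?GG"
      using ac cd de eb ba by argo
    show "0 < alpha_G m \<Omega> ?GG \<longleftrightarrow> (\<exists>F. left_inverse_row m s r ?GG F)"
      using ac cd de eb ba by argo
    show "(\<exists>F. left_inverse_row m s r ?GG F) \<longleftrightarrow> ?d"
      using ac cd de eb ba by argo
    show "?d \<longleftrightarrow> (\<exists>C. frame_expansion U M ?V s b C)"
      using ac cd de eb ba by argo
    show "\<forall>c. (\<forall>j<s. c j \<in> ?V) \<and> frame_expansion U M ?V s b (\<lambda>j k. U k (c j)) \<longrightarrow>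
         (\<exists>F. left_inverse_row m s r ?GG F \<and> (\<forall>j<s. c j = T_iso m U H a (\<lambda>\<xi>. of_nat r * F j \<xi>)))"
      using generators_of_expansion by blast
  qed
qed

end
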